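(* Let $p>3$ be a prime. Then $$\sum_{k=1}^{p-1}\binom{2k}{k}^3\frac{O_k}{64^k}\equiv \begin{cases} 0 & \text{if } p\equiv 1 \pmod 4,\\[2mm] -\frac{p}{12}\,\Gamma_p^4\left(\frac{1}{4}\right) & \text{if } p\equiv 3 \pmod 4, \end{cases}\pmod{p^2}$$ and $$\sum_{k=1}^{p-1}\binom{2k}{k}^3\frac{O_k^{(2)}}{64^k}\equiv \begin{cases} \frac{1}{2}\,\Gamma_p^4\left(\frac{1}{4}\right)E_{p-3} & \text{if } p\equiv 1 \pmod 4,\\[2mm] -\frac{1}{16}\,\Gamma_p^4\left(\frac{1}{4}\right) & \text{if } p\equiv 3 \pmod 4, \end{cases}\pmod{p}.$$
   Context: For integers $k\ge 0$ and $r\ge1$, $O_k^{(r)}=\sum_{j=1}^{k}\frac{1}{(2j-1)^r}$ and $O_k=O_k^{(1)}$. $E_n$ denotes the $n$-th Euler number, $\frac{2}{e^t+e^{-t}}=\sum_{n\ge0}E_n\frac{t^n}{n!}$ (so $E_0=1$, $E_2=-1$, $E_4=5$). $\Gamma_p:\mathbb{Z}_p\to\mathbb{Z}_p$ is Morita's $p$-adic Gamma function, the continuous extension to $\mathbb{Z}_p$ of $n\mapsto(-1)^n\prod_{0\le k<n,\ (k,p)=1}k$ for integers $n>1$; $\Gamma_p^4(x)$ means $(\Gamma_p(x))^4$. Congruences are between elements of $\mathbb{Z}_p$ (the sums and right-hand sides are $p$-adic integers): $a\equiv b\pmod{p^r}$ means $a-b\in p^r\mathbb{Z}_p$. *)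

theory Defs
  imports
    "HOL-Algebra.Ideal"
    "HOL-Analysis.Analysis"
    "HOL-Computational_Algebra.Computational_Algebra"
    "HOL-Number_Theory.Number_Theory"
begin

text \<open>
  \<open>Zp p\<close> is the inverse limit of the rings \<open>\<int>/p\<^sup>n\<int>\<close>: a \<open>p\<close>-adic integer \<open>x\<close> is the coherent
  sequence of its residues, \<open>x n\<close> being the representative in \<open>{0..<p\<^sup>n}\<close> of \<open>x\<close> modulo \<open>p\<^sup>n\<close>.
\<close>

definition Zp :: "nat \<Rightarrow> (nat \<Rightarrow> int) ring" where
  "Zp p = \<lparr>
     carrier = {x. \<forall>n. x n \<in> {0..<int p ^ n} \<and> x (Suc n) mod int p ^ n = x n},
     monoid.mult = (\<lambda>x y n. (x n * y n) mod int p ^ n),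
     monoid.one = (\<lambda>n. 1 mod int p ^ n),
     ring.zero = (\<lambda>n. 0),
     ring.add = (\<lambda>x y n. (x n + y n) mod int p ^ n)\<rparr>"

definition Zp_of_int :: "nat \<Rightarrow> int \<Rightarrow> nat \<Rightarrow> int" where
  "Zp_of_int p a = (\<lambda>n. a mod int p ^ n)"

definition p_integral :: "nat \<Rightarrow> rat \<Rightarrow> bool" where
  "p_integral p q \<longleftrightarrow> \<not> int p dvd snd (quotient_of q)"

text \<open>Only meaningful for \<open>p_integral p q\<close>; otherwise the denominator is not a unit of \<open>Zp p\<close>.\<close>

definition Zp_of_rat :: "nat \<Rightarrow> rat \<Rightarrow> nat \<Rightarrow> int" where
  "Zp_of_rat p q =
     (case quotient_of q of (a, b) \<Rightarrow> Zp_of_int p a \<otimes>\<^bsub>Zp p\<^esub> inv\<^bsub>Zp p\<^esub> (Zp_of_int p b))"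

definition Zp_cong :: "nat \<Rightarrow> nat \<Rightarrow> (nat \<Rightarrow> int) \<Rightarrow> (nat \<Rightarrow> int) \<Rightarrow> bool" where
  "Zp_cong p r x y \<longleftrightarrow> x \<ominus>\<^bsub>Zp p\<^esub> y \<in> PIdl\<^bsub>Zp p\<^esub> (Zp_of_int p (int p ^ r))"

definition Gamma_int :: "nat \<Rightarrow> nat \<Rightarrow> int" where
  "Gamma_int p n = (-1) ^ n * (\<Prod>k | k < n \<and> coprime k p. int k)"

text \<open>
  \<open>continuous_on\<close> refers to the product topology on \<open>nat \<Rightarrow> int\<close> (with \<open>int\<close> discrete), which
  induces the \<open>p\<close>-adic topology on \<open>carrier (Zp p)\<close>. For odd primes \<open>p\<close> the description below
  determines a unique function, see \<open>ex1_Gamma_extension\<close>.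
\<close>

definition is_Gamma_extension :: "nat \<Rightarrow> ((nat \<Rightarrow> int) \<Rightarrow> nat \<Rightarrow> int) \<Rightarrow> bool" where
  "is_Gamma_extension p f \<longleftrightarrow>
     f \<in> carrier (Zp p) \<rightarrow>\<^sub>E carrier (Zp p) \<and>
     continuous_on (carrier (Zp p)) f \<and>
     (\<forall>n>1. f (Zp_of_int p (int n)) = Zp_of_int p (Gamma_int p n))"

definition padic_Gamma :: "nat \<Rightarrow> (nat \<Rightarrow> int) \<Rightarrow> nat \<Rightarrow> int" where
  "padic_Gamma p = (THE f. is_Gamma_extension p f)"

definition odd_harmonic :: "nat \<Rightarrow> nat \<Rightarrow> rat" where
  "odd_harmonic r k = (\<Sum>j=1..k. 1 / (2 * of_nat j - 1) ^ r)"

definition euler_number :: "nat \<Rightarrow> rat" where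
  "euler_number n = fact n * fps_nth (2 / (fps_exp 1 + fps_exp (-1))) n"

lemma Zp_carrier_iff:
  "x \<in> carrier (Zp p) \<longleftrightarrow> (\<forall>n. 0 \<le> x n \<and> x n < int p ^ n \<and> x (Suc n) mod int p ^ n = x n)"
  by (auto simp: Zp_def)

lemma Zp_simps:
  "x \<otimes>\<^bsub>Zp p\<^esub> y = (\<lambda>n. (x n * y n) mod int p ^ n)"
  "\<one>\<^bsub>Zp p\<^esub> = Zp_of_int p 1"
  "\<zero>\<^bsub>Zp p\<^esub> = Zp_of_int p 0"
  "x \<oplus>\<^bsub>Zp p\<^esub> y = (\<lambda>n. (x n + y n) mod int p ^ n)"
  by (simp_all add: Zp_def Zp_of_int_def)

lemma mod_power_Suc_mod: "(a::int) mod q ^ Suc n mod q ^ n = a mod q ^ n"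
  by (simp add: mod_mod_cancel)

lemma Zp_carrierI:
  assumes "p > 0" "\<And>n. [x (Suc n) = x n] (mod int p ^ n)"
  shows "(\<lambda>n. x n mod int p ^ n) \<in> carrier (Zp p)"
  using assms unfolding Zp_carrier_iff mod_power_Suc_mod by (auto simp: cong_def)

lemma Zp_of_int_carrier: "p > 0 \<Longrightarrow> Zp_of_int p a \<in> carrier (Zp p)"
  unfolding Zp_of_int_def by (rule Zp_carrierI) auto

lemma Zp_coherent: "x \<in> carrier (Zp p) \<Longrightarrow> [x (Suc n) = x n] (mod int p ^ n)"
  unfolding Zp_carrier_iff cong_def by (metis mod_mod_trivial)

lemma Zp_mod: "x \<in> carrier (Zp p) \<Longrightarrow> x n mod int p ^ n = x n"
  unfolding Zp_carrier_iff by auto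

lemma Zp_closed:
  assumes "p > 0" "x \<in> carrier (Zp p)" "y \<in> carrier (Zp p)"
  shows "x \<oplus>\<^bsub>Zp p\<^esub> y \<in> carrier (Zp p)" "x \<otimes>\<^bsub>Zp p\<^esub> y \<in> carrier (Zp p)"
  unfolding Zp_simps
  by (rule Zp_carrierI[OF assms(1)], intro cong_add cong_mult Zp_coherent assms)+

lemma cring_Zp:
  assumes "p > 0"
  shows "cring (Zp p)"
proof (rule cringI)
  show "abelian_group (Zp p)"
  proof (rule abelian_groupI)
    fix x assume x: "x \<in> carrier (Zp p)"
    let ?y = "\<lambda>n. (- x n) mod int p ^ n"
    have "?y \<in> carrier (Zp p)"
      using assms Zp_coherent[OF x] by (intro Zp_carrierI) (auto simp: cong_minus_minus_iff)
    moreover have "?y \<oplus>\<^bsub>Zp p\<^esub> x = \<zero>\<^bsub>Zp p\<^esub>"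
      by (auto simp: Zp_simps Zp_of_int_def mod_simps)
    ultimately show "\<exists>y\<in>carrier (Zp p). y \<oplus>\<^bsub>Zp p\<^esub> x = \<zero>\<^bsub>Zp p\<^esub>" by blast
  next
    fix x y z assume "x \<in> carrier (Zp p)" "y \<in> carrier (Zp p)" "z \<in> carrier (Zp p)"
    show "x \<oplus>\<^bsub>Zp p\<^esub> y \<oplus>\<^bsub>Zp p\<^esub> z = x \<oplus>\<^bsub>Zp p\<^esub> (y \<oplus>\<^bsub>Zp p\<^esub> z)"
      by (auto simp: Zp_simps mod_simps add_ac)
  next
    fix x y
    show "x \<oplus>\<^bsub>Zp p\<^esub> y = y \<oplus>\<^bsub>Zp p\<^esub> x" by (auto simp: Zp_simps add_ac)
  qed (use assms in \<open>auto simp: Zp_closed Zp_simps(3) Zp_of_int_carrier\<close>,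
       auto simp: Zp_simps Zp_of_int_def Zp_mod)
next
  show "Group.comm_monoid (Zp p)"
  proof (rule Group.comm_monoidI)
    fix x y z
    show "x \<otimes>\<^bsub>Zp p\<^esub> y \<otimes>\<^bsub>Zp p\<^esub> z = x \<otimes>\<^bsub>Zp p\<^esub> (y \<otimes>\<^bsub>Zp p\<^esub> z)"
      by (auto simp: Zp_simps mod_simps mult_ac)
  next
    fix x y
    show "x \<otimes>\<^bsub>Zp p\<^esub> y = y \<otimes>\<^bsub>Zp p\<^esub> x" by (auto simp: Zp_simps mult_ac)
  qed (use assms in \<open>auto simp: Zp_closed Zp_simps(2) Zp_of_int_carrier\<close>,
       auto simp: Zp_simps Zp_of_int_def mod_simps Zp_mod)
qed (auto simp: Zp_simps mod_simps algebra_simps)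

lemma Zp_of_int_unit:
  assumes p: "prime p" and b: "\<not> int p dvd b"
  shows "Zp_of_int p b \<in> Units (Zp p)"
proof -
  have p0: "p > 0" using p by (rule prime_gt_0_nat)
  have cop: "coprime b (int p ^ n)" for n
    using p b by (metis coprime_commute coprime_power_right_iff prime_imp_coprime prime_nat_int_transfer)
  let ?c = "\<lambda>n. modular_inverse (int p ^ n) b mod int p ^ n"
  have inv: "[b * modular_inverse (int p ^ n) b = 1] (mod int p ^ n)" for n
    using cop by (rule cong_modular_inverse1)
  have "[modular_inverse (int p ^ Suc n) b = modular_inverse (int p ^ n) b] (mod int p ^ n)" for n
  proof -
    have "[b * modular_inverse (int p ^ Suc n) b = 1] (mod int p ^ n)"
      using inv[of "Suc n"] by (rule cong_dvd_modulus) simp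
    then have "[b * modular_inverse (int p ^ Suc n) b = b * modular_inverse (int p ^ n) b] (mod int p ^ n)"
      using inv[of n] by (metis cong_sym cong_trans)
    then show ?thesis using cop by (simp add: cong_mult_lcancel)
  qed
  then have c: "?c \<in> carrier (Zp p)" by (intro Zp_carrierI p0)
  have "Zp_of_int p b \<otimes>\<^bsub>Zp p\<^esub> ?c = \<one>\<^bsub>Zp p\<^esub>"
    using inv by (auto simp: Zp_simps Zp_of_int_def mod_simps cong_def)
  moreover have "?c \<otimes>\<^bsub>Zp p\<^esub> Zp_of_int p b = \<one>\<^bsub>Zp p\<^esub>"
    using inv by (auto simp: Zp_simps Zp_of_int_def mod_simps cong_def mult_ac)
  ultimately show ?thesis
    using c Zp_of_int_carrier[OF p0] unfolding Units_def by blast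
qed

lemma Zp_of_rat_correct:
  assumes p: "prime p" and q: "p_integral p q" and ab: "quotient_of q = (a, b)"
  shows "Zp_of_rat p q \<in> carrier (Zp p)"
    and "Zp_of_int p b \<otimes>\<^bsub>Zp p\<^esub> Zp_of_rat p q = Zp_of_int p a"
proof -
  have p0: "p > 0" using p by (rule prime_gt_0_nat)
  interpret cring "Zp p" using p0 by (rule cring_Zp)
  have u: "Zp_of_int p b \<in> Units (Zp p)"
    using p q ab by (intro Zp_of_int_unit) (auto simp: p_integral_def)
  have e: "Zp_of_rat p q = Zp_of_int p a \<otimes>\<^bsub>Zp p\<^esub> inv\<^bsub>Zp p\<^esub> (Zp_of_int p b)"
    by (simp add: Zp_of_rat_def ab)
  show "Zp_of_rat p q \<in> carrier (Zp p)"
    using u Zp_of_int_carrier[OF p0] by (simp add: e)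
  show "Zp_of_int p b \<otimes>\<^bsub>Zp p\<^esub> Zp_of_rat p q = Zp_of_int p a"
    using u Zp_of_int_carrier[OF p0]
    by (simp add: e m_lcomm Units_closed)
qed

lemma Wilson_prime_power:
  assumes p: "prime p" "odd p" and N: "N > 0"
  shows "[(\<Prod>k\<in>totatives (p ^ N). int k) = -1] (mod int p ^ N)"
proof -
  define m where "m = p ^ N"
  obtain g where g: "residue_primroot m g"
    using residue_primroot_odd_prime_power_exists[OF p] N unfolding m_def by metis
  have m1: "m > 1" using p N prime_gt_1_nat one_less_power unfolding m_def by blast
  have "odd m" using p unfolding m_def by simp
  then have m2: "m > 2" using m1 by (cases "m = 2") auto
  have ord: "ord m g = totient m"
    using g by (auto simp: residue_primroot_def)
  define t where "t = totient m div 2"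
  have t: "totient m = 2 * t" using totient_even[OF m2] by (simp add: t_def)
  have t0: "t > 0" using m1 t by (metis totient_gt_0_iff gr0I mult_0_right zero_less_one less_trans less_numeral_extra(3))
  define h where "h = int g ^ t"
  have "[g ^ (2 * t) = 1] (mod m)" using ord_works[of g m] ord t by simp
  then have "[int (g ^ (2 * t)) = int 1] (mod int m)" by (simp only: cong_int_iff)
  then have sq: "[h * h = 1] (mod int m)"
    by (simp add: h_def power_add[symmetric] mult_2)
  have ne: "\<not> [h = 1] (mod int m)"
  proof
    assume "[h = 1] (mod int m)"
    then have "[int (g ^ t) = int 1] (mod int m)" by (simp add: h_def)
    then have "[g ^ t = 1] (mod m)" by (simp only: cong_int_iff)
    then show False using ord_minimal[of t m g] ord t t0 by simp
  qed
  have h: "[h = -1] (mod int m)"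
  proof -
    have dvd: "int p ^ N dvd (h - 1) * (h + 1)"
      using sq by (simp add: cong_iff_dvd_diff m_def algebra_simps)
    have pp: "prime (int p)" using p by simp
    have p3: "\<not> int p dvd 2" using p prime_gt_1_nat[of p]
      by (metis dvd_refl int_dvd_int_iff of_nat_numeral primes_dvd_imp_eq two_is_prime_nat)
    show ?thesis
    proof (cases "int p dvd h - 1")
      case True
      have "\<not> int p dvd h + 1"
      proof
        assume "int p dvd h + 1"
        from dvd_diff[OF this True] p3 show False by simp
      qed
      then have "coprime (int p ^ N) (h + 1)" using pp by (simp add: prime_imp_coprime)
      then have "int p ^ N dvd h - 1" using dvd by (simp add: coprime_dvd_mult_left_iff)
      then show ?thesis using ne by (simp add: cong_iff_dvd_diff m_def)
    next
      case False
      then have "coprime (int p ^ N) (h - 1)" using pp by (simp add: prime_imp_coprime)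
      then have "int p ^ N dvd h + 1" using dvd by (simp add: coprime_dvd_mult_right_iff)
      then show ?thesis by (simp add: cong_iff_dvd_diff m_def)
    qed
  qed
  have "(\<Prod>k\<in>totatives m. int k) = (\<Prod>i<totient m. int (g ^ i mod m))"
    using prod.reindex_bij_betw[OF residue_primroot_is_generator[OF m1 g], of int] by simp
  also have "[\<dots> = (\<Prod>i<totient m. int g ^ i)] (mod int m)"
    by (intro cong_prod) (simp add: cong_def zmod_int)
  also have "(\<Prod>i<totient m. int g ^ i) = int g ^ (\<Sum>i<totient m. i)"
    by (simp add: power_sum)
  also have "(\<Sum>i<2 * t. i) = t * (2 * t - 1)" for t :: nat
  proof (induction t)
    case (Suc t)
    have "(\<Sum>i<2 * Suc t. i) = (\<Sum>i<2 * t. i) + 2 * t + (2 * t + 1)"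
      by (simp add: lessThan_Suc)
    then show ?case using Suc by (cases t) (simp_all add: algebra_simps)
  qed simp
  then have "int g ^ (\<Sum>i<totient m. i) = h ^ (2 * t - 1)"
    by (simp add: t h_def power_mult)
  also have "[h ^ (2 * t - 1) = (-1) ^ (2 * t - 1)] (mod int m)" using h by (rule cong_pow)
  also have "(-1 :: int) ^ (2 * t - 1) = -1" using t0 by (intro power_minus_odd[THEN trans]) auto
  finally show ?thesis by (simp add: m_def)
qed

lemma Gamma_int_add_power:
  assumes p: "prime p" "odd p"
  shows "[Gamma_int p (n + p ^ N) = Gamma_int p n] (mod int p ^ N)"
proof (cases "N = 0")
  case False
  have p0: "p > 0" using p by (simp add: prime_gt_0_nat)
  define m where "m = p ^ N"
  have m0: "m > 0" using p0 by (simp add: m_def)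
  have m1: "m > 1" using p False prime_gt_1_nat one_less_power unfolding m_def by blast
  have cop: "coprime k p \<longleftrightarrow> coprime k m" for k
    using False by (simp add: m_def)
  let ?f = "\<lambda>k. if coprime k p then int k else 1"
  have G: "Gamma_int p n = (-1) ^ n * (\<Prod>k<n. ?f k)" for n
    unfolding Gamma_int_def by (simp add: prod.inter_filter[symmetric])
  have block: "[(\<Prod>k\<in>{n..<n+m}. ?f k) = -1] (mod int m)" for n
  proof (induction n)
    case 0
    have "(\<Prod>k\<in>{0..<0+m}. ?f k) = (\<Prod>k\<in>{k\<in>{0..<m}. coprime k p}. int k)"
      by (simp add: prod.inter_filter[symmetric])
    also have "{k\<in>{0..<m}. coprime k p} = totatives m"
      using m1 by (auto simp: totatives_def cop intro!: Nat.gr0I le_neq_implies_less)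
    finally show ?case using Wilson_prime_power[OF p] False by (simp add: m_def)
  next
    case (Suc n)
    have "coprime (n + m) p \<longleftrightarrow> coprime n p"
      using cop[of "n + m"] cop[of n] gcd_add1[of n m] by (simp only: coprime_iff_gcd_eq_1[of _ m])
    then have c: "[?f (n + m) = ?f n] (mod int m)"
      by (simp add: cong_def)
    show ?case
    proof (cases "coprime n p")
      case True
      have "?f n * (\<Prod>k\<in>{Suc n..<Suc n+m}. ?f k) = (\<Prod>k\<in>{n..<Suc (n+m)}. ?f k)"
        by (subst (2) prod.atLeast_Suc_lessThan) auto
      also have "\<dots> = ?f (n + m) * (\<Prod>k\<in>{n..<n+m}. ?f k)"
        by (subst prod.atLeastLessThan_Suc) (auto simp: mult_ac)
      also have "[\<dots> = ?f n * -1] (mod int m)" by (intro cong_mult c Suc.IH)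
      finally have "[int n * (\<Prod>k\<in>{Suc n..<Suc n+m}. ?f k) = int n * -1] (mod int m)"
        using True by simp
      moreover have "coprime (int n) (int m)" using True cop by simp
      ultimately show ?thesis by (simp only: cong_mult_lcancel)
    next
      case False
      then have "\<not> coprime (n + m) p" using \<open>coprime (n + m) p \<longleftrightarrow> coprime n p\<close> by simp
      have "?f n * (\<Prod>k\<in>{Suc n..<Suc n+m}. ?f k) = (\<Prod>k\<in>{n..<Suc (n+m)}. ?f k)"
        by (subst (2) prod.atLeast_Suc_lessThan) auto
      also have "\<dots> = ?f (n + m) * (\<Prod>k\<in>{n..<n+m}. ?f k)"
        by (subst prod.atLeastLessThan_Suc) (auto simp: mult_ac)
      finally show ?thesis using False \<open>\<not> coprime (n + m) p\<close> Suc.IH by simp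
    qed
  qed
  have "(\<Prod>k<n+m. ?f k) = (\<Prod>k<n. ?f k) * (\<Prod>k\<in>{n..<n+m}. ?f k)"
    using prod.atLeastLessThan_concat[of 0 n "n + m" ?f] by (simp add: atLeast0LessThan)
  moreover have "(-1 :: int) ^ (n + m) = - ((-1) ^ n)"
    using p by (simp add: power_add m_def)
  ultimately have "Gamma_int p (n + m) = Gamma_int p n * (- (\<Prod>k\<in>{n..<n+m}. ?f k))"
    by (simp add: G)
  also have "[\<dots> = Gamma_int p n * (- (- 1))] (mod int m)"
    by (intro cong_mult cong_refl) (unfold cong_minus_minus_iff, rule block)
  finally show ?thesis by (simp add: m_def)
qed simp

lemma Gamma_int_cong:
  assumes p: "prime p" "odd p" and ab: "[a = b] (mod p ^ N)"
  shows "[Gamma_int p a = Gamma_int p b] (mod int p ^ N)"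
proof -
  have *: "[Gamma_int p (c + j * p ^ N) = Gamma_int p c] (mod int p ^ N)" for c j
  proof (induction j)
    case (Suc j)
    have "[Gamma_int p (c + j * p ^ N + p ^ N) = Gamma_int p (c + j * p ^ N)] (mod int p ^ N)"
      by (rule Gamma_int_add_power[OF p])
    also note Suc.IH
    finally show ?case by (simp add: add_ac)
  qed simp
  have r: "[Gamma_int p c = Gamma_int p (c mod p ^ N)] (mod int p ^ N)" for c
    using *[of "c mod p ^ N" "c div p ^ N"] by (simp only: mod_div_mult_eq)
  show ?thesis using r[of a] r[of b] ab unfolding cong_def by simp
qed

lemma tendsto_coordinatewise_iff:
  fixes f :: "'c \<Rightarrow> 'a \<Rightarrow> 'b :: topological_space"
  shows "(f \<longlongrightarrow> l) F \<longleftrightarrow> (\<forall>i. ((\<lambda>z. f z i) \<longlongrightarrow> l i) F)"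
proof -
  have "limitin (product_topology (\<lambda>i. euclidean) UNIV) f l F \<longleftrightarrow>
      (\<forall>i. ((\<lambda>z. f z i) \<longlongrightarrow> l i) F)"
    by (simp add: limitin_componentwise)
  then show ?thesis by (simp add: euclidean_product_topology)
qed

lemma ex1_Gamma_extension:
  assumes p: "prime p" "odd p"
  shows "\<exists>!f. is_Gamma_extension p f"
proof (rule ex_ex1I)
  have p0: "p > 0" using p by (simp add: prime_gt_0_nat)
  let ?C = "carrier (Zp p)"
  define F where "F = (\<lambda>x n. Gamma_int p (nat (x n)) mod int p ^ n)"
  have F: "F x \<in> ?C" if x: "x \<in> ?C" for x
    unfolding F_def
  proof (rule Zp_carrierI[OF p0], rule Gamma_int_cong[OF p])
    fix n
    have "x (Suc n) \<ge> 0" "x n \<ge> 0" using x by (auto simp: Zp_carrier_iff)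
    then have "[int (nat (x (Suc n))) = int (nat (x n))] (mod int (p ^ n))"
      using Zp_coherent[OF x, of n] by simp
    then show "[nat (x (Suc n)) = nat (x n)] (mod p ^ n)" by (simp only: cong_int_iff)
  qed
  have cont: "continuous_on ?C F"
    unfolding F_def
  proof (rule continuous_on_coordinatewise_then_product)
    fix n
    have 1: "continuous_on ?C (\<lambda>x. x n)"
      by (rule continuous_on_product_then_coordinatewise[OF continuous_on_id])
    have 2: "continuous_on UNIV (\<lambda>a :: int. Gamma_int p (nat a) mod int p ^ n)"
      by (rule Topological_Spaces.continuous_on_discrete)
    show "continuous_on ?C (\<lambda>x. Gamma_int p (nat (x n)) mod int p ^ n)"
      using continuous_on_compose2[OF 2 1] by simp
  qed
  have val: "F (Zp_of_int p (int n)) = Zp_of_int p (Gamma_int p n)" for n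
  proof
    fix N
    have "nat (int n mod int p ^ N) = n mod p ^ N" by (metis nat_int of_nat_power zmod_int)
    moreover have "[Gamma_int p (n mod p ^ N) = Gamma_int p n] (mod int p ^ N)"
      by (rule Gamma_int_cong[OF p]) simp
    ultimately show "F (Zp_of_int p (int n)) N = Zp_of_int p (Gamma_int p n) N"
      by (simp add: F_def Zp_of_int_def cong_def)
  qed
  have "is_Gamma_extension p (restrict F ?C)"
    unfolding is_Gamma_extension_def
  proof (intro conjI allI impI)
    show "restrict F ?C \<in> ?C \<rightarrow>\<^sub>E ?C" using F by auto
    show "continuous_on ?C (restrict F ?C)"
      using cont by (rule continuous_on_eq) simp
  qed (simp add: val Zp_of_int_carrier p0)
  then show "\<exists>f. is_Gamma_extension p f" by blast
next
  have p0: "p > 0" using p by (simp add: prime_gt_0_nat)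
  let ?C = "carrier (Zp p)"
  fix f g assume fg: "is_Gamma_extension p f" "is_Gamma_extension p g"
  show "f = g"
  proof (rule extensionalityI[of _ ?C])
    fix x assume x: "x \<in> ?C"
    define s where "s = (\<lambda>n. nat (x n) + 2 * p ^ n)"
    define y where "y = (\<lambda>n. Zp_of_int p (int (s n)))"
    have y: "y n \<in> ?C" for n by (simp add: y_def Zp_of_int_carrier p0)
    have s1: "s n > 1" for n
    proof -
      have "p ^ n > 0" using p0 by (rule zero_less_power)
      then show ?thesis unfolding s_def by linarith
    qed
    have x_mono: "[x (N + d) = x N] (mod int p ^ N)" for N d
    proof (induction d)
      case (Suc d)
      have "[x (Suc (N + d)) = x (N + d)] (mod int p ^ N)"
        by (rule cong_dvd_modulus[OF Zp_coherent[OF x]]) (simp add: le_imp_power_dvd)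
      from cong_trans[OF this Suc.IH] show ?case by simp
    qed simp
    have lim: "y \<longlonglongrightarrow> x"
    unfolding tendsto_coordinatewise_iff
    proof
      fix N
      have "y n N = x N" if "n \<ge> N" for n
      proof -
        obtain d where d: "n = N + d" using le_Suc_ex[OF \<open>n \<ge> N\<close>] by blast
        have xn: "x n \<ge> 0" using x by (auto simp: Zp_carrier_iff)
        have "int p ^ N dvd 2 * int p ^ n" using \<open>n \<ge> N\<close> by (simp add: le_imp_power_dvd dvd_mult)
        then have "[x n + 2 * int p ^ n = x N + 0] (mod int p ^ N)"
          using x_mono[of N d] unfolding d by (intro cong_add) (auto simp: cong_0_iff)
        then show ?thesis
          using xn Zp_mod[OF x, of N] by (simp add: y_def s_def Zp_of_int_def cong_def)
      qed
      then show "(\<lambda>n. y n N) \<longlonglongrightarrow> x N"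
        by (intro tendsto_eventually) (auto simp: eventually_sequentially)
    qed
    have *: "(\<lambda>n. h (y n)) \<longlonglongrightarrow> h x" if "is_Gamma_extension p h" for h
      by (rule continuous_on_tendsto_compose[of ?C h, OF _ lim x])
        (use that y in \<open>simp_all add: is_Gamma_extension_def\<close>)
    have "f (y n) = g (y n)" for n
      using fg s1[of n] unfolding is_Gamma_extension_def y_def by simp
    then have "(\<lambda>n. g (y n)) \<longlonglongrightarrow> f x" using *[OF fg(1)] by simp
    then have "(\<lambda>n. g (y n) i) \<longlonglongrightarrow> f x i" "(\<lambda>n. g (y n) i) \<longlonglongrightarrow> g x i" for i
      using *[OF fg(2)] unfolding tendsto_coordinatewise_iff by blast+
    then show "f x = g x" by (intro ext) (rule LIMSEQ_unique)
  qed (use fg in \<open>auto simp: is_Gamma_extension_def PiE_def\<close>)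
qed

lemma euler_number_rec:
  assumes "n > 0"
  shows "euler_number n = - (\<Sum>k<n. if even (n - k) then of_nat (n choose k) * euler_number k else 0)"
proof -
  let ?C = "fps_exp 1 + fps_exp (-1) :: rat fps"
  let ?E = "2 / ?C :: rat fps"
  have C: "fps_nth ?C k = (if even k then 2 / fact k else 0)" for k by simp
  have "fps_nth ?C 0 \<noteq> 0" by simp
  then have "?E * ?C = 2"
    by (simp add: fps_divide_unit mult.assoc inverse_mult_eq_1)
  moreover have "fps_nth (2 :: rat fps) n = 0" using assms by (simp only: fps_numeral_nth) simp
  ultimately have "fps_nth (?E * ?C) n = 0" by (simp only:)
  then have "(\<Sum>k\<le>n. fps_nth ?E k * fps_nth ?C (n - k)) = 0"
    by (simp only: fps_mult_nth atLeast0AtMost)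
  then have "0 = fact n * (\<Sum>k\<le>n. fps_nth ?E k * fps_nth ?C (n - k)) / 2"
    by (simp only: mult_zero_right div_0)
  also have "\<dots> = (\<Sum>k\<le>n. fact n * (fps_nth ?E k * fps_nth ?C (n - k)) / 2)"
    by (simp only: sum_distrib_left sum_divide_distrib)
  also have "\<dots> = (\<Sum>k\<le>n. if even (n - k) then of_nat (n choose k) * euler_number k else 0)"
  proof (intro sum.cong refl)
    fix k assume "k \<in> {..n}"
    then have "(of_nat (n choose k) :: rat) = fact n / (fact k * fact (n - k))"
      by (simp add: binomial_fact)
    moreover have "euler_number k = fact k * fps_nth ?E k" by (simp only: euler_number_def)
    ultimately show "fact n * (fps_nth ?E k * fps_nth ?C (n - k)) / 2 =
        (if even (n - k) then of_nat (n choose k) * euler_number k else 0)"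
      unfolding C by simp
  qed
  also have "{..n} = insert n {..<n}" by auto
  finally show ?thesis by simp
qed

lemma euler_number_Ints: "euler_number n \<in> \<int>"
proof (induction n rule: less_induct)
  case (less n)
  show ?case
  proof (cases "n = 0")
    case True
    then show ?thesis by (simp add: euler_number_def fps_divide_unit numeral_fps_const)
  next
    case False
    then have "n > 0" by simp
    show ?thesis unfolding euler_number_rec[OF \<open>n > 0\<close>]
      by (intro Ints_minus Ints_sum) (auto intro!: Ints_mult less)
  qed
qed

end

theory Submission
  imports Defs
begin

text \<open>
  Write \<open>(1/2)\<^sub>k / k! = C(2k, k) / 4\<^sup>k\<close> and \<open>n = (p - 1)/2\<close>.

  For the first sum, consider \<open>F(x) = \<Sum>\<^sub>k\<^sub><\<^sub>p ((x)\<^sub>k / k!)\<^sup>3\<close>, so that \<open>6 S = F'(1/2)\<close>. Zeilberger's method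
  gives \<open>(x - 2)\<^sup>2 F(x - 2) + 3 (3x - 2) (3x - 4) F(x) = W(x)\<close>, where the boundary term \<open>W\<close> is a multiple of
  \<open>(x)\<^sub>p\<^sub>-\<^sub>2\<^sup>3\<close>. Near an integer \<open>-N\<close> with \<open>0 \<le> N < p - 2\<close>, say at \<open>x = p/2 - N\<close>, the values of \<open>W\<close> and \<open>W'\<close> vanish
  modulo \<open>p\<^sup>3\<close> and \<open>p\<^sup>2\<close>, so the pair \<open>(F, F')\<close> can be propagated from \<open>x = p/2\<close> (if \<open>n\<close> is even) or
  \<open>x = p/2 - 1\<close> (if \<open>n\<close> is odd) to \<open>x = p/2 - n = 1/2\<close>. If \<open>p = 4m + 1\<close>, the logarithmic derivative
  obtained in this way is \<open>6 \<Sum> 1/(4i - p)\<close>, summed over \<open>0 < i < p\<close>, which vanishes modulo \<open>p\<^sup>2\<close>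
  by pairing \<open>i\<close> with \<open>p - i\<close>. If \<open>p = 4m + 3\<close>, exactly one factor of the product
  is divisible by \<open>p\<close>, and \<open>F'(1/2)\<close> is congruent to \<open>-6p\<close> times the product of the others.

  For the second sum, \<open>4 T\<close> is, up to sign, the derivative at \<open>w = 0\<close> of
  \<open>\<Sum>\<^sub>k (1/2)\<^sub>k / k!\<^sup>3 \<Prod>\<^sub>j\<^sub><\<^sub>k ((j + 1/2)\<^sup>2 - w)\<close>. Modulo \<open>p\<close> one may replace \<open>(1/2)\<^sub>k / k!\<close> by
  \<open>(-n)\<^sub>k / (-2n)\<^sub>k\<close>, and a terminating case of Whipple's theorem turns the sum into the product
  \<open>\<Prod>\<^sub>i ((2i - 1/2)\<^sup>2 - w) / (2n)!\<close>.
\<close>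

section \<open>Rationals that are integral at a prime\<close>

text \<open>The reduced denominator divides the denominator of every other representation of the
  same rational, so any fraction with denominator prime to p certifies integrality. All closure
  properties below work with such unreduced fractions.\<close>

lemma p_integral_iff:
  assumes "prime p"
  shows "p_integral p q \<longleftrightarrow> (\<exists>a b. \<not> int p dvd b \<and> q = of_int a / of_int b)"
proof
  obtain a b where ab: "quotient_of q = (a, b)" by (cases "quotient_of q")
  then have q: "q = of_int a / of_int b" by (rule quotient_of_div)
  show "p_integral p q \<Longrightarrow> \<exists>a b. \<not> int p dvd b \<and> q = of_int a / of_int b"
    using q ab by (auto simp: p_integral_def)
  assume "\<exists>a b. \<not> int p dvd b \<and> q = of_int a / of_int b"
  then obtain c d where d: "\<not> int p dvd d" "q = of_int c / of_int d" by blast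
  have nz: "b \<noteq> 0" "d \<noteq> 0" using quotient_of_denom_pos[OF ab] d by auto
  have "of_int a * of_int d = (of_int c * of_int b :: rat)"
    using q d(2) nz by (simp add: field_simps)
  then have "a * d = c * b" by (simp only: of_int_mult[symmetric] of_int_eq_iff)
  then have "b dvd a * d" by simp
  then have "b dvd d"
    using quotient_of_coprime[OF ab] by (metis coprime_commute coprime_dvd_mult_right_iff)
  then show "p_integral p q" using d(1) ab by (auto simp: p_integral_def dest: dvd_trans)
qed

locale prime_localization =
  fixes p :: nat
  assumes prime_p: "prime p" and p_gt_3: "p > 3"
begin

abbreviation pint :: "rat \<Rightarrow> bool" where "pint \<equiv> p_integral p"

definition punit :: "rat \<Rightarrow> bool" where
  "punit q \<longleftrightarrow> q \<noteq> 0 \<and> pint q \<and> pint (inverse q)"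

text \<open>Congruence modulo p^r in the localization of the integers at p. Only the difference is
  constrained, so x and y need not be integral; rules that multiply congruences therefore carry
  integrality hypotheses.\<close>

definition pcong :: "nat \<Rightarrow> rat \<Rightarrow> rat \<Rightarrow> bool" where
  "pcong r x y \<longleftrightarrow> pint ((x - y) / of_nat p ^ r)"

lemma p_nz [simp]: "(of_nat p :: rat) \<noteq> 0" "p \<noteq> 0" "p > 0"
  using prime_p by (auto simp: prime_gt_0_nat)

lemma prime_int_p: "prime (int p)" using prime_p by simp

lemma pintE: "pint q \<Longrightarrow> \<exists>a b. \<not> int p dvd b \<and> b \<noteq> 0 \<and> q = of_int a / of_int b"
  using p_integral_iff[OF prime_p] by force

lemma pint_of_int [simp, intro]: "pint (of_int a)"
proof -
  have "\<not> int p dvd 1" using prime_p by (metis not_prime_unit prime_int_p)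
  then show ?thesis unfolding p_integral_iff[OF prime_p] by (intro exI[of _ a] exI[of _ 1]) simp
qed

lemma pint_of_nat [simp, intro]: "pint (of_nat a)"
  using pint_of_int[of "int a"] by simp

lemma pint_numeral [simp, intro]: "pint (numeral a)" "pint 0" "pint 1"
  using pint_of_nat[of "numeral a"] pint_of_nat[of 0] pint_of_nat[of 1] by simp_all

lemma pint_mult [intro]: assumes "pint x" "pint y" shows "pint (x * y)"
proof -
  obtain a b c d where "\<not> int p dvd b" "x = of_int a / of_int b" "\<not> int p dvd d" "y = of_int c / of_int d"
    using assms[THEN pintE] by blast
  then show ?thesis unfolding p_integral_iff[OF prime_p]
    by (intro exI[of _ "a * c"] exI[of _ "b * d"]) (simp add: prime_dvd_mult_iff[OF prime_int_p])
qed

lemma pint_add [intro]: assumes "pint x" "pint y" shows "pint (x + y)"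
proof -
  obtain a b c d where "\<not> int p dvd b" "b \<noteq> 0" "x = of_int a / of_int b" "\<not> int p dvd d" "d \<noteq> 0" "y = of_int c / of_int d"
    using assms[THEN pintE] by blast
  then show ?thesis unfolding p_integral_iff[OF prime_p]
    by (intro exI[of _ "a * d + c * b"] exI[of _ "b * d"])
      (simp add: prime_dvd_mult_iff[OF prime_int_p] field_simps)
qed

lemma pint_minus_iff [simp]: "pint (- x) \<longleftrightarrow> pint x"
proof -
  have "pint (- x)" if "pint x" for x
    using pint_mult[OF pint_of_int[of "-1"] that] by simp
  from this[of x] this[of "- x"] show ?thesis by auto
qed

lemma pint_diff [intro]: "pint x \<Longrightarrow> pint y \<Longrightarrow> pint (x - y)"
  using pint_add[of x "- y"] by simp

lemma pint_power [intro]: "pint x \<Longrightarrow> pint (x ^ n)"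
  by (induction n) auto

lemma pint_sum [intro]: "(\<And>i. i \<in> A \<Longrightarrow> pint (f i)) \<Longrightarrow> pint (sum f A)"
  by (induction A rule: infinite_finite_induct) auto

lemma pint_prod [intro]: "(\<And>i. i \<in> A \<Longrightarrow> pint (f i)) \<Longrightarrow> pint (prod f A)"
  by (induction A rule: infinite_finite_induct) auto

lemma pint_pochhammer [intro]: "pint x \<Longrightarrow> pint (pochhammer x k)"
  unfolding pochhammer_prod by (intro pint_prod pint_add) auto

lemma pint_divide [intro]: "pint x \<Longrightarrow> punit y \<Longrightarrow> pint (x / y)"
  by (auto simp: punit_def divide_inverse)

lemma punit_nz: "punit x \<Longrightarrow> x \<noteq> 0" by (simp add: punit_def)

lemma punit_pint [intro]: "punit x \<Longrightarrow> pint x" by (simp add: punit_def)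

lemma punit_mult [intro]: "punit x \<Longrightarrow> punit y \<Longrightarrow> punit (x * y)"
  by (auto simp: punit_def)

lemma punit_one [simp]: "punit 1" by (simp add: punit_def)

lemma punit_minus_iff [simp]: "punit (- x) \<longleftrightarrow> punit x" by (simp add: punit_def)

lemma punit_inverse [intro]: "punit x \<Longrightarrow> punit (inverse x)" by (simp add: punit_def)

lemma punit_divide [intro]: "punit x \<Longrightarrow> punit y \<Longrightarrow> punit (x / y)"
  by (simp add: divide_inverse punit_mult punit_inverse)

lemma punit_power [intro]: "punit x \<Longrightarrow> punit (x ^ n)" by (induction n) auto

lemma punit_of_int_iff: "punit (of_int a) \<longleftrightarrow> \<not> int p dvd a"
proof
  assume "\<not> int p dvd a"
  moreover from this have "pint (inverse (of_int a))" unfolding p_integral_iff[OF prime_p]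
    by (intro exI[of _ 1] exI[of _ a]) (simp add: divide_inverse)
  ultimately show "punit (of_int a)" by (auto simp: punit_def)
next
  assume u: "punit (of_int a)"
  show "\<not> int p dvd a"
  proof
    assume "int p dvd a"
    then obtain c where c: "a = int p * c" by blast
    from u obtain x y where xy: "\<not> int p dvd y" "y \<noteq> 0" "inverse (of_int a) = (of_int x / of_int y :: rat)"
      unfolding punit_def using pintE by blast
    have "a \<noteq> 0" using u by (auto simp: punit_def)
    then have "(of_int y :: rat) = of_int (a * x)" using xy by (simp add: field_simps)
    then have "y = a * x" by (simp only: of_int_eq_iff)
    then show False using xy(1) c by simp
  qed
qed

lemma punit_of_nat_iff: "punit (of_nat a) \<longleftrightarrow> \<not> p dvd a"
  using punit_of_int_iff[of "int a"] by simp

lemma punit_of_nat_less: "0 < k \<Longrightarrow> k < p \<Longrightarrow> punit (of_nat k)"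
  unfolding punit_of_nat_iff by (auto dest: dvd_imp_le)

lemma punit_small [simp]: "punit 2" "punit 3" "punit 4" "punit 8" "punit 12" "punit 16" "punit 64" "punit 6"
proof -
  show 2: "punit 2" using punit_of_nat_less[of 2] p_gt_3 by simp
  show 3: "punit 3" using punit_of_nat_less[of 3] p_gt_3 by simp
  show "punit 4" using punit_mult[OF 2 2] by simp
  show "punit 8" using punit_power[OF 2, of 3] by simp
  show "punit 16" using punit_power[OF 2, of 4] by simp
  show "punit 64" using punit_power[OF 2, of 6] by simp
  show 6: "punit 6" using punit_mult[OF 2 3] by simp
  show "punit 12" using punit_mult[OF 2 6] by simp
qed

lemma punit_fact [intro]: "k < p \<Longrightarrow> punit (fact k)"
  using punit_of_nat_iff[of "fact k"] prime_dvd_fact_iff[OF prime_p, of k] by simp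

section \<open>Calculus of congruences between rationals modulo p^r\<close>

lemma pcong_0_pint [simp]: "pcong 0 x y \<longleftrightarrow> pint (x - y)" by (simp add: pcong_def)

lemma pcong_refl [simp, intro]: "pcong r x x" by (simp add: pcong_def)

lemma pcong_sym: "pcong r x y \<Longrightarrow> pcong r y x"
  unfolding pcong_def by (subst pint_minus_iff[symmetric]) (simp add: diff_divide_distrib)

lemma pcong_trans [trans]: "pcong r x y \<Longrightarrow> pcong r y z \<Longrightarrow> pcong r x z"
  unfolding pcong_def using pint_add[of "(x - y) / of_nat p ^ r" "(y - z) / of_nat p ^ r"]
  by (simp add: diff_divide_distrib)

lemma pcong_add: "pcong r a b \<Longrightarrow> pcong r c d \<Longrightarrow> pcong r (a + c) (b + d)"
  unfolding pcong_def using pint_add[of "(a - b) / of_nat p ^ r" "(c - d) / of_nat p ^ r"]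
  by (simp add: diff_divide_distrib add_divide_distrib algebra_simps)

lemma pcong_minus: "pcong r a b \<Longrightarrow> pcong r (- a) (- b)"
  unfolding pcong_def by (subst pint_minus_iff[symmetric]) (simp add: diff_divide_distrib)

lemma pcong_diff: "pcong r a b \<Longrightarrow> pcong r c d \<Longrightarrow> pcong r (a - c) (b - d)"
  using pcong_add[of r a b "- c" "- d"] by (simp add: pcong_minus)

text \<open>Uses a c - b d = a (c - d) + (a - b) d, which asks for integrality of only one factor on
  each side.\<close>

lemma pcong_mult_gen:
  assumes "pcong r a b" "pcong r c d" "pint a" "pint d"
  shows "pcong r (a * c) (b * d)"
proof -
  have "pint (a * ((c - d) / of_nat p ^ r) + (a - b) / of_nat p ^ r * d)"
    using assms unfolding pcong_def by blast
  also have "a * ((c - d) / of_nat p ^ r) + (a - b) / of_nat p ^ r * d = (a * c - b * d) / of_nat p ^ r"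
    by (simp add: diff_divide_distrib add_divide_distrib algebra_simps)
  finally show ?thesis unfolding pcong_def .
qed

lemma pcong_le: assumes "pcong r x y" "s \<le> r" shows "pcong s x y"
proof -
  have "pint ((x - y) / of_nat p ^ r * of_nat (p ^ (r - s)))" using assms unfolding pcong_def by blast
  moreover have "(of_nat p :: rat) ^ r = of_nat p ^ s * of_nat (p ^ (r - s))"
    using assms by (simp add: power_add[symmetric])
  then have "(x - y) / of_nat p ^ r * of_nat (p ^ (r - s)) = (x - y) / of_nat p ^ s"
    by simp
  ultimately show ?thesis unfolding pcong_def by simp
qed

text \<open>Weakened to modulus p^0, the congruence says that x - y is integral.\<close>

lemma pcong_pint: "pcong r x y \<Longrightarrow> pint y \<Longrightarrow> pint x"
  using pcong_le[of r x y 0] pint_add[of "x - y" y] by simp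

lemma pcong_mult:
  assumes "pcong r a b" "pcong r c d" "pint b" "pint d"
  shows "pcong r (a * c) (b * d)"
  by (rule pcong_mult_gen) (use assms pcong_pint in blast)+

lemma pcong_mult_left: "pcong r a b \<Longrightarrow> pint c \<Longrightarrow> pcong r (c * a) (c * b)"
  unfolding pcong_def right_diff_distrib[symmetric] times_divide_eq_right[symmetric] by (rule pint_mult)

lemma pcong_mult_right: "pcong r a b \<Longrightarrow> pint c \<Longrightarrow> pcong r (a * c) (b * c)"
  using pcong_mult_left[of r a b c] by (simp add: mult.commute)

lemma pcong_unit_cancel: "punit u \<Longrightarrow> pcong r (u * x) (u * y) \<Longrightarrow> pcong r x y"
  using pcong_mult_left[of r "u * x" "u * y" "inverse u"]
  by (simp add: punit_def mult.assoc[symmetric])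

lemma pcong_divide_unit: "punit u \<Longrightarrow> pcong r x y \<Longrightarrow> pcong r (x / u) (y / u)"
  using pcong_mult_left[of r x y "inverse u"] by (simp add: punit_def divide_inverse mult.commute)

lemma pcong_inverse:
  assumes "punit u" "punit v" "pcong r u v" shows "pcong r (inverse u) (inverse v)"
proof -
  have "pcong r (inverse u * inverse v * v) (inverse u * inverse v * u)"
    using assms by (intro pcong_mult_left pcong_sym[OF assms(3)]) (auto simp: punit_def)
  then show ?thesis using assms by (simp add: punit_def field_simps)
qed

lemma pcong_divide:
  assumes "pcong r x y" "pcong r u v" "punit u" "punit v" "pint y"
  shows "pcong r (x / u) (y / v)"
  unfolding divide_inverse using assms
  by (intro pcong_mult pcong_inverse) (auto simp: punit_def)

text \<open>If p divided the numerator of v, then u / p would be integral, and multiplying by the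
  inverse of u would make 1 / p integral.\<close>

lemma punit_pcong:
  assumes "punit u" "pcong r u v" "r > 0" shows "punit v"
proof -
  have "pint v" using assms pcong_pint[of r v u] pcong_sym by blast
  then obtain a b where ab: "\<not> int p dvd b" "b \<noteq> 0" "v = of_int a / of_int b" using pintE by blast
  obtain c d where cd: "\<not> int p dvd d" "d \<noteq> 0" "u = of_int c / of_int d" using assms pintE by blast
  have b: "punit (of_int b)" "punit (of_int d)" using ab cd by (simp_all add: punit_of_int_iff)
  have "punit (of_int c)" using punit_mult[OF assms(1) b(2)] cd by simp
  have "\<not> int p dvd a"
  proof
    assume "int p dvd a"
    then obtain e where e: "a = int p * e" by blast
    have "pint (v / of_nat p)" using pint_divide[OF pint_of_int[of e] b(1)] unfolding ab(3) e by simp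
    moreover have "pint ((u - v) / of_nat p)"
      using pcong_le[OF assms(2), of 1] assms(3) by (simp add: pcong_def)
    ultimately have "pint (u / of_nat p)"
      using pint_add[of "v / of_nat p" "(u - v) / of_nat p"] by (simp add: add_divide_distrib[symmetric])
    then have "pint (u / of_nat p * inverse u)" using assms(1) unfolding punit_def by blast
    also have "u / of_nat p * inverse u = inverse (of_nat p)"
      using assms(1) by (simp add: punit_def field_simps)
    finally have "pint (inverse (of_nat p))" .
    then have "punit (of_nat p)" by (simp add: punit_def)
    then show False by (simp add: punit_of_nat_iff)
  qed
  then have "punit (of_int a)" by (simp add: punit_of_int_iff)
  then show ?thesis unfolding ab(3) using b by blast
qed

lemma pcong_sum: "(\<And>i. i \<in> A \<Longrightarrow> pcong r (f i) (g i)) \<Longrightarrow> pcong r (sum f A) (sum g A)"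
  by (induction A rule: infinite_finite_induct) (auto intro: pcong_add)

lemma pcong_prod:
  "(\<And>i. i \<in> A \<Longrightarrow> pcong r (f i) (g i)) \<Longrightarrow> (\<And>i. i \<in> A \<Longrightarrow> pint (g i)) \<Longrightarrow> pcong r (prod f A) (prod g A)"
  by (induction A rule: infinite_finite_induct) (auto intro!: pcong_mult)

lemma pcong_power: "pcong r a b \<Longrightarrow> pint b \<Longrightarrow> pcong r (a ^ n) (b ^ n)"
  by (induction n) (auto intro!: pcong_mult)

lemma pcong_0_iff: "pcong r x 0 \<longleftrightarrow> (\<exists>z. pint z \<and> x = of_nat p ^ r * z)"
  unfolding pcong_def by (auto intro!: exI[of _ "x / of_nat p ^ r"])

lemma pcong_diff_0_iff: "pcong r (x - y) 0 \<longleftrightarrow> pcong r x y"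
  by (simp add: pcong_def)

text \<open>A factor p^s gains s powers of p in the modulus; in this way congruences modulo p yield
  those modulo p^2.\<close>

lemma pcong_p_power_mult: "pcong r x y \<Longrightarrow> pcong (s + r) (of_nat p ^ s * x) (of_nat p ^ s * y)"
  unfolding pcong_def by (simp add: power_add right_diff_distrib[symmetric])

lemma pcong_p_mult: "pcong r x y \<Longrightarrow> pcong (Suc r) (of_nat p * x) (of_nat p * y)"
  using pcong_p_power_mult[of r x y 1] by simp

lemma pcong_p_0: "pint x \<Longrightarrow> pcong 1 (of_nat p * x) 0"
  unfolding pcong_0_iff by auto

lemma pcong_add_p: "pint x \<Longrightarrow> pcong 1 (y + of_nat p * x) y"
  using pcong_add[OF pcong_refl pcong_p_0] by fastforce

lemma pcong_of_int: "pcong r (of_int a) (of_int b) \<longleftrightarrow> [a = b] (mod int p ^ r)"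
proof
  assume "[a = b] (mod int p ^ r)"
  then obtain k where "a - b = int p ^ r * k" by (auto simp: cong_iff_dvd_diff)
  then have "(of_int a - of_int b :: rat) = of_nat p ^ r * of_int k"
    by (metis of_int_diff of_int_mult of_int_of_nat_eq of_int_power)
  then show "pcong r (of_int a) (of_int b)" by (simp add: pcong_def)
next
  assume "pcong r (of_int a) (of_int b)"
  then obtain c d where cd: "\<not> int p dvd d" "d \<noteq> 0" "(of_int a - of_int b) / of_nat p ^ r = (of_int c / of_int d :: rat)"
    unfolding pcong_def using pintE by blast
  then have "of_int ((a - b) * d) = (of_int (c * int p ^ r) :: rat)" by (simp add: field_simps)
  then have "(a - b) * d = c * int p ^ r" by (simp only: of_int_eq_iff)
  then have "int p ^ r dvd (a - b) * d" by simp
  moreover have "coprime (int p ^ r) d" using cd(1) prime_int_p by (simp add: prime_imp_coprime)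
  ultimately show "[a = b] (mod int p ^ r)"
    by (simp add: cong_iff_dvd_diff coprime_dvd_mult_left_iff)
qed

lemma pcong_of_nat: "pcong 1 (of_nat a) (of_nat b) \<longleftrightarrow> [a = b] (mod p)"
  using pcong_of_int[of 1 "int a" "int b"] by (simp add: cong_int_iff)

end

section \<open>Residues in the p-adic integers\<close>

lemma Zp_residue_cong:
  assumes "x \<in> carrier (Zp p)" shows "[x (r + d) = x r] (mod int p ^ r)"
proof (induction d)
  case (Suc d)
  have "[x (Suc (r + d)) = x (r + d)] (mod int p ^ r)"
    by (rule cong_dvd_modulus[OF Zp_coherent[OF assms]]) (simp add: le_imp_power_dvd)
  from cong_trans[OF this Suc.IH] show ?case by simp
qed simp

text \<open>If the residues at level r agree, all residues of the difference z at levels from r on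
  are divisible by p^r, so z can be divided by p^r inside \<open>Zp p\<close>.\<close>

lemma Zp_congI:
  assumes "p > 0" "x \<in> carrier (Zp p)" "y \<in> carrier (Zp p)" "x r = y r"
  shows "Zp_cong p r x y"
proof -
  interpret cring "Zp p" by (rule cring_Zp[OF assms(1)])
  define z where "z = x \<ominus>\<^bsub>Zp p\<^esub> y"
  have z: "z \<in> carrier (Zp p)" using assms by (simp add: z_def)
  have "z \<oplus>\<^bsub>Zp p\<^esub> y = x" unfolding z_def using assms by (simp add: minus_eq a_assoc l_neg)
  then have "x r = (z r + y r) mod int p ^ r" by (metis Zp_simps(4))
  then have "[z r + x r = 0 + x r] (mod int p ^ r)"
    using Zp_mod[OF assms(2), of r] assms(4) by (simp add: cong_def)
  then have "[z r = 0] (mod int p ^ r)" by (simp only: cong_add_rcancel)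
  then have zr: "int p ^ r dvd z (r + n)" for n
    using Zp_residue_cong[OF z, of r n] by (metis cong_0_iff cong_trans)
  \<comment> \<open>Division by p^r loses r levels of precision, hence level n of the quotient is
    read off from level r + n of z.\<close>
  define w where "w = (\<lambda>n. z (r + n) div int p ^ r mod int p ^ n)"
  have pr: "int p ^ r \<noteq> 0" using assms(1) by simp
  have w: "w \<in> carrier (Zp p)" unfolding w_def
  proof (rule Zp_carrierI[OF assms(1)])
    fix n
    have "int p ^ (r + n) dvd z (r + Suc n) - z (r + n)"
      using Zp_coherent[OF z, of "r + n"] by (simp add: cong_iff_dvd_diff)
    moreover have "z (r + Suc n) - z (r + n) = int p ^ r * (z (r + Suc n) div int p ^ r - z (r + n) div int p ^ r)"
      using zr[of n] zr[of "Suc n"] by (simp add: right_diff_distrib)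
    ultimately have "int p ^ r * int p ^ n dvd int p ^ r * (z (r + Suc n) div int p ^ r - z (r + n) div int p ^ r)"
      by (simp only: power_add)
    then show "[z (r + Suc n) div int p ^ r = z (r + n) div int p ^ r] (mod int p ^ n)"
      using pr unfolding cong_iff_dvd_diff by (metis dvd_mult_cancel_left)
  qed
  have "z = w \<otimes>\<^bsub>Zp p\<^esub> Zp_of_int p (int p ^ r)"
  proof
    fix n
    have "z n = z (n + r) mod int p ^ n"
      using Zp_residue_cong[OF z, of n r] Zp_mod[OF z, of n] by (simp add: cong_def)
    also have "z (n + r) = z (r + n) div int p ^ r * int p ^ r" using zr[of n] by (simp add: add.commute)
    finally show "z n = (w \<otimes>\<^bsub>Zp p\<^esub> Zp_of_int p (int p ^ r)) n"
      by (simp add: w_def Zp_simps Zp_of_int_def mod_simps)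
  qed
  then show ?thesis unfolding Zp_cong_def z_def[symmetric] cgenideal_def using w by blast
qed

lemma padic_Gamma_extension:
  assumes "prime p" "odd p" shows "is_Gamma_extension p (padic_Gamma p)"
  unfolding padic_Gamma_def using ex1_Gamma_extension[OF assms] by (rule theI')

text \<open>Approximate x by integers. Both the residues of the integers and, by
  \<open>Gamma_int_cong\<close>, those of their Gamma values become stationary, and continuity
  passes to the limit.\<close>

lemma padic_Gamma_residue:
  assumes p: "prime p" "odd p" and x: "x \<in> carrier (Zp p)"
  shows "padic_Gamma p x r = Gamma_int p (nat (x r)) mod int p ^ r"
proof -
  have p0: "p > 0" using p by (simp add: prime_gt_0_nat)
  note ext = padic_Gamma_extension[OF p]
  \<comment> \<open>The summand 2 p^n does not affect the limit but makes every \<open>s n\<close>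
    exceed 1, where the values of an extension are prescribed.\<close>
  define s where "s = (\<lambda>n. nat (x n) + 2 * p ^ n)"
  define y where "y = (\<lambda>n. Zp_of_int p (int (s n)))"
  have y: "y n \<in> carrier (Zp p)" for n by (simp add: y_def Zp_of_int_carrier p0)
  have s1: "s n > 1" for n
  proof -
    have "p ^ n > 0" using p0 by (rule zero_less_power)
    then show ?thesis unfolding s_def by linarith
  qed
  have x0: "x n \<ge> 0" for n using x by (auto simp: Zp_carrier_iff)
  have s_cong: "[int (s n) = x N] (mod int p ^ N)" if "n \<ge> N" for n N
  proof -
    obtain d where d: "n = N + d" using le_Suc_ex[OF \<open>n \<ge> N\<close>] by blast
    have "int p ^ N dvd 2 * int p ^ n" using \<open>n \<ge> N\<close> by (simp add: le_imp_power_dvd dvd_mult)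
    then have "[x n + 2 * int p ^ n = x N + 0] (mod int p ^ N)"
      using Zp_residue_cong[OF x, of N d] unfolding d by (intro cong_add) (auto simp: cong_0_iff)
    then show ?thesis using x0[of n] by (simp add: s_def)
  qed
  have "y \<longlonglongrightarrow> x"
    unfolding tendsto_coordinatewise_iff
  proof
    fix N
    have "y n N = x N" if "n \<ge> N" for n
      using s_cong[OF that] Zp_mod[OF x, of N] by (simp add: y_def Zp_of_int_def cong_def)
    then show "(\<lambda>n. y n N) \<longlonglongrightarrow> x N"
      by (intro tendsto_eventually) (auto simp: eventually_sequentially)
  qed
  then have "(\<lambda>n. padic_Gamma p (y n)) \<longlonglongrightarrow> padic_Gamma p x"
    by (intro continuous_on_tendsto_compose[of "carrier (Zp p)" "padic_Gamma p"])
      (use ext x y in \<open>simp_all add: is_Gamma_extension_def\<close>)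
  then have "(\<lambda>n. padic_Gamma p (y n) r) \<longlonglongrightarrow> padic_Gamma p x r"
    unfolding tendsto_coordinatewise_iff by blast
  moreover have "padic_Gamma p (y n) r = Gamma_int p (nat (x r)) mod int p ^ r" if "n \<ge> r" for n
  proof -
    have "[int (s n) = int (nat (x r))] (mod int (p ^ r))"
      using s_cong[OF that] x0[of r] by simp
    then have "[s n = nat (x r)] (mod p ^ r)" by (simp only: cong_int_iff)
    from Gamma_int_cong[OF p this] show ?thesis
      using ext s1[of n] by (simp add: is_Gamma_extension_def y_def Zp_of_int_def cong_def)
  qed
  then have "(\<lambda>n. padic_Gamma p (y n) r) \<longlonglongrightarrow> Gamma_int p (nat (x r)) mod int p ^ r"
    by (intro tendsto_eventually) (auto simp: eventually_sequentially)
  ultimately show ?thesis by (rule LIMSEQ_unique)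
qed

section \<open>From congruences of rationals to congruences in the p-adic integers\<close>

context prime_localization begin

lemma odd_p: "odd p" using prime_p p_gt_3 prime_odd_nat by simp

lemma p_integral_Zp_carrier: "pint q \<Longrightarrow> Zp_of_rat p q \<in> carrier (Zp p)"
  using Zp_of_rat_correct(1)[OF prime_p] by (metis surj_pair)

text \<open>Compare level r of the defining relation b x = a in \<open>Zp p\<close>, then cancel the
  unit b.\<close>

lemma Zp_of_rat_residue:
  assumes "pint q" shows "pcong r (of_int (Zp_of_rat p q r)) q"
proof -
  obtain a b where ab: "quotient_of q = (a, b)" by (cases "quotient_of q")
  have b: "punit (of_int b)" using assms ab by (simp add: punit_of_int_iff p_integral_def)
  have q: "q = of_int a / of_int b" using ab by (rule quotient_of_div)
  have "(Zp_of_int p b \<otimes>\<^bsub>Zp p\<^esub> Zp_of_rat p q) r = Zp_of_int p a r"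
    using Zp_of_rat_correct(2)[OF prime_p assms ab] by simp
  then have "[b * Zp_of_rat p q r = a] (mod int p ^ r)"
    by (simp add: Zp_simps Zp_of_int_def cong_def mod_simps)
  then have "pcong r (of_int (b * Zp_of_rat p q r)) (of_int a)" by (simp only: pcong_of_int)
  then have "pcong r (of_int b * of_int (Zp_of_rat p q r)) (of_int b * q)"
    using b by (simp add: q punit_def)
  then show ?thesis using b pcong_unit_cancel by blast
qed

lemma Zp_of_rat_cong_0:
  assumes "pint q" "pcong r q 0" shows "Zp_cong p r (Zp_of_rat p q) \<zero>\<^bsub>Zp p\<^esub>"
proof (rule Zp_congI)
  interpret cring "Zp p" by (rule cring_Zp) simp
  show "\<zero>\<^bsub>Zp p\<^esub> \<in> carrier (Zp p)" by simp
  have "pcong r (of_int (Zp_of_rat p q r)) (of_int 0)"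
    using pcong_trans[OF Zp_of_rat_residue[OF assms(1)] assms(2)] by simp
  then have "[Zp_of_rat p q r = 0] (mod int p ^ r)" by (simp only: pcong_of_int)
  then show "Zp_of_rat p q r = \<zero>\<^bsub>Zp p\<^esub> r"
    using Zp_mod[OF p_integral_Zp_carrier[OF assms(1)], of r] by (simp add: cong_def Zp_simps Zp_of_int_def)
qed (use assms p_integral_Zp_carrier in auto)

lemma Zp_residue_power:
  "[(g [^]\<^bsub>Zp p\<^esub> (k::nat)) r = g r ^ k] (mod int p ^ r)"
proof (induction k)
  case 0
  then show ?case by (simp add: Zp_simps(2) Zp_of_int_def cong_def nat_pow_def)
next
  case (Suc k)
  have "(g [^]\<^bsub>Zp p\<^esub> Suc k) r = (g [^]\<^bsub>Zp p\<^esub> k) r * g r mod int p ^ r"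
    by (simp add: Zp_simps nat_pow_def)
  then have "[(g [^]\<^bsub>Zp p\<^esub> Suc k) r = (g [^]\<^bsub>Zp p\<^esub> k) r * g r] (mod int p ^ r)"
    by (simp add: cong_def)
  also have "[(g [^]\<^bsub>Zp p\<^esub> k) r * g r = g r ^ k * g r] (mod int p ^ r)"
    by (intro cong_mult Suc.IH cong_refl)
  finally show ?case by (simp add: mult.commute)
qed

text \<open>A congruence modulo \<open>p\<^sup>r\<^sup>+\<^sup>1\<close> with right-hand side \<open>p\<^sup>r d g\<^sup>k\<close> only depends on \<open>g\<close> modulo \<open>p\<close>.\<close>

lemma Zp_of_rat_cong_mult_power:
  assumes q: "pint q" and d: "pint d" and g: "g \<in> carrier (Zp p)"
    and c: "pcong (Suc r) q (of_nat p ^ r * d * of_int (g 1) ^ k)"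
  shows "Zp_cong p (Suc r) (Zp_of_rat p q)
    (Zp_of_rat p (of_nat p ^ r * d) \<otimes>\<^bsub>Zp p\<^esub> (g [^]\<^bsub>Zp p\<^esub> k))"
proof (rule Zp_congI)
  interpret cring "Zp p" by (rule cring_Zp) simp
  let ?e = "of_nat p ^ r * d"
  let ?h = "g [^]\<^bsub>Zp p\<^esub> k"
  have e: "pint ?e" using d by auto
  have h: "?h \<in> carrier (Zp p)" using g by (rule nat_pow_closed)
  show cl: "Zp_of_rat p ?e \<otimes>\<^bsub>Zp p\<^esub> ?h \<in> carrier (Zp p)"
    using p_integral_Zp_carrier[OF e] h by (rule m_closed)
  have "[?h (1 + r) = ?h 1] (mod int p ^ 1)" by (rule Zp_residue_cong[OF h])
  also have "[?h 1 = g 1 ^ k] (mod int p ^ 1)" by (rule Zp_residue_power)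
  finally have "pcong 1 (of_int (?h (Suc r))) (of_int (g 1) ^ k)"
    unfolding of_int_power[symmetric] pcong_of_int by simp
  then have "pcong (r + 1) (of_nat p ^ r * (d * of_int (?h (Suc r)))) (of_nat p ^ r * (d * of_int (g 1) ^ k))"
    by (intro pcong_p_power_mult pcong_mult_left d)
  then have 1: "pcong (Suc r) (?e * of_int (?h (Suc r))) (?e * of_int (g 1) ^ k)"
    by (simp add: mult.assoc)
  have "pcong (Suc r) (of_int (Zp_of_rat p q (Suc r))) q" by (rule Zp_of_rat_residue[OF q])
  also note c
  also note pcong_sym[OF 1]
  also have "pcong (Suc r) (?e * of_int (?h (Suc r))) (of_int (Zp_of_rat p ?e (Suc r)) * of_int (?h (Suc r)))"
    by (intro pcong_mult_right pcong_sym[OF Zp_of_rat_residue[OF e]]) auto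
  finally have "[Zp_of_rat p q (Suc r) = Zp_of_rat p ?e (Suc r) * ?h (Suc r)] (mod int p ^ Suc r)"
    unfolding of_int_mult[symmetric] pcong_of_int .
  then show "Zp_of_rat p q (Suc r) = (Zp_of_rat p ?e \<otimes>\<^bsub>Zp p\<^esub> ?h) (Suc r)"
    using Zp_mod[OF p_integral_Zp_carrier[OF q], of "Suc r"] by (simp add: cong_def Zp_simps del: power_Suc)
qed (use q p_integral_Zp_carrier in auto)

text \<open>Among the indices below p only 0 fails to be coprime to p, so the product is a full
  factorial.\<close>

lemma Gamma_int_le:
  assumes "n \<le> p" "n > 0" shows "Gamma_int p n = (-1) ^ n * fact (n - 1)"
proof -
  have "{k. k < n \<and> coprime k p} = {1..n - 1}"
  proof (intro subset_antisym subsetI)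
    fix k assume k: "k \<in> {1..n - 1}"
    then have "\<not> p dvd k" using assms by (auto dest: dvd_imp_le)
    then have "coprime k p"
      using prime_imp_coprime[OF prime_p] by (subst coprime_commute) blast
    then show "k \<in> {k. k < n \<and> coprime k p}" using k assms by auto
  next
    fix k assume "k \<in> {k. k < n \<and> coprime k p}"
    then show "k \<in> {1..n - 1}" using p_gt_3 by (cases k) auto
  qed
  then show ?thesis unfolding Gamma_int_def fact_prod by (simp add: of_nat_prod)
qed

text \<open>Modulo p the value depends only on the residue of 1/4, and that residue is a.\<close>

lemma padic_Gamma_quarter:
  assumes "[4 * a = 1] (mod p)" "0 < a" "a < p"
  shows "pcong 1 (of_int (padic_Gamma p (Zp_of_rat p (1 / 4)) 1)) ((-1) ^ a * fact (a - 1))"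
proof -
  have i: "pint (1 / 4)" by (intro pint_divide) auto
  note c = p_integral_Zp_carrier[OF i]
  let ?x = "Zp_of_rat p (1 / 4) 1"
  have x: "0 \<le> ?x" "?x < int p" using c by (auto simp: Zp_carrier_iff dest: spec[of _ 1])
  have "pcong 1 (4 * of_int ?x) (4 * (1 / 4))"
    by (intro pcong_mult_left Zp_of_rat_residue[OF i]) auto
  also have "pcong 1 (4 * (1 / 4)) (of_nat (4 * a))"
    using assms(1) pcong_of_nat[of 1 "4 * a"] by (simp add: cong_sym_eq)
  finally have "pcong 1 (of_int (4 * ?x)) (of_int (4 * int a))" by simp
  then have "[4 * ?x = 4 * int a] (mod int p)" unfolding pcong_of_int by simp
  moreover have "coprime ((2::int)\<^sup>2) (int p)"
    unfolding coprime_power_left_iff using odd_p by simp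
  then have "coprime 4 (int p)" by simp
  ultimately have "[?x = int a] (mod int p)" by (simp add: cong_mult_lcancel)
  then have "?x = int a" using x assms by (simp add: cong_def)
  then have "padic_Gamma p (Zp_of_rat p (1 / 4)) 1 = (-1) ^ a * fact (a - 1) mod int p ^ 1"
    using padic_Gamma_residue[OF prime_p odd_p c, of 1] assms by (simp add: Gamma_int_le)
  then have "[padic_Gamma p (Zp_of_rat p (1 / 4)) 1 = (-1) ^ a * fact (a - 1)] (mod int p ^ 1)"
    by (simp add: cong_def)
  then show ?thesis unfolding pcong_of_int[symmetric] by simp
qed

end

section \<open>Power sums and factorials modulo a prime\<close>

lemma sum_reflect:
  fixes f :: "nat \<Rightarrow> 'a :: comm_monoid_add"
  shows "(\<Sum>i=1..n. f (Suc n - i)) = (\<Sum>i=1..n. f i)"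
  by (rule sum.reindex_bij_witness[of _ "\<lambda>i. Suc n - i" "\<lambda>i. Suc n - i"]) auto

lemma sum_even_odd:
  fixes f :: "nat \<Rightarrow> 'a :: comm_monoid_add"
  shows "(\<Sum>i=1..2*n. f i) = (\<Sum>i=1..n. f (2 * i)) + (\<Sum>i=1..n. f (2 * i - 1))"
  by (induction n) (simp_all add: add_ac)

lemma sum_halves:
  fixes f :: "nat \<Rightarrow> 'a :: comm_monoid_add"
  shows "(\<Sum>i=1..2*n. f i) = (\<Sum>i=1..n. f i) + (\<Sum>i=1..n. f (2 * n + 1 - i))"
proof -
  have "(\<Sum>i=1..2*n. f i) = (\<Sum>i=1..n. f i) + (\<Sum>i=n+1..n+n. f i)"
    unfolding mult_2 by (rule sum.ub_add_nat) simp
  also have "(\<Sum>i=n+1..n+n. f i) = (\<Sum>i=1..n. f (2 * n + 1 - i))"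
    by (rule sum.reindex_bij_witness[of _ "\<lambda>i. 2 * n + 1 - i" "\<lambda>i. 2 * n + 1 - i"]) auto
  finally show ?thesis .
qed

text \<open>Multiplying the exponential generating function, the sum of (-1)^j e^((2j+1)t) over j <
  N, by e^t + e^(-t) telescopes to 1 - (-1)^N e^(2Nt). Multiplying by the Euler series and comparing
  coefficients of t^r gives the formula.\<close>

lemma alternating_odd_power_sum:
  "(\<Sum>j<N. (-1) ^ j * (2 * of_nat j + 1) ^ r) =
    (euler_number r - (-1) ^ N * (\<Sum>i\<le>r. of_nat (r choose i) * euler_number i * (2 * of_nat N) ^ (r - i))) / 2"
proof -
  let ?C = "fps_exp 1 + fps_exp (-1) :: rat fps"
  let ?E = "2 / ?C :: rat fps"
  let ?S = "\<lambda>N. \<Sum>j<N. fps_const ((-1) ^ j) * fps_exp (2 * of_nat j + 1 :: rat)"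
  have "?C * ?S N = 1 - fps_const ((-1) ^ N) * fps_exp (2 * of_nat N)"
  proof (induction N)
    case (Suc N)
    have "?C * ?S (Suc N) = ?C * ?S N + fps_const ((-1) ^ N) * (fps_exp 1 * fps_exp (2 * of_nat N + 1) + fps_exp (-1) * fps_exp (2 * of_nat N + 1))"
      by (simp add: algebra_simps)
    also have "fps_exp 1 * fps_exp (2 * of_nat N + 1) = fps_exp (2 * of_nat (Suc N) :: rat)"
      by (simp add: fps_exp_add_mult[symmetric] algebra_simps)
    also have "fps_exp (-1) * fps_exp (2 * of_nat N + 1) = fps_exp (2 * of_nat N :: rat)"
      by (simp add: fps_exp_add_mult[symmetric] algebra_simps)
    finally have "?C * ?S (Suc N) = 1 - fps_const ((-1) ^ N) * fps_exp (2 * of_nat N) +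
      fps_const ((-1) ^ N) * (fps_exp (2 * of_nat (Suc N)) + fps_exp (2 * of_nat N))"
      unfolding Suc.IH .
    moreover have "1 - c * x + c * (y + x) = 1 - (- c) * y" for c x y :: "rat fps"
      by (simp add: algebra_simps)
    moreover have "fps_const ((-1) ^ Suc N) = - fps_const ((-1) ^ N :: rat)" by simp
    ultimately show ?case by (simp only:)
  qed simp
  moreover have "?E * ?C = 2"
    by (simp add: fps_divide_unit mult.assoc inverse_mult_eq_1)
  then have "2 * ?S N = ?E * (?C * ?S N)" by (simp only: mult.assoc[symmetric])
  ultimately have "2 * ?S N = ?E * (1 - fps_const ((-1) ^ N) * fps_exp (2 * of_nat N))"
    by (simp only:)
  then have *: "2 * ?S N = ?E - fps_const ((-1) ^ N) * (?E * fps_exp (2 * of_nat N))"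
    by (simp only: right_diff_distrib mult_1_right mult.left_commute)
  have "fact r * fps_nth (2 * ?S N) r = 2 * (\<Sum>j<N. (-1) ^ j * (2 * of_nat j + 1) ^ r)"
    by (simp add: numeral_fps_const fps_sum_nth sum_distrib_left)
  moreover have "fact r * fps_nth (?E * fps_exp (2 * of_nat N)) r =
      (\<Sum>i\<le>r. of_nat (r choose i) * euler_number i * (2 * of_nat N) ^ (r - i))"
    unfolding fps_mult_nth sum_distrib_left atLeast0AtMost
  proof (intro sum.cong refl)
    fix i assume "i \<in> {..r}"
    then have "(of_nat (r choose i) :: rat) = fact r / (fact i * fact (r - i))"
      by (simp add: binomial_fact)
    then show "fact r * (fps_nth ?E i * fps_nth (fps_exp (2 * of_nat N)) (r - i)) =
      of_nat (r choose i) * euler_number i * (2 * of_nat N) ^ (r - i)"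
      unfolding euler_number_def by simp
  qed
  moreover have "fact r * fps_nth ?E r = euler_number r" unfolding euler_number_def ..
  moreover have "fact r * fps_nth (2 * ?S N) r =
      fact r * fps_nth ?E r - (-1) ^ N * (fact r * fps_nth (?E * fps_exp (2 * of_nat N)) r)"
    unfolding * by (simp add: algebra_simps)
  ultimately have "2 * (\<Sum>j<N. (-1) ^ j * (2 * of_nat j + 1) ^ r) = euler_number r -
      (-1) ^ N * (\<Sum>i\<le>r. of_nat (r choose i) * euler_number i * (2 * of_nat N) ^ (r - i))"
    by (simp only:)
  then show ?thesis by simp
qed

section \<open>Wilson, Fermat, inverse squares and Euler numbers modulo p\<close>

context prime_localization begin

definition half :: nat where "half = (p - 1) div 2"

lemma p_eq: "p = 2 * half + 1" "p - 1 = 2 * half" and half_gt_1: "half > 1"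
  using odd_p p_gt_3 by (auto simp: half_def elim!: oddE)

lemma of_nat_p: "(of_nat p :: rat) = 2 * of_nat half + 1"
  by (subst p_eq) simp

lemma punit_minus_p: "0 < i \<Longrightarrow> i < p \<Longrightarrow> punit (of_nat p - of_nat i)"
  using punit_of_nat_less[of "p - i"] by simp

lemma pcong_minus_p_square:
  assumes "0 < i" "i < p"
  shows "pcong 1 (1 / (of_nat p - of_nat i)\<^sup>2) (1 / (of_nat i)\<^sup>2)"
proof -
  have "pcong 1 (of_nat p - of_nat i) (- of_nat i)"
    using pcong_add_p[of 1 "- of_nat i"] by (simp add: algebra_simps)
  then have "pcong 1 ((of_nat p - of_nat i)\<^sup>2) ((- of_nat i)\<^sup>2)" by (rule pcong_power) auto
  then have "pcong 1 ((of_nat p - of_nat i)\<^sup>2) ((of_nat i)\<^sup>2)" by simp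
  then show ?thesis by (intro pcong_divide) (use assms punit_minus_p punit_of_nat_less in auto)
qed

text \<open>Let h be the half sum and H the full one. Folding i to p - i gives H = 2h. Splitting by
  parity, where each odd index is p minus an even one, gives H = h/4 + h/4. So 3h = 0, and 3 is a
  unit.\<close>

lemma sum_inverse_squares_half: "pcong 1 (\<Sum>i=1..half. 1 / (of_nat i)\<^sup>2) 0"
  and sum_inverse_squares: "pcong 1 (\<Sum>i=1..p-1. 1 / (of_nat i)\<^sup>2) 0"
proof -
  define h where "h = (\<Sum>i=1..half. 1 / (of_nat i)\<^sup>2 :: rat)"
  define H where "H = (\<Sum>i=1..2*half. 1 / (of_nat i)\<^sup>2 :: rat)"
  have "H = h + (\<Sum>i=1..half. 1 / (of_nat (2 * half + 1 - i))\<^sup>2)"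
    unfolding h_def H_def by (rule sum_halves)
  also have "pcong 1 \<dots> (h + h)"
    unfolding h_def
  proof (intro pcong_add pcong_refl pcong_sum)
    fix i assume i: "i \<in> {1..half}"
    then have "(of_nat (2 * half + 1 - i) :: rat) = of_nat p - of_nat i"
      by (subst of_nat_diff) (auto simp: of_nat_p)
    then show "pcong 1 (1 / (of_nat (2 * half + 1 - i))\<^sup>2) (1 / (of_nat i)\<^sup>2)"
      using pcong_minus_p_square[of i] i p_eq by auto
  qed
  finally have 1: "pcong 1 H (2 * h)" by simp
  have "H = (\<Sum>i=1..half. 1 / (of_nat (2 * i))\<^sup>2) + (\<Sum>i=1..half. 1 / (of_nat (2 * i - 1))\<^sup>2)"
    unfolding H_def by (rule sum_even_odd)
  also have "(\<Sum>i=1..half. 1 / (of_nat (2 * i - 1))\<^sup>2 :: rat) = (\<Sum>i=1..half. 1 / (of_nat (2 * (Suc half - i) - 1))\<^sup>2)"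
    by (rule sum_reflect[symmetric])
  also have "pcong 1 ((\<Sum>i=1..half. 1 / (of_nat (2 * i))\<^sup>2) + \<dots>)
     ((\<Sum>i=1..half. 1 / (of_nat (2 * i))\<^sup>2) + (\<Sum>i=1..half. 1 / (of_nat (2 * i))\<^sup>2))"
  proof (intro pcong_add pcong_refl pcong_sum)
    fix i assume i: "i \<in> {1..half}"
    then have "2 * (Suc half - i) - 1 = p - 2 * i" using p_eq by auto
    then have "(of_nat (2 * (Suc half - i) - 1) :: rat) = of_nat p - of_nat (2 * i)"
      using i p_eq by (simp add: of_nat_diff)
    moreover have "0 < 2 * i" "2 * i < p" using i p_eq by auto
    ultimately show "pcong 1 (1 / (of_nat (2 * (Suc half - i) - 1))\<^sup>2) (1 / (of_nat (2 * i))\<^sup>2)"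
      using pcong_minus_p_square[of "2 * i"] by (simp only:)
  qed
  also have "(\<Sum>i=1..half. 1 / (of_nat (2 * i))\<^sup>2) = h / 4"
    unfolding h_def sum_divide_distrib by (intro sum.cong) (auto simp: power_mult_distrib)
  finally have 2: "pcong 1 H (h / 2)" by simp
  have "pcong 1 (2 * h) (h / 2)" using pcong_trans[OF pcong_sym[OF 1] 2] .
  then have "pcong 1 (2 * (2 * h) - 2 * (h / 2)) (2 * (h / 2) - 2 * (h / 2))"
    by (intro pcong_diff pcong_refl pcong_mult_left) auto
  then have "pcong 1 (3 * h) (3 * 0)" by simp
  then have h: "pcong 1 h 0" by (rule pcong_unit_cancel[rotated]) simp
  then show "pcong 1 (\<Sum>i=1..half. 1 / (of_nat i)\<^sup>2) 0" by (simp add: h_def)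
  have "pcong 1 H (2 * 0)" by (rule pcong_trans[OF 1 pcong_mult_left[OF h]]) auto
  then show "pcong 1 (\<Sum>i=1..p-1. 1 / (of_nat i)\<^sup>2) 0" unfolding H_def p_eq(2) by simp
qed

lemma punit_shift_p: "punit x \<Longrightarrow> pint y \<Longrightarrow> punit (x + of_nat p * y)"
  using punit_pcong[of x 1 "x + of_nat p * y"] pcong_sym[OF pcong_add_p[of y x]] by simp

text \<open>Pairing i with p - i, the terms 1/(4i - p) and 1/(3p - 4i) add up to 2p over the product
  of the denominators. One factor p is thus explicit, and the remaining sum is a multiple of the sum
  of inverse squares modulo p.\<close>

lemma sum_inverse_four_i_minus_p:
  "pcong 2 (\<Sum>i=1..p-1. 1 / (4 * of_nat i - of_nat p)) 0"
proof -
  let ?L = "\<Sum>i=1..p-1. 1 / (4 * of_nat i - of_nat p) :: rat"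
  have u: "punit (4 * of_nat i - of_nat p)" "punit (3 * of_nat p - 4 * of_nat i)"
    and c: "pcong 1 ((4 * of_nat i - of_nat p) * (3 * of_nat p - 4 * of_nat i)) (- (16 * (of_nat i)\<^sup>2))"
    if "i \<in> {1..p-1}" for i
  proof -
    have 4: "punit (4 * of_nat i)" using that by (auto intro!: punit_mult punit_of_nat_less)
    show "punit (4 * of_nat i - of_nat p)" using punit_shift_p[OF 4, of "-1"] by simp
    show "punit (3 * of_nat p - 4 * of_nat i)"
      using punit_shift_p[of "- (4 * of_nat i)" "3"] 4 by (simp add: mult.commute)
    have "(4 * of_nat i - of_nat p) * (3 * of_nat p - 4 * of_nat i)
      = - (16 * (of_nat i)\<^sup>2) + of_nat p * (16 * of_nat i - 3 * of_nat p :: rat)"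
      by (simp add: algebra_simps power2_eq_square)
    moreover have "pint (16 * of_nat i - 3 * of_nat p)" by (intro pint_diff pint_mult) auto
    ultimately show "pcong 1 ((4 * of_nat i - of_nat p) * (3 * of_nat p - 4 * of_nat i)) (- (16 * (of_nat i)\<^sup>2))"
      using pcong_add_p by presburger
  qed
  have "?L = (\<Sum>i=1..p-1. 1 / (4 * of_nat (Suc (p - 1) - i) - of_nat p))"
    by (rule sum_reflect[symmetric])
  also have "\<dots> = (\<Sum>i=1..p-1. 1 / (3 * of_nat p - 4 * of_nat i))"
    by (intro sum.cong refl) (auto simp: of_nat_diff algebra_simps)
  finally have "2 * ?L = ?L + (\<Sum>i=1..p-1. 1 / (3 * of_nat p - 4 * of_nat i))" by simp
  also have "\<dots> = (\<Sum>i=1..p-1. of_nat p * (2 / ((4 * of_nat i - of_nat p) * (3 * of_nat p - 4 * of_nat i))))"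
    unfolding sum.distrib[symmetric] using u[THEN punit_nz]
    by (intro sum.cong refl) (simp add: divide_simps)
  also have "\<dots> = of_nat p * (\<Sum>i=1..p-1. 2 / ((4 * of_nat i - of_nat p) * (3 * of_nat p - 4 * of_nat i)))"
    by (simp only: sum_distrib_left)
  also have "pcong (Suc 1) \<dots> (of_nat p * (\<Sum>i=1..p-1. 2 / (- (16 * (of_nat i)\<^sup>2))))"
    using u c by (intro pcong_p_mult pcong_sum pcong_divide)
      (auto intro!: punit_of_nat_less punit_mult[of 16] punit_power)
  also have "(\<Sum>i=1..p-1. 2 / (- (16 * (of_nat i)\<^sup>2)) :: rat) = - 1 / 8 * (\<Sum>i=1..p-1. 1 / (of_nat i)\<^sup>2)"
    unfolding sum_distrib_left by (intro sum.cong) auto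
  also have "pcong (Suc 1) (of_nat p * (- 1 / 8 * (\<Sum>i=1..p-1. 1 / (of_nat i)\<^sup>2))) (of_nat p * (- 1 / 8 * 0))"
    by (intro pcong_p_mult pcong_mult_left sum_inverse_squares pint_divide) auto
  finally have "pcong 2 (2 * ?L) (2 * 0)" by (simp add: numeral_2_eq_2)
  then show ?thesis by (rule pcong_unit_cancel[rotated]) simp
qed

lemma fermat_pcong: "\<not> p dvd a \<Longrightarrow> pcong 1 (of_nat a ^ (p - 1)) 1"
  using fermat_theorem[OF prime_p, of a] pcong_of_nat[of "a ^ (p - 1)" 1] by simp

text \<open>Starting from Wilson's theorem, each step trades the factor p - 1 - k of the first
  factorial for -(k + 1).\<close>

lemma wilson_pcong: "k < p \<Longrightarrow> pcong 1 (fact (p - 1 - k) * fact k * (-1) ^ k) (-1)"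
proof (induction k)
  case 0
  have "[fact (p - 1) = - 1] (mod int p)" using wilson_theorem[OF prime_p] .
  then show ?case using pcong_of_int[of 1 "fact (p - 1)" "-1"] by simp
next
  case (Suc k)
  have "p - 1 - k = Suc (p - 1 - Suc k)" using Suc.prems by simp
  then have f: "(fact (p - 1 - k) :: rat) = of_nat (p - 1 - k) * fact (p - 1 - Suc k)"
    by (metis fact_Suc)
  have "(of_nat (p - 1 - k) :: rat) = of_nat p - of_nat (Suc k)" using Suc.prems by (simp add: of_nat_diff)
  then have 1: "pcong 1 (of_nat (p - 1 - k)) (- of_nat (Suc k))"
    using pcong_add_p[of 1 "- of_nat (Suc k)"] by (simp add: algebra_simps)
  have "fact (p - 1 - Suc k) * fact (Suc k) * (-1) ^ Suc k = - of_nat (Suc k) * (fact (p - 1 - Suc k) * fact k * (-1) ^ k :: rat)"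
    by (simp add: algebra_simps)
  also have "pcong 1 \<dots> (of_nat (p - 1 - k) * (fact (p - 1 - Suc k) * fact k * (-1) ^ k))"
  proof (intro pcong_mult_right pcong_sym[OF 1] pint_mult pint_power)
    show "pint (fact (p - 1 - Suc k))" "pint (fact k)" using pint_of_nat[of "fact _"] by simp_all
  qed auto
  also have "\<dots> = fact (p - 1 - k) * fact k * (-1) ^ k" unfolding f by (simp add: mult_ac)
  also have "pcong 1 \<dots> (-1)" using Suc by simp
  finally show ?case .
qed

lemma euler_number_pint: "pint (euler_number k)"
  using euler_number_Ints[of k] by (auto elim!: Ints_cases)

lemma power_p_minus_3:
  assumes "\<not> p dvd a" shows "pcong 1 (of_nat a ^ (p - 3)) (1 / (of_nat a)\<^sup>2)"
proof -
  have u: "punit ((of_nat a)\<^sup>2)" using assms by (intro punit_power) (simp add: punit_of_nat_iff)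
  have "p - 1 = 2 + (p - 3)" using p_gt_3 by simp
  then have "(of_nat a)\<^sup>2 * of_nat a ^ (p - 3) = (of_nat a ^ (p - 1) :: rat)"
    by (simp only: power_add)
  also have "pcong 1 \<dots> 1" using fermat_pcong[OF assms] .
  also have "1 = (of_nat a)\<^sup>2 * (1 / (of_nat a)\<^sup>2 :: rat)" using punit_nz[OF u] by simp
  finally show ?thesis using pcong_unit_cancel[OF u] by blast
qed

text \<open>Take N = p and exponent p - 3 in \<open>alternating_odd_power_sum\<close>. By Fermat the
  power p - 3 acts as an inverse square, and the terms j and p - 1 - j coincide modulo p.\<close>

lemma euler_number_pcong:
  "pcong 1 (euler_number (p - 3)) (2 * (\<Sum>j<half. (-1) ^ j / (2 * of_nat j + 1)\<^sup>2))"
proof -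
  let ?r = "p - 3"
  have "even ?r" using odd_p p_gt_3 by simp
  have r0: "?r > 0" using p_gt_3 by simp
  let ?f = "\<lambda>j. (-1) ^ j * (2 * of_nat j + 1) ^ ?r :: rat"
  \<comment> \<open>All terms except the last contain a positive power of 2p.\<close>
  have "pcong 1 (\<Sum>i\<le>?r. of_nat (?r choose i) * euler_number i * (2 * of_nat p) ^ (?r - i))
     (\<Sum>i\<le>?r. if i = ?r then euler_number ?r else 0)"
  proof (intro pcong_sum)
    fix i assume i: "i \<in> {..?r}"
    show "pcong 1 (of_nat (?r choose i) * euler_number i * (2 * of_nat p) ^ (?r - i)) (if i = ?r then euler_number ?r else 0)"
    proof (cases "i = ?r")
      case False
      then obtain d where "?r - i = Suc d" using i by (cases "?r - i") auto
      then have "of_nat (?r choose i) * euler_number i * (2 * of_nat p) ^ (?r - i)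
        = of_nat p * (of_nat (?r choose i) * euler_number i * (2 * (2 * of_nat p) ^ d))" by simp
      moreover have "pcong 1 \<dots> 0"
        by (intro pcong_p_0 pint_mult euler_number_pint pint_power) auto
      ultimately show ?thesis using False by (simp only: if_False)
    qed simp
  qed
  then have 1: "pcong 1 (\<Sum>i\<le>?r. of_nat (?r choose i) * euler_number i * (2 * of_nat p) ^ (?r - i)) (euler_number ?r)"
    by simp
  have "(\<Sum>j<p. ?f j) = (euler_number ?r + (\<Sum>i\<le>?r. of_nat (?r choose i) * euler_number i * (2 * of_nat p) ^ (?r - i))) / 2"
    unfolding alternating_odd_power_sum using odd_p by simp
  also have "pcong 1 \<dots> ((euler_number ?r + euler_number ?r) / 2)"
    by (intro pcong_divide_unit pcong_add 1) auto
  finally have E: "pcong 1 (\<Sum>j<p. ?f j) (euler_number ?r)" by simp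
  \<comment> \<open>The middle index has 2j + 1 = p, where Fermat fails; its term vanishes modulo p
    since the exponent p - 3 is positive.\<close>
  have "{..<p} = {..<half} \<union> {half} \<union> {half<..<p}" using p_eq half_gt_1 by auto
  then have s1: "(\<Sum>j<p. ?f j) = sum ?f ({..<half} \<union> {half} \<union> {half<..<p})" by (simp only:)
  have s2: "sum ?f ({..<half} \<union> {half} \<union> {half<..<p}) = sum ?f ({..<half} \<union> {half}) + (\<Sum>j\<in>{half<..<p}. ?f j)"
    by (rule sum.union_disjoint) auto
  have s3: "sum ?f ({..<half} \<union> {half}) = (\<Sum>j<half. ?f j) + ?f half"
    by (subst sum.union_disjoint) auto
  have s4: "(\<Sum>j\<in>{half<..<p}. ?f j) = (\<Sum>j<half. ?f (p - 1 - j))"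
    by (rule sum.reindex_bij_witness[of _ "\<lambda>j. p - 1 - j" "\<lambda>j. p - 1 - j"]) (use p_eq in auto)
  have c: "pcong 1 ((\<Sum>j<half. ?f j) + ?f half + (\<Sum>j<half. ?f (p - 1 - j)))
    ((\<Sum>j<half. (-1) ^ j * (1 / (2 * of_nat j + 1)\<^sup>2)) + 0 + (\<Sum>j<half. (-1) ^ j * (1 / (2 * of_nat j + 1)\<^sup>2)))"
  proof (intro pcong_add pcong_sum)
    fix j assume "j \<in> {..<half}"
    then have j: "j < half" by simp
    have "\<not> p dvd 2 * j + 1" using j p_eq(1) by (auto dest: dvd_imp_le)
    from power_p_minus_3[OF this]
    have *: "pcong 1 ((2 * of_nat j + 1) ^ ?r) (1 / (2 * of_nat j + 1)\<^sup>2)" by (simp add: add.commute)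
    then show 1: "pcong 1 (?f j) ((-1) ^ j * (1 / (2 * of_nat j + 1)\<^sup>2))"
      by (intro pcong_mult_left) auto
    have e: "(-1 :: rat) ^ (p - 1 - j) = (-1) ^ j"
    proof -
      have "(-1 :: rat) ^ (p - 1 - j) * (-1) ^ j = (-1) ^ (2 * half)"
        using j p_eq by (simp add: power_add[symmetric])
      then show ?thesis by (cases "even j") auto
    qed
    have "2 * of_nat (p - 1 - j) + 1 = - (2 * of_nat j + 1) + of_nat p * (2 :: rat)"
      using j p_eq(1) by (simp add: of_nat_diff)
    then have "pcong 1 (2 * of_nat (p - 1 - j) + 1) (- (2 * of_nat j + 1))"
      using pcong_add_p[of 2 "- (2 * of_nat j + 1)"] by (simp only: pint_numeral)
    then have "pcong 1 ((2 * of_nat (p - 1 - j) + 1) ^ ?r) ((- (2 * of_nat j + 1)) ^ ?r)"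
      by (rule pcong_power) (auto simp del: minus_add_distrib)
    also have "(- (2 * of_nat j + 1)) ^ ?r = (2 * of_nat j + 1 :: rat) ^ ?r"
      unfolding uminus_power_if using \<open>even ?r\<close> by simp
    finally have "pcong 1 (?f (p - 1 - j)) (?f j)" unfolding e by (intro pcong_mult_left) auto
    then show "pcong 1 (?f (p - 1 - j)) ((-1) ^ j * (1 / (2 * of_nat j + 1)\<^sup>2))"
      using 1 by (rule pcong_trans)
  next
    have "?f half = of_nat p * ((-1) ^ half * of_nat p ^ (?r - 1))"
      using r0 unfolding of_nat_p[symmetric] by (cases ?r) auto
    moreover have "pint ((-1) ^ half * of_nat p ^ (?r - 1))"
      using pint_of_int[of "(-1) ^ half * int p ^ (?r - 1)"] by simp
    then have "pcong 1 (of_nat p * ((-1) ^ half * of_nat p ^ (?r - 1))) 0" by (rule pcong_p_0)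
    ultimately show "pcong 1 (?f half) 0" by (simp only:)
  qed
  have d: "(\<Sum>j<half. (-1) ^ j * (1 / (2 * of_nat j + 1)\<^sup>2)) + 0 + (\<Sum>j<half. (-1) ^ j * (1 / (2 * of_nat j + 1)\<^sup>2))
    = 2 * (\<Sum>j<half. (-1) ^ j / (2 * of_nat j + 1)\<^sup>2 :: rat)"
    by (simp only: times_divide_eq_right mult_1_right add_0_right mult_2)
  have "pcong 1 (\<Sum>j<p. ?f j) (2 * (\<Sum>j<half. (-1) ^ j / (2 * of_nat j + 1)\<^sup>2))"
    using c unfolding s1 s2 s3 s4 d .
  then show ?thesis using pcong_trans[OF pcong_sym[OF E]] by blast
qed

text \<open>With A and B the sums of inverse squares over the classes 1 and 3 modulo 4 below p, the
  Euler number is 2(A - B), while A + B vanishes because odd numbers reflect to even ones. Folding i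
  to 2m + 1 - i, where the denominator becomes 2p - (4i - 1) before squaring, turns the sum into 2B
  = -(A - B) + (A + B).\<close>

lemma sum_inverse_squares_four_i_minus_1:
  assumes m: "p = 4 * m + 1"
  shows "pcong 1 (\<Sum>i=1..2*m. 1 / (4 * of_nat i - 1)\<^sup>2) (- euler_number (p - 3) / 2)"
proof -
  have half: "half = 2 * m" using m p_eq(1) by linarith
  define A where "A = (\<Sum>i=1..m. 1 / (4 * of_nat i - 3)\<^sup>2 :: rat)"
  define B where "B = (\<Sum>i=1..m. 1 / (4 * of_nat i - 1)\<^sup>2 :: rat)"
  have "(\<Sum>j<2*k. (-1) ^ j / (2 * of_nat j + 1)\<^sup>2) =
    (\<Sum>i=1..k. 1 / (4 * of_nat i - 3)\<^sup>2) - (\<Sum>i=1..k. 1 / (4 * of_nat i - 1)\<^sup>2 :: rat)" for k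
    by (induction k) (simp_all add: algebra_simps)
  then have E: "pcong 1 (euler_number (p - 3)) (2 * (A - B))"
    using euler_number_pcong by (simp add: half A_def B_def)
  have "A + B = (\<Sum>i=1..2*m. 1 / (2 * of_nat i - 1)\<^sup>2)"
    unfolding A_def B_def by (induction m) (simp_all add: algebra_simps)
  also have "\<dots> = (\<Sum>i=1..2*m. 1 / (2 * of_nat (Suc (2 * m) - i) - 1)\<^sup>2)"
    by (rule sum_reflect[symmetric])
  also have "pcong 1 \<dots> (\<Sum>i=1..2*m. 1 / (of_nat (2 * i))\<^sup>2)"
  proof (intro pcong_sum)
    fix i assume i: "i \<in> {1..2*m}"
    then have "2 * of_nat (Suc (2 * m) - i) - 1 = of_nat p - (of_nat (2 * i) :: rat)"
      by (subst m) (simp add: of_nat_diff)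
    moreover have "0 < 2 * i" "2 * i < p" using i m by auto
    ultimately show "pcong 1 (1 / (2 * of_nat (Suc (2 * m) - i) - 1)\<^sup>2) (1 / (of_nat (2 * i))\<^sup>2)"
      using pcong_minus_p_square[of "2 * i"] by (simp only:)
  qed
  also have "(\<Sum>i=1..2*m. 1 / (of_nat (2 * i))\<^sup>2 :: rat) = 1 / 4 * (\<Sum>i=1..half. 1 / (of_nat i)\<^sup>2)"
    unfolding sum_distrib_left half by (intro sum.cong) (auto simp: power_mult_distrib)
  also have "pcong 1 \<dots> (1 / 4 * 0)"
    by (intro pcong_mult_left sum_inverse_squares_half pint_divide) auto
  finally have AB: "pcong 1 (A + B) 0" by simp
  have "(\<Sum>i=1..2*m. 1 / (4 * of_nat i - 1)\<^sup>2) = B + (\<Sum>i=1..m. 1 / (4 * of_nat (2 * m + 1 - i) - 1)\<^sup>2)"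
    unfolding B_def by (rule sum_halves)
  also have "pcong 1 \<dots> (B + B)"
    unfolding B_def
  proof (intro pcong_add pcong_refl pcong_sum)
    fix i assume i: "i \<in> {1..m}"
    have "of_nat (4 * i - 1) = 4 * of_nat i - (1 :: rat)" using i by (simp add: of_nat_diff)
    moreover have "0 < 4 * i - 1" "4 * i - 1 < p" using i m by auto
    ultimately have u: "punit (4 * of_nat i - 1)" using punit_of_nat_less[of "4 * i - 1"] by (simp only:)
    have e: "4 * of_nat (2 * m + 1 - i) - 1 = - (4 * of_nat i - 1) + of_nat p * (2 :: rat)"
      using i by (subst m) (simp add: of_nat_diff)
    have c: "pcong 1 (4 * of_nat (2 * m + 1 - i) - 1) (- (4 * of_nat i - 1))"
      unfolding e by (rule pcong_add_p) auto
    have u2: "punit (4 * of_nat (2 * m + 1 - i) - 1)"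
      unfolding e by (rule punit_shift_p) (use u in \<open>simp_all only: punit_minus_iff pint_numeral\<close>)
    have "pcong 1 ((4 * of_nat (2 * m + 1 - i) - 1)\<^sup>2) ((4 * of_nat i - 1)\<^sup>2)"
      using pcong_power[OF c, of 2] u by (simp only: power2_minus) (metis pint_minus_iff punit_pint)
    then show "pcong 1 (1 / (4 * of_nat (2 * m + 1 - i) - 1)\<^sup>2) (1 / (4 * of_nat i - 1)\<^sup>2)"
      using u u2 by (intro pcong_divide) auto
  qed
  also have "B + B = - (2 * (A - B)) / 2 + (A + B)" by (simp add: field_simps)
  also have "pcong 1 \<dots> (- euler_number (p - 3) / 2 + 0)"
    by (intro pcong_add AB pcong_divide_unit pcong_minus pcong_sym[OF E]) auto
  finally show ?thesis by simp
qed

end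

section \<open>A recurrence for truncated Dixon sums\<close>

text \<open>Determined by \<open>dixon_cert_rec\<close>; found by solving for the coefficients of a polynomial ansatz.\<close>

definition dixon_cert :: "'a \<Rightarrow> 'a \<Rightarrow> 'a :: comm_ring_1" where
  "dixon_cert b k = - 232 + 414 * k - 294 * k ^ 2 + 96 * k ^ 3 - 12 * k ^ 4
     + (784 - 1113 * k + 594 * k ^ 2 - 132 * k ^ 3 + 9 * k ^ 4) * b
     + (- 1042 + 1107 * k - 396 * k ^ 2 + 45 * k ^ 3) * b ^ 2
     + (682 - 483 * k + 87 * k ^ 2) * b ^ 3 + (78 * k - 220) * b ^ 4 + 28 * b ^ 5"

text \<open>The inductive step of \<open>dixon_telescope\<close>, for the summand of index k, after
  the cube of (b)_(k-2) / k! has been divided out.\<close>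

lemma dixon_cert_rec:
  fixes b k :: "'a :: field_char_0"
  shows "(b - 2) ^ 5 * (b - 1) ^ 3 + 3 * (3 * b - 2) * (3 * b - 4) * (b + k - 2) ^ 3 * (b + k - 1) ^ 3 =
   (b + k - 2) ^ 3 * dixon_cert b (k + 1) - k ^ 3 * dixon_cert b k" (is "?l = ?r")
proof -
  have "?l - ?r = 0"
    unfolding dixon_cert_def by (simp add: algebra_simps eval_nat_numeral)
  then show ?thesis by simp
qed

text \<open>The creative telescoping recurrence, relating the parameters b - 2 and b. The summands
  with k at least 2 share the cube of (b)_(k-2) / k!, which is why the induction starts from sums of
  two terms.\<close>

lemma dixon_telescope:
  fixes b :: "'a :: field_char_0"
  shows "(b - 2)\<^sup>2 * (\<Sum>k<K+2. (pochhammer (b - 2) k / fact k) ^ 3) +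
    3 * (3 * b - 2) * (3 * b - 4) * (\<Sum>k<K+2. (pochhammer b k / fact k) ^ 3) =
    (pochhammer b K / fact (K + 1)) ^ 3 * dixon_cert b (of_nat (K + 2))"
proof (induction K)
  case 0
  have "(b - 2)\<^sup>2 * (1 + (b - 2) ^ 3) + 3 * (3 * b - 2) * (3 * b - 4) * (1 + b ^ 3) = dixon_cert b 2"
    unfolding dixon_cert_def by (simp add: algebra_simps eval_nat_numeral)
  then show ?case by (simp add: numeral_2_eq_2)
next
  case (Suc K)
  \<comment> \<open>The index of the entering summand; c is the quotient whose cube appears in the
    boundary term of the induction hypothesis.\<close>
  define k where "k = (of_nat (K + 2) :: 'a)"
  define c where "c = pochhammer b K / fact (K + 1)"
  have k: "k \<noteq> 0" unfolding k_def of_nat_eq_0_iff by simp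
  have ks: "of_nat (Suc K + 2) = k + 1" by (simp add: k_def)
  have f: "fact (K + 2) = k * fact (K + 1)" by (simp add: k_def)
  have "pochhammer (b - 2) (K + 2) = (b - 2) * (b - 1) * pochhammer b K"
    by (simp add: pochhammer_rec)
  then have t1: "pochhammer (b - 2) (K + 2) / fact (K + 2) = c * ((b - 2) * (b - 1) / k)"
    unfolding f c_def by (simp add: mult_ac)
  have "pochhammer b (K + 2) = pochhammer b K * ((b + k - 2) * (b + k - 1))"
    by (simp add: pochhammer_Suc k_def)
  then have t2: "pochhammer b (K + 2) / fact (K + 2) = c * ((b + k - 2) * (b + k - 1) / k)"
    unfolding f c_def by (simp add: mult_ac)
  have "pochhammer b (Suc K) = pochhammer b K * (b + k - 2)"
    by (simp add: pochhammer_Suc k_def)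
  moreover have "fact (Suc K + 1) = k * fact (K + 1)" using f by simp
  ultimately have t3: "pochhammer b (Suc K) / fact (Suc K + 1) = c * ((b + k - 2) / k)"
    unfolding c_def by (simp add: mult_ac)
  have s: "(\<Sum>k<Suc K + 2. f k) = (\<Sum>k<K + 2. f k) + f (K + 2)" for f :: "nat \<Rightarrow> 'a" by simp
  have d: "x * (S + T) + y * (S' + T') = (x * S + y * S') + (x * T + y * T')" for x y S S' T T' :: 'a
    by (simp add: algebra_simps)
  have "(b - 2)\<^sup>2 * (\<Sum>k<Suc K+2. (pochhammer (b - 2) k / fact k) ^ 3) +
    3 * (3 * b - 2) * (3 * b - 4) * (\<Sum>k<Suc K+2. (pochhammer b k / fact k) ^ 3) =
    c ^ 3 * dixon_cert b k + ((b - 2)\<^sup>2 * (c * ((b - 2) * (b - 1) / k)) ^ 3 +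
     3 * (3 * b - 2) * (3 * b - 4) * (c * ((b + k - 2) * (b + k - 1) / k)) ^ 3)"
    unfolding s d Suc.IH t1 t2 unfolding c_def k_def ..
  also have "\<dots> = (c / k) ^ 3 * (k ^ 3 * dixon_cert b k + ((b - 2) ^ 5 * (b - 1) ^ 3 +
     3 * (3 * b - 2) * (3 * b - 4) * (b + k - 2) ^ 3 * (b + k - 1) ^ 3))"
  proof -
    define X where "X = (c / k) ^ 3"
    have e: "(c * (A / k)) ^ 3 = X * A ^ 3" for A by (simp add: X_def power_mult_distrib power_divide)
    have c: "c ^ 3 = X * k ^ 3" using k by (simp add: X_def power_divide)
    have p5: "(b - 2) ^ 5 = (b - 2)\<^sup>2 * (b - 2) ^ 3" by (simp only: power_add[symmetric]) simp
    show ?thesis unfolding e c X_def[symmetric] p5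
      by (simp only: power_mult_distrib distrib_left mult_ac)
  qed
  also have "\<dots> = (c * ((b + k - 2) / k)) ^ 3 * dixon_cert b (k + 1)"
    unfolding dixon_cert_rec by (simp add: power_mult_distrib power_divide)
  finally show ?case unfolding t3 ks .
qed

text \<open>The first K terms of the hypergeometric series 3F2(x, x, x; 1, 1; 1), encoded as a
  polynomial so that the recurrence can be differentiated in x.\<close>

definition dixon_poly :: "nat \<Rightarrow> rat poly" where
  "dixon_poly K = (\<Sum>k<K. (Polynomial.smult (1 / fact k) (pochhammer [:0, 1:] k)) ^ 3)"

lemma poly_pochhammer: "poly (pochhammer q k) x = pochhammer (poly q x) k"
  by (simp add: pochhammer_prod poly_prod)

lemma poly_dixon_poly: "poly (dixon_poly K) x = (\<Sum>k<K. (pochhammer x k / fact k) ^ 3)"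
  by (simp add: dixon_poly_def poly_sum poly_pochhammer)

text \<open>The boundary term W of the recurrence. The cube of (x)_K makes it p-adically small near
  0, -1, ..., -(K - 1).\<close>

definition dixon_bdry :: "nat \<Rightarrow> rat poly" where
  "dixon_bdry K = (Polynomial.smult (1 / fact (K + 1)) (pochhammer [:0, 1:] K)) ^ 3 * dixon_cert [:0, 1:] (of_nat (K + 2))"

lemma poly_dixon_cert: "poly (dixon_cert q r) x = dixon_cert (poly q x) (poly r x)"
  unfolding dixon_cert_def by simp

text \<open>Both sides agree at every rational point. The coefficient \<open>[:24, -54, 27:]\<close>
  is 3(3x - 2)(3x - 4).\<close>

lemma dixon_poly_rec:
  "[:-2, 1:]\<^sup>2 * (dixon_poly (K + 2) \<circ>\<^sub>p [:-2, 1:]) + [:24, -54, 27:] * dixon_poly (K + 2) = dixon_bdry K"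
proof -
  have "poly ([:-2, 1:]\<^sup>2 * (dixon_poly (K + 2) \<circ>\<^sub>p [:-2, 1:]) + [:24, -54, 27:] * dixon_poly (K + 2)) x
    = poly (dixon_bdry K) x" for x
  proof -
    have "poly [:24, -54, 27:] x = 3 * (3 * x - 2) * (3 * x - 4)" by (simp add: algebra_simps)
    then show ?thesis
      using dixon_telescope[of x K] unfolding poly_add poly_mult poly_pcompose poly_dixon_poly
      by (simp add: dixon_bdry_def poly_pochhammer poly_dixon_cert)
  qed
  then show ?thesis by (intro poly_eq_poly_eq_iff[THEN iffD1] ext)
qed

lemma dixon_value_rec:
  "(x - 2)\<^sup>2 * poly (dixon_poly (K + 2)) (x - 2) + 3 * (3 * x - 2) * (3 * x - 4) * poly (dixon_poly (K + 2)) x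
    = poly (dixon_bdry K) x"
proof -
  have "poly [:24, -54, 27:] x = 3 * (3 * x - 2) * (3 * x - 4)" by (simp add: algebra_simps)
  then show ?thesis
    using arg_cong[OF dixon_poly_rec[of K], of "\<lambda>q. poly q x"] unfolding poly_add poly_mult poly_pcompose by simp
qed

lemma dixon_deriv_rec:
  "2 * (x - 2) * poly (dixon_poly (K + 2)) (x - 2) + (x - 2)\<^sup>2 * poly (pderiv (dixon_poly (K + 2))) (x - 2)
    + 54 * (x - 1) * poly (dixon_poly (K + 2)) x
    + 3 * (3 * x - 2) * (3 * x - 4) * poly (pderiv (dixon_poly (K + 2))) x
    = poly (pderiv (dixon_bdry K)) x"
proof -
  let ?F = "dixon_poly (K + 2)"
  have 1: "poly [:24, -54, 27:] x = 3 * (3 * x - 2) * (3 * x - 4)" by (simp add: algebra_simps)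
  have 2: "poly (pderiv [:24, -54, 27:]) x = 54 * (x - 1)" by (simp add: pderiv_pCons algebra_simps)
  have 3: "poly (pderiv ([:-2, 1:]\<^sup>2)) x = 2 * (x - 2)"
    by (simp add: pderiv_pCons power2_eq_square pderiv_mult algebra_simps)
  have 4: "poly (pderiv (?F \<circ>\<^sub>p [:-2, 1:])) x = poly (pderiv ?F) (x - 2)"
    by (simp add: pderiv_pcompose poly_pcompose pderiv_pCons)
  have "poly (pderiv (dixon_bdry K)) x =
    poly ([:-2, 1:]\<^sup>2) x * poly (pderiv (?F \<circ>\<^sub>p [:-2, 1:])) x + poly (?F \<circ>\<^sub>p [:-2, 1:]) x * poly (pderiv ([:-2, 1:]\<^sup>2)) x
    + (poly [:24, -54, 27:] x * poly (pderiv ?F) x + poly ?F x * poly (pderiv [:24, -54, 27:]) x)"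
    unfolding dixon_poly_rec[symmetric] pderiv_add pderiv_mult poly_add poly_mult by simp
  then show ?thesis unfolding 1 2 3 4 poly_pcompose by (simp add: algebra_simps)
qed

lemma pochhammer_half: "pochhammer (1 / 2) k / fact k = (of_nat ((2 * k) choose k) / 4 ^ k :: rat)"
proof -
  have "(of_nat ((2 * k) choose k) :: rat) = fact (2 * k) / (fact k * fact k)"
    by (simp add: binomial_fact mult_2)
  also have "fact (2 * k) = (4 ^ k * pochhammer (1 / 2) k * fact k :: rat)"
    by (simp add: fact_double power_mult)
  finally show ?thesis by simp
qed

text \<open>The logarithmic derivative of (x)_k at 1/2 is the sum of 1/(j + 1/2) over j < k.\<close>

lemma poly_pderiv_pochhammer_half:
  "poly (pderiv (pochhammer [:0, 1:] k)) (1 / 2) = pochhammer (1 / 2) k * (2 * odd_harmonic 1 k)"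
proof (induction k)
  case (Suc k)
  have nz: "(2 * of_nat k + 1 :: rat) \<noteq> 0" by (metis of_nat_Suc of_nat_mult of_nat_numeral of_nat_neq_0 add.commute)
  have "poly (pderiv (pochhammer [:0, 1:] (Suc k))) (1 / 2) =
    pochhammer (1 / 2) k * (2 * odd_harmonic 1 k) * (1 / 2 + of_nat k) + pochhammer (1 / 2) k"
    by (simp add: pochhammer_Suc pderiv_mult pderiv_add pderiv_pCons poly_pochhammer Suc.IH of_nat_poly pderiv_smult algebra_simps del: mult_pCons_right)
  also have "\<dots> = pochhammer (1 / 2) (Suc k) * (2 * odd_harmonic 1 (Suc k))"
    using nz by (simp add: pochhammer_Suc odd_harmonic_def field_simps)
  finally show ?case .
qed (simp add: odd_harmonic_def)

lemma poly_pderiv_cube: "poly (pderiv (q ^ 3)) (x :: rat) = 3 * (poly q x)\<^sup>2 * poly (pderiv q) x"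
  by (simp add: power3_eq_cube power2_eq_square pderiv_mult algebra_simps)

text \<open>Cubing triples the logarithmic derivative, whence the factor 6. The summand k = 0 drops
  out since its odd harmonic number is 0.\<close>

lemma poly_pderiv_dixon_half:
  assumes "K > 0"
  shows "poly (pderiv (dixon_poly K)) (1 / 2) =
    6 * (\<Sum>k=1..K-1. of_nat ((2 * k) choose k) ^ 3 * odd_harmonic 1 k / 64 ^ k)"
proof -
  have "poly (pderiv (dixon_poly K)) (1 / 2) = (\<Sum>k<K. 3 * (pochhammer (1 / 2) k / fact k)\<^sup>2 *
    (pochhammer (1 / 2) k / fact k * (2 * odd_harmonic 1 k)))"
    unfolding dixon_poly_def higher_pderiv_sum[of 1, simplified] poly_sum
    by (intro sum.cong refl)
       (simp add: poly_pderiv_cube pderiv_smult poly_pderiv_pochhammer_half poly_pochhammer)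
  also have "\<dots> = (\<Sum>k<K. 6 * (of_nat ((2 * k) choose k) ^ 3 * odd_harmonic 1 k / 64 ^ k))"
  proof (intro sum.cong refl)
    fix k
    have "(64 :: rat) ^ k = (4 ^ 3) ^ k" by simp
    then have "(64 :: rat) ^ k = (4 ^ k) ^ 3" by (simp only: power_mult[symmetric] mult.commute)
    then show "3 * (pochhammer (1 / 2) k / fact k)\<^sup>2 * (pochhammer (1 / 2) k / fact k * (2 * odd_harmonic 1 k))
      = 6 * (of_nat ((2 * k) choose k) ^ 3 * odd_harmonic 1 k / 64 ^ k)"
      unfolding pochhammer_half by (simp add: field_simps power2_eq_square power3_eq_cube)
  qed
  also have "{..<K} = insert 0 {1..K-1}" using assms by auto
  finally show ?thesis by (simp add: odd_harmonic_def sum_distrib_left)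
qed

section \<open>p-integral polynomials and the Dixon sum near negative integers\<close>

context prime_localization begin

definition pint_poly :: "rat poly \<Rightarrow> bool" where
  "pint_poly f \<longleftrightarrow> (\<forall>i. pint (Polynomial.coeff f i))"

lemma pint_poly_const: "pint a \<Longrightarrow> pint_poly [:a:]"
  by (auto simp: pint_poly_def coeff_pCons split: nat.splits)

lemma pint_poly_numeral [intro]: "pint_poly (numeral a)" "pint_poly 0" "pint_poly 1" "pint_poly (of_nat b)"
  using pint_poly_const[of "numeral a"] pint_poly_const[of 0] pint_poly_const[of 1] pint_poly_const[of "of_nat b"]
  by (auto simp: numeral_poly of_nat_poly pCons_one)

lemma pint_poly_X [intro]: "pint_poly [:0, 1:]"
  by (auto simp: pint_poly_def coeff_pCons split: nat.splits)

lemma pint_poly_add [intro]: "pint_poly f \<Longrightarrow> pint_poly g \<Longrightarrow> pint_poly (f + g)"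
  by (auto simp: pint_poly_def)

lemma pint_poly_diff [intro]: "pint_poly f \<Longrightarrow> pint_poly g \<Longrightarrow> pint_poly (f - g)"
  by (auto simp: pint_poly_def)

lemma pint_poly_uminus [intro]: "pint_poly f \<Longrightarrow> pint_poly (- f)"
  by (auto simp: pint_poly_def)

lemma pint_poly_mult [intro]: "pint_poly f \<Longrightarrow> pint_poly g \<Longrightarrow> pint_poly (f * g)"
  by (auto simp: pint_poly_def coeff_mult)

lemma pint_poly_smult [intro]: "pint a \<Longrightarrow> pint_poly f \<Longrightarrow> pint_poly (Polynomial.smult a f)"
  by (auto simp: pint_poly_def)

lemma pint_poly_power [intro]: "pint_poly f \<Longrightarrow> pint_poly (f ^ n)"
  by (induction n) auto

lemma pint_poly_sum [intro]: "(\<And>i. i \<in> A \<Longrightarrow> pint_poly (f i)) \<Longrightarrow> pint_poly (sum f A)"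
  by (induction A rule: infinite_finite_induct) auto

lemma pint_poly_prod [intro]: "(\<And>i. i \<in> A \<Longrightarrow> pint_poly (f i)) \<Longrightarrow> pint_poly (prod f A)"
  by (induction A rule: infinite_finite_induct) auto

lemma pint_poly_pderiv [intro]: "pint_poly f \<Longrightarrow> pint_poly (pderiv f)"
  unfolding pint_poly_def coeff_pderiv using pint_mult[OF pint_of_nat] by blast

lemma pint_poly_eval [intro]: "pint_poly f \<Longrightarrow> pint x \<Longrightarrow> pint (poly f x)"
  by (auto simp: pint_poly_def poly_altdef)

lemma pint_inverse_fact: "k < p \<Longrightarrow> pint (1 / fact k)"
  using pint_divide[OF pint_numeral(3) punit_fact] .

lemma pint_poly_dixon: "pint_poly (dixon_poly p)"
  unfolding dixon_poly_def pochhammer_prod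
  by (intro pint_poly_sum pint_poly_power pint_poly_smult pint_poly_prod pint_poly_add pint_inverse_fact) auto

definition pochhammer_cofactor :: "nat \<Rightarrow> nat \<Rightarrow> rat poly" where
  "pochhammer_cofactor i k = (\<Prod>j\<in>{..<k} - {i}. [:0, 1:] + of_nat j)"

lemma pochhammer_X_factor:
  assumes "i < k"
  shows "pochhammer [:0, 1:] k = [:of_nat i, 1:] * pochhammer_cofactor i k"
proof -
  have "pochhammer [:0, 1:] k = (\<Prod>j<k. [:0, 1:] + of_nat j :: rat poly)"
    by (simp add: pochhammer_prod atLeast0LessThan)
  also have "\<dots> = ([:0, 1:] + of_nat i) * pochhammer_cofactor i k"
    unfolding pochhammer_cofactor_def using assms by (intro prod.remove) auto
  also have "[:0, 1:] + of_nat i = [:of_nat i :: rat, 1:]" by (simp add: of_nat_poly)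
  finally show ?thesis .
qed

lemma pint_poly_cofactor: "pint_poly (pochhammer_cofactor i k)"
  unfolding pochhammer_cofactor_def by (intro pint_poly_prod pint_poly_add pint_poly_X pint_poly_numeral)

lemma smult_cube_mult: "(Polynomial.smult c (f * g)) ^ 3 = f ^ 3 * (Polynomial.smult c g) ^ 3"
  unfolding mult_smult_right[symmetric] by (rule power_mult_distrib)

text \<open>Each summand with k > i contains (x + i)^3, and k < p keeps the factorials in the
  denominators invertible.\<close>

lemma dixon_poly_split:
  assumes "i < p"
  shows "\<exists>V. pint_poly V \<and> dixon_poly p = dixon_poly (Suc i) + [:of_nat i, 1:] ^ 3 * V"
proof -
  define V where "V = (\<lambda>k. (Polynomial.smult (1 / fact k) (pochhammer_cofactor i k)) ^ 3)"
  have V: "pint_poly (V k)" if "k \<in> {i<..<p}" for k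
    unfolding V_def using that
    by (intro pint_poly_power pint_poly_smult pint_inverse_fact pint_poly_cofactor) auto
  have "dixon_poly p = (\<Sum>k\<in>{..<Suc i} \<union> {i<..<p}. (Polynomial.smult (1 / fact k) (pochhammer [:0, 1:] k)) ^ 3)"
    unfolding dixon_poly_def using assms by (intro sum.cong) auto
  also have "\<dots> = dixon_poly (Suc i) + (\<Sum>k\<in>{i<..<p}. (Polynomial.smult (1 / fact k) (pochhammer [:0, 1:] k)) ^ 3)"
    unfolding dixon_poly_def by (rule sum.union_disjoint) auto
  also have "(\<Sum>k\<in>{i<..<p}. (Polynomial.smult (1 / fact k) (pochhammer [:0, 1:] k)) ^ 3) = [:of_nat i, 1:] ^ 3 * sum V {i<..<p}"
    unfolding sum_distrib_left V_def
  proof (intro sum.cong refl)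
    fix k assume "k \<in> {i<..<p}"
    then have "i < k" by simp
    show "(Polynomial.smult (1 / fact k) (pochhammer [:0, 1:] k)) ^ 3 =
      [:of_nat i, 1:] ^ 3 * (Polynomial.smult (1 / fact k) (pochhammer_cofactor i k)) ^ 3"
      unfolding pochhammer_X_factor[OF \<open>i < k\<close>] by (rule smult_cube_mult)
  qed
  finally show ?thesis using V by (intro exI[of _ "sum V {i<..<p}"] conjI pint_poly_sum)
qed

text \<open>Where x + i = p z, the cube contributes p^3, and its derivative still contains (x + i)^2
  and so p^2.\<close>

lemma pcong_cube_multiple:
  assumes V: "pint_poly V" and x: "pcong 1 (x + of_nat i) 0" "pint x"
  shows "pcong 3 (poly ([:of_nat i, 1:] ^ 3 * V) x) 0"
    and "pcong 2 (poly (pderiv ([:of_nat i, 1:] ^ 3 * V)) x) 0"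
proof -
  obtain z where z: "pint z" "x + of_nat i = of_nat p * z" using x(1) pcong_0_iff by auto
  have e: "poly [:of_nat i, 1:] x = of_nat p * z" using z by (simp add: add.commute)
  have "poly ([:of_nat i, 1:] ^ 3 * V) x = of_nat p ^ 3 * (z ^ 3 * poly V x)"
    unfolding poly_mult poly_power e by (simp add: power_mult_distrib)
  then show "pcong 3 (poly ([:of_nat i, 1:] ^ 3 * V) x) 0"
    unfolding pcong_0_iff using z V x(2)
    by (intro exI[of _ "z ^ 3 * poly V x"] conjI pint_mult pint_power pint_poly_eval)
  have "pderiv [:of_nat i :: rat, 1:] = 1" by (simp add: pderiv_pCons)
  then have "poly (pderiv ([:of_nat i, 1:] ^ 3 * V)) x
     = of_nat p ^ 2 * (z ^ 2 * (of_nat p * z * poly (pderiv V) x + 3 * poly V x))"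
    unfolding pderiv_mult poly_add poly_mult poly_pderiv_cube poly_power e
    by (simp add: power_mult_distrib power2_eq_square power3_eq_cube algebra_simps)
  moreover have "pint (z ^ 2 * (of_nat p * z * poly (pderiv V) x + 3 * poly V x))"
    using z V x(2) by (intro pint_mult pint_power pint_add pint_poly_eval pint_poly_pderiv) auto
  ultimately show "pcong 2 (poly (pderiv ([:of_nat i, 1:] ^ 3 * V)) x) 0"
    unfolding pcong_0_iff by (intro exI conjI)
qed

text \<open>The factor x + i occurs in (x)_(p-2) because i < p - 2, and the denominator (p - 1)! is
  a unit.\<close>

lemma dixon_bdry_small:
  assumes "i < p - 2" and x: "pcong 1 (x + of_nat i) 0" "pint x"
  shows "pcong 3 (poly (dixon_bdry (p - 2)) x) 0" "pcong 2 (poly (pderiv (dixon_bdry (p - 2))) x) 0"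
proof -
  let ?U = "(Polynomial.smult (1 / fact (p - 2 + 1)) (pochhammer_cofactor i (p - 2))) ^ 3 *
    dixon_cert [:0, 1:] (of_nat (p - 2 + 2))"
  have e: "dixon_bdry (p - 2) = [:of_nat i, 1:] ^ 3 * ?U"
    unfolding dixon_bdry_def pochhammer_X_factor[OF assms(1)] smult_cube_mult mult.assoc ..
  have "pint_poly (dixon_cert [:0, 1:] (of_nat (p - 2 + 2)))"
    unfolding dixon_cert_def
    by (intro pint_poly_mult pint_poly_add pint_poly_diff pint_poly_power pint_poly_uminus
      pint_poly_X pint_poly_numeral)
  moreover have "p - 2 + 1 < p" using p_gt_3 by simp
  ultimately have "pint_poly ?U"
    by (intro pint_poly_mult pint_poly_power pint_poly_smult pint_inverse_fact pint_poly_cofactor)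
  from pcong_cube_multiple[OF this x]
  show "pcong 3 (poly (dixon_bdry (p - 2)) x) 0" "pcong 2 (poly (pderiv (dixon_bdry (p - 2))) x) 0"
    unfolding e .
qed

abbreviation dixon_val :: "rat \<Rightarrow> rat" where "dixon_val \<equiv> poly (dixon_poly p)"
abbreviation dixon_der :: "rat \<Rightarrow> rat" where "dixon_der \<equiv> poly (pderiv (dixon_poly p))"

text \<open>Near -i the boundary term can be ignored, which leaves homogeneous recurrences carrying
  the value and the derivative from x to x - 2.\<close>

lemma dixon_step:
  assumes "i < p - 2" "pcong 1 (x + of_nat i) 0" "pint x"
  shows "pcong 3 ((x - 2)\<^sup>2 * dixon_val (x - 2) + 3 * (3 * x - 2) * (3 * x - 4) * dixon_val x) 0"
    and "pcong 2 (2 * (x - 2) * dixon_val (x - 2) + (x - 2)\<^sup>2 * dixon_der (x - 2)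
      + 54 * (x - 1) * dixon_val x + 3 * (3 * x - 2) * (3 * x - 4) * dixon_der x) 0"
proof -
  have "p - 2 + 2 = p" using p_gt_3 by simp
  note rec = dixon_value_rec[of x "p - 2", unfolded this] dixon_deriv_rec[of x "p - 2", unfolded this]
  show "pcong 3 ((x - 2)\<^sup>2 * dixon_val (x - 2) + 3 * (3 * x - 2) * (3 * x - 4) * dixon_val x) 0"
    unfolding rec(1) by (rule dixon_bdry_small[OF assms])
  show "pcong 2 (2 * (x - 2) * dixon_val (x - 2) + (x - 2)\<^sup>2 * dixon_der (x - 2)
      + 54 * (x - 1) * dixon_val x + 3 * (3 * x - 2) * (3 * x - 4) * dixon_der x) 0"
    unfolding rec(2) by (rule dixon_bdry_small[OF assms])
qed

lemma pint_dixon_val [intro]: "pint x \<Longrightarrow> pint (dixon_val x)"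
  and pint_dixon_der [intro]: "pint x \<Longrightarrow> pint (dixon_der x)"
  using pint_poly_dixon by blast+

text \<open>Supplies the initial values: near -i only the summands up to k = i count.\<close>

lemma dixon_start:
  assumes "i < p" "pcong 1 (x + of_nat i) 0" "pint x"
  shows "pcong 3 (dixon_val x) (poly (dixon_poly (Suc i)) x)"
    and "pcong 2 (dixon_der x) (poly (pderiv (dixon_poly (Suc i))) x)"
proof -
  obtain V where V: "pint_poly V" "dixon_poly p = dixon_poly (Suc i) + [:of_nat i, 1:] ^ 3 * V"
    using dixon_poly_split[OF assms(1)] by blast
  have "pcong 3 (dixon_val x) (poly (dixon_poly (Suc i)) x + 0)"
    unfolding V(2) poly_add by (intro pcong_add pcong_refl pcong_cube_multiple[OF V(1) assms(2,3)])
  then show "pcong 3 (dixon_val x) (poly (dixon_poly (Suc i)) x)" by simp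
  have "pcong 2 (dixon_der x) (poly (pderiv (dixon_poly (Suc i))) x + 0)"
    unfolding V(2) poly_add pderiv_add by (intro pcong_add pcong_refl pcong_cube_multiple[OF V(1) assms(2,3)])
  then show "pcong 2 (dixon_der x) (poly (pderiv (dixon_poly (Suc i))) x)" by simp
qed

end

section \<open>The sum with odd harmonic numbers\<close>

context prime_localization begin

lemma pint_half_p: "pint (of_nat p / 2)" by (intro pint_divide) auto

lemma punit_neg_shift: "punit x \<Longrightarrow> punit (of_nat p * y - x)" if "pint y"
  using punit_shift_p[of "- x" y] that by simp

lemma pcong_neg_shift: "pint y \<Longrightarrow> pcong 1 (of_nat p * y - x) (- x)"
  using pcong_add_p[of y "- x"] by simp

lemma pcong_p_half_0: "pint y \<Longrightarrow> pcong 1 (of_nat p / 2 * y) 0"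
  using pcong_p_0[OF pint_divide[of y 2]] by simp

text \<open>Up to the boundary term, one step multiplies F by -3(3x - 2)(3x - 4) / (x - 2)^2. This
  is the sum of the logarithmic derivatives of these multipliers at x = p/2 - 2i for i < j.\<close>

definition dixon_log :: "nat \<Rightarrow> rat" where
  "dixon_log j = (\<Sum>i<j. 3 / (3 * (of_nat p / 2 - 2 * of_nat i) - 2) + 3 / (3 * (of_nat p / 2 - 2 * of_nat i) - 4)
     - 2 / ((of_nat p / 2 - 2 * of_nat i) - 2))"

text \<open>Doubling numerators and denominators gives 6/(3p - 4i) for i = 3m + 1 and 3m + 2. The
  missing i = 3m + 3 is a third of 6/(p - 4(m + 1)); adding and subtracting it completes the first
  sum.\<close>

lemma dixon_log_eq:
  "dixon_log m = 6 * ((\<Sum>i=1..3*m. 1 / (3 * of_nat p - 4 * of_nat i)) - (\<Sum>i=1..m. 1 / (of_nat p - 4 * of_nat i)))"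
proof (induction m)
  case (Suc m)
  define P where "P = (of_nat p :: rat)"
  have e: "{1..3 * Suc m} = insert (3*m+3) (insert (3*m+2) (insert (3*m+1) {1..3*m}))" by auto
  have 1: "3 / (3 * (P / 2 - 2 * of_nat m) - 2) = 6 / (3 * P - 4 * of_nat (3*m+1))"
    using mult_divide_mult_cancel_left[of 2 3 "3 * (P / 2 - 2 * of_nat m) - 2"] by (simp add: algebra_simps)
  have 2: "3 / (3 * (P / 2 - 2 * of_nat m) - 4) = 6 / (3 * P - 4 * of_nat (3*m+2))"
    using mult_divide_mult_cancel_left[of 2 3 "3 * (P / 2 - 2 * of_nat m) - 4"] by (simp add: algebra_simps)
  have 3: "2 / ((P / 2 - 2 * of_nat m) - 2) = 4 / (P - 4 * of_nat (Suc m))"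
    using mult_divide_mult_cancel_left[of 2 2 "(P / 2 - 2 * of_nat m) - 2"] by (simp add: algebra_simps)
  have 4: "6 / (3 * P - 4 * of_nat (3*m+3)) = 2 / (P - 4 * of_nat (Suc m))"
    using mult_divide_mult_cancel_left[of 3 2 "P - 4 * of_nat (Suc m)"] by (simp add: algebra_simps)
  have "dixon_log (Suc m) = dixon_log m + (6 / (3 * P - 4 * of_nat (3*m+1)) + 6 / (3 * P - 4 * of_nat (3*m+2)) - 4 / (P - 4 * of_nat (Suc m)))"
    unfolding dixon_log_def P_def[symmetric] 1[symmetric] 2[symmetric] 3[symmetric] by simp
  also have "\<dots> = dixon_log m + (6 / (3 * P - 4 * of_nat (3*m+1)) + 6 / (3 * P - 4 * of_nat (3*m+2)) + 6 / (3 * P - 4 * of_nat (3*m+3)) - 6 / (P - 4 * of_nat (Suc m)))"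
    unfolding 4 by (simp add: diff_divide_distrib[symmetric])
  finally show ?case unfolding Suc.IH P_def[symmetric] e
    by (simp add: algebra_simps)
qed (simp add: dixon_log_def)

text \<open>Since 3p - 4i = 4(p - i) - p, the first sum of \<open>dixon_log_eq\<close> covers the
  indices m < i < p of 1/(4i - p), and the second, with its sign, covers i up to m.\<close>

lemma dixon_log_zero:
  assumes m: "p = 4 * m + 1" shows "pcong 2 (dixon_log m) 0"
proof -
  have "(\<Sum>i=1..p-1. 1 / (4 * of_nat i - of_nat p)) = (\<Sum>i=1..m+3*m. 1 / (4 * of_nat i - of_nat p) :: rat)"
    using m by (intro sum.cong) auto
  also have "\<dots> = (\<Sum>i=1..m. 1 / (4 * of_nat i - of_nat p)) + (\<Sum>i=m+1..m+3*m. 1 / (4 * of_nat i - of_nat p))"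
    by (rule sum.ub_add_nat) simp
  also have "(\<Sum>i=1..m. 1 / (4 * of_nat i - of_nat p) :: rat) = - (\<Sum>i=1..m. 1 / (of_nat p - 4 * of_nat i))"
    unfolding sum_negf[symmetric] by (intro sum.cong refl) (simp add: minus_divide_right)
  also have "(\<Sum>i=m+1..m+3*m. 1 / (4 * of_nat i - of_nat p) :: rat) = (\<Sum>i=1..3*m. 1 / (3 * of_nat p - 4 * of_nat i))"
  proof (rule sum.reindex_bij_witness[of _ "\<lambda>i. p - i" "\<lambda>i. p - i"])
    fix i assume "i \<in> {m+1..m+3*m}"
    then have "i \<le> p" using m by simp
    then show "1 / (3 * of_nat p - 4 * of_nat (p - i)) = 1 / (4 * of_nat i - of_nat p :: rat)"
      by (simp add: of_nat_diff)
  qed (use m in auto)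
  finally have "dixon_log m = 6 * (\<Sum>i=1..p-1. 1 / (4 * of_nat i - of_nat p))"
    unfolding dixon_log_eq by simp
  moreover have "pcong 2 \<dots> (6 * 0)" by (intro pcong_mult_left sum_inverse_four_i_minus_p) auto
  ultimately show ?thesis by simp
qed

text \<open>The relation F' = L F modulo p^2 is propagated, L growing by the logarithmic derivative
  of the multiplier. All multipliers met are units.\<close>

lemma dixon_der_1_mod_4:
  assumes m: "p = 4 * m + 1" and j: "j \<le> m"
  shows "pcong 2 (dixon_der (of_nat p / 2 - 2 * of_nat j)) (dixon_log j * dixon_val (of_nat p / 2 - 2 * of_nat j)) \<and> pint (dixon_log j)"
  using j
proof (induction j)
  case 0
  \<comment> \<open>Near 0 only the constant summand survives, so the derivative vanishes modulo
    p^2, in accordance with the empty sum \<open>dixon_log 0\<close>.\<close>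
  have "pcong 1 (of_nat p / 2 + of_nat 0) 0" using pcong_p_half_0[of 1] by simp
  from dixon_start(2)[OF _ this pint_half_p]
  show ?case by (simp add: dixon_log_def dixon_poly_def pCons_one)
next
  case (Suc j)
  define x where "x = of_nat p / 2 - 2 * (of_nat j :: rat)"
  define A A2 B B2 where "A = dixon_val x" and "A2 = dixon_val (x - 2)" and "B = dixon_der x" and "B2 = dixon_der (x - 2)"
  define u v w where "u = 3 * x - 2" and "v = 3 * x - 4" and "w = x - 2"
  have x: "pint x" unfolding x_def using pint_half_p by (intro pint_diff pint_mult) auto
  have ev: "punit (of_nat (2 * k))" if "0 < k" "k < p" for k
    using punit_mult[OF punit_small(1) punit_of_nat_less[OF that]] by simp
  have h: "pint (3 / 2)" "pint (1 / 2)" by (auto intro!: pint_divide)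
  \<comment> \<open>Modulo p, the numbers u, v, w are -2(3j + 1), -2(3j + 2), -2(j + 1), and all
    three bracketed integers are below p because j < m.\<close>
  have "u = of_nat p * (3 / 2) - of_nat (2 * (3 * j + 1))" by (simp add: u_def x_def algebra_simps)
  then have u: "punit u" using punit_neg_shift[OF h(1) ev[of "3 * j + 1"]] Suc.prems m by simp
  have "v = of_nat p * (3 / 2) - of_nat (2 * (3 * j + 2))" by (simp add: v_def x_def algebra_simps)
  then have v: "punit v" using punit_neg_shift[OF h(1) ev[of "3 * j + 2"]] Suc.prems m by simp
  have "w = of_nat p * (1 / 2) - of_nat (2 * (j + 1))" by (simp add: w_def x_def algebra_simps)
  then have w: "punit w" using punit_neg_shift[OF h(2) ev[of "j + 1"]] Suc.prems m by simp
  have "pcong 1 (x + of_nat (2 * j)) 0" using pcong_p_0[OF h(2)] by (simp add: x_def)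
  moreover have "2 * j < p - 2" using Suc.prems m by simp
  ultimately have E: "pcong 3 (w\<^sup>2 * A2 + 3 * u * v * A) 0"
    "pcong 2 (2 * w * A2 + w\<^sup>2 * B2 + 54 * (x - 1) * A + 3 * u * v * B) 0"
    using dixon_step[of "2 * j" x] x unfolding A_def A2_def B_def B2_def u_def v_def w_def by blast+
  define L where "L = dixon_log j"
  have IH: "pcong 2 B (L * A)" "pint L"
    using Suc unfolding A_def B_def x_def L_def by auto
  define k where "k = L + 3 / u + 3 / v"
  have k: "pint k" unfolding k_def using IH(2) u v by (intro pint_add pint_divide) auto
  have L2: "dixon_log (Suc j) = k - 2 / w"
    unfolding dixon_log_def by (simp add: k_def L_def dixon_log_def u_def v_def w_def x_def)
  \<comment> \<open>Derivative recurrence minus k times the value recurrence: 54(x - 1) is the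
    derivative of 3uv, so k = L + 3/u + 3/v cancels every term in A apart from the multiple of B - L
    A.\<close>
  have "w\<^sup>2 * B2 - w\<^sup>2 * ((k - 2 / w) * A2) =
    (2 * w * A2 + w\<^sup>2 * B2 + 54 * (x - 1) * A + 3 * u * v * B) - k * (w\<^sup>2 * A2 + 3 * u * v * A) - 3 * u * v * (B - L * A)"
  proof -
    have 1: "w\<^sup>2 * (2 / w) = 2 * w" using punit_nz[OF w] by (simp add: power2_eq_square)
    have "k * (u * v) = L * u * v + 3 * v + 3 * u"
      using punit_nz[OF u] punit_nz[OF v] unfolding k_def by (simp add: field_simps)
    moreover have "k * (3 * u * v * A) = 3 * A * (k * (u * v))" by simp
    ultimately have "k * (3 * u * v * A) = 3 * A * (L * u * v + 3 * v + 3 * u)" by simp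
    also have "\<dots> = 3 * u * v * (L * A) + 9 * (v + u) * A" by (simp add: algebra_simps)
    also have "9 * (v + u) = 54 * (x - 1)" by (simp add: u_def v_def)
    finally have 2: "k * (3 * u * v * A) = 3 * u * v * (L * A) + 54 * (x - 1) * A" .
    have "w\<^sup>2 * ((k - 2 / w) * A2) = k * (w\<^sup>2 * A2) - (w\<^sup>2 * (2 / w)) * A2"
      by (simp add: left_diff_distrib right_diff_distrib mult_ac)
    then show ?thesis unfolding 1 using 2 by (simp add: algebra_simps)
  qed
  also have "pcong 2 \<dots> (0 - k * 0 - 3 * u * v * 0)"
  proof (intro pcong_diff pcong_mult_left E(2) pcong_le[OF E(1)] k)
    show "pint (3 * u * v)" using u v by (intro pint_mult punit_pint) simp_all
    show "pcong 2 (B - L * A) 0" using IH(1) by (simp only: pcong_diff_0_iff)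
  qed simp
  finally have "pcong 2 (w\<^sup>2 * B2 - w\<^sup>2 * ((k - 2 / w) * A2)) 0" by (simp only: mult_zero_right diff_0_right)
  then have "pcong 2 (w\<^sup>2 * B2) (w\<^sup>2 * ((k - 2 / w) * A2))" by (simp only: pcong_diff_0_iff)
  then have "pcong 2 B2 (dixon_log (Suc j) * A2)"
    unfolding L2 by (rule pcong_unit_cancel[OF punit_power[OF w]])
  moreover have "of_nat p / 2 - 2 * of_nat (Suc j) = x - 2" by (simp add: x_def)
  moreover have "pint (k - 2 / w)" using k w by (intro pint_diff pint_divide) simp_all
  ultimately show ?case unfolding A2_def B2_def L2 by (simp only: simp_thms)
qed

abbreviation S_sum :: rat where
  "S_sum \<equiv> (\<Sum>k=1..p-1. of_nat ((2 * k) choose k) ^ 3 * odd_harmonic 1 k / 64 ^ k)"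

lemma dixon_der_half: "dixon_der (1 / 2) = 6 * S_sum"
  by (rule poly_pderiv_dixon_half) simp

lemma pint_S_sum: "pint S_sum"
proof -
  have "pint (dixon_der (1 / 2) / 6)" by (intro pint_divide pint_dixon_der) auto
  then show ?thesis unfolding dixon_der_half by simp
qed

lemma S_sum_1_mod_4:
  assumes m: "p = 4 * m + 1" shows "pcong 2 S_sum 0"
proof -
  have y: "of_nat p / 2 - 2 * of_nat m = (1 / 2 :: rat)" by (subst m) (simp add: add_divide_distrib)
  have "pcong 2 (6 * S_sum) (dixon_log m * dixon_val (1 / 2))"
    using dixon_der_1_mod_4[OF m order_refl] unfolding dixon_der_half[symmetric] y by blast
  also have "pcong 2 \<dots> (0 * dixon_val (1 / 2))"
    by (intro pcong_mult_right dixon_log_zero[OF m] pint_dixon_val pint_divide) auto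
  finally have "pcong 2 (6 * S_sum) (6 * 0)" by simp
  then show ?thesis by (rule pcong_unit_cancel[rotated]) simp
qed

section \<open>Propagation for p congruent to 3 modulo 4\<close>

lemma pcong_p_half_mult:
  assumes "pcong 1 x y" shows "pcong 2 (of_nat p / 2 * x) (of_nat p / 2 * y)"
proof -
  have "pcong 1 (x / 2) (y / 2)" using assms by (intro pcong_divide_unit) auto
  from pcong_p_mult[OF this] show ?thesis by (simp add: numeral_2_eq_2)
qed

text \<open>Two regimes, before and after the step at which a factor is divisible by p. In the first
  the value is p c / 2 modulo p^2 and the derivative is c modulo p; in the second they are 0 and -2
  p c modulo p^2. The explicit factors p, and the vanishing of the values, reduce each step to the
  residues u0, v0, w0 modulo p.\<close>

lemma dixon_step_regular:
  assumes w: "punit w" "pcong 1 w w0" "punit w0" and u: "pcong 1 u u0" "pint u0" and v: "pcong 1 v v0" "pint v0"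
    and x: "pint x" and c: "pint c"
    and E: "pcong 3 (w\<^sup>2 * A2 + 3 * u * v * A) 0"
      "pcong 2 (2 * w * A2 + w\<^sup>2 * B2 + 54 * (x - 1) * A + 3 * u * v * B) 0"
    and c2: "c2 = - 3 * u0 * v0 * c / w0\<^sup>2"
  shows "pcong 2 A (of_nat p / 2 * c) \<Longrightarrow> pcong 1 B c \<Longrightarrow> pcong 2 A2 (of_nat p / 2 * c2) \<and> pcong 1 B2 c2"
    and "pcong 2 A 0 \<Longrightarrow> pcong 2 B (- 2 * of_nat p * c) \<Longrightarrow> pcong 2 A2 0 \<and> pcong 2 B2 (- 2 * of_nat p * c2)"
proof -
  have ui: "pint u" and vi: "pint v" using u v pcong_pint by blast+
  have w0i: "pint w0" using w(3) by auto
  have w2: "punit (w\<^sup>2)" using w by auto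
  have w0c2: "w0\<^sup>2 * c2 = - (3 * u0 * v0 * c)" using punit_nz[OF w(3)] by (simp add: c2)
  have c2i: "pint c2" unfolding c2 using u(2) v(2) c w(3) by (intro pint_divide pint_mult) auto
  have Cc: "pcong 1 (3 * u * v) (3 * u0 * v0)"
    using u v ui vi by (intro pcong_mult) auto
  have "pcong 1 (w\<^sup>2 * c2) (w0\<^sup>2 * c2)" using w(2) w0i c2i by (intro pcong_mult_right pcong_power)
  also have "w0\<^sup>2 * c2 = - (3 * u0 * v0 * c)" by (fact w0c2)
  also have "pcong 1 \<dots> (- (3 * u * v * c))"
    using c by (intro pcong_minus pcong_mult_right pcong_sym[OF Cc])
  finally have key: "pcong 1 (w\<^sup>2 * c2) (- (3 * u * v * c))" .
  have E1: "w\<^sup>2 * A2 = (w\<^sup>2 * A2 + 3 * u * v * A) - 3 * u * v * A" by simp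
  have E2: "w\<^sup>2 * B2 = (2 * w * A2 + w\<^sup>2 * B2 + 54 * (x - 1) * A + 3 * u * v * B) - 2 * w * A2 - 54 * (x - 1) * A - 3 * u * v * B"
    by simp
  have "pint w" using w(1) by (rule punit_pint)
  then have wi: "pint (2 * w)" "pint (54 * (x - 1))" "pint (3 * u * v)"
    using x ui vi by (intro pint_mult pint_diff; simp)+
  {
    assume A: "pcong 2 A (of_nat p / 2 * c)" and B: "pcong 1 B c"
    have "pcong 2 (w\<^sup>2 * A2) (0 - 3 * u * v * (of_nat p / 2 * c))"
      by (subst E1, intro pcong_diff pcong_le[OF E(1)] pcong_mult_left A wi) simp
    also have "0 - 3 * u * v * (of_nat p / 2 * c) = of_nat p / 2 * (- (3 * u * v * c))" by simp
    also have "pcong 2 \<dots> (of_nat p / 2 * (w\<^sup>2 * c2))" by (rule pcong_p_half_mult[OF pcong_sym[OF key]])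
    also have "\<dots> = w\<^sup>2 * (of_nat p / 2 * c2)" by simp
    finally have A2: "pcong 2 A2 (of_nat p / 2 * c2)" by (rule pcong_unit_cancel[OF w2])
    note z = pcong_p_half_0
    have A0: "pcong 1 A 0" "pcong 1 A2 0"
      using pcong_trans[OF pcong_le[OF A] z[OF c]] pcong_trans[OF pcong_le[OF A2] z[OF c2i]] by simp_all
    have "pcong 1 (w\<^sup>2 * B2) (0 - 2 * w * 0 - 54 * (x - 1) * 0 - 3 * u * v * c)"
      by (subst E2, intro pcong_diff pcong_le[OF E(2)] pcong_mult_left A0 B wi) simp
    also have "0 - 2 * w * 0 - 54 * (x - 1) * 0 - 3 * u * v * c = - (3 * u * v * c)" by simp
    also have "pcong 1 \<dots> (w\<^sup>2 * c2)" by (rule pcong_sym[OF key])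
    finally have "pcong 1 B2 c2" by (rule pcong_unit_cancel[OF w2])
    with A2 show "pcong 2 A2 (of_nat p / 2 * c2) \<and> pcong 1 B2 c2" by blast
  }
  {
    assume A: "pcong 2 A 0" and B: "pcong 2 B (- 2 * of_nat p * c)"
    have "pcong 2 (w\<^sup>2 * A2) (0 - 3 * u * v * 0)"
      by (subst E1, intro pcong_diff pcong_le[OF E(1)] pcong_mult_left A wi) simp
    then have "pcong 2 (w\<^sup>2 * A2) (w\<^sup>2 * 0)" by simp
    then have A2: "pcong 2 A2 0" by (rule pcong_unit_cancel[OF w2])
    have "pcong 2 (w\<^sup>2 * B2) (0 - 2 * w * 0 - 54 * (x - 1) * 0 - 3 * u * v * (- 2 * of_nat p * c))"
      by (subst E2, intro pcong_diff pcong_le[OF E(2)] pcong_mult_left A A2 B wi) simp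
    also have "0 - 2 * w * 0 - 54 * (x - 1) * 0 - 3 * u * v * (- 2 * of_nat p * c) = of_nat p / 2 * (- 4 * (- (3 * u * v * c)))"
      by simp
    also have "pcong 2 \<dots> (of_nat p / 2 * (- 4 * (w\<^sup>2 * c2)))"
      by (intro pcong_p_half_mult pcong_mult_left pcong_sym[OF key]) auto
    also have "\<dots> = w\<^sup>2 * (- 2 * of_nat p * c2)" by simp
    finally have "pcong 2 B2 (- 2 * of_nat p * c2)" by (rule pcong_unit_cancel[OF w2])
    with A2 show "pcong 2 A2 0 \<and> pcong 2 B2 (- 2 * of_nat p * c2)" by blast
  }
qed

text \<open>The step at which the factor \<open>u\<close> of the recurrence equals \<open>p/2\<close>: the value drops to \<open>0\<close> modulo \<open>p\<^sup>2\<close>, while the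
  derivative picks up \<open>p\<close> from differentiating \<open>u\<close>.\<close>

lemma dixon_step_critical:
  assumes w: "punit w" "pcong 1 w w0" "punit w0" and u: "u = of_nat p / 2" and v: "pcong 1 v v0" "pint v0"
    and x: "54 * (x - 1) = 9 * (u + v)" and c: "pint c"
    and E: "pcong 3 (w\<^sup>2 * A2 + 3 * u * v * A) 0"
      "pcong 2 (2 * w * A2 + w\<^sup>2 * B2 + 54 * (x - 1) * A + 3 * u * v * B) 0"
    and c2: "c2 = 3 * v0 * c / w0\<^sup>2"
    and A: "pcong 2 A (of_nat p / 2 * c)" and B: "pcong 1 B c"
  shows "pcong 2 A2 0 \<and> pcong 2 B2 (- 2 * of_nat p * c2)"
proof -
  have vi: "pint v" using v pcong_pint by blast
  have w0i: "pint w0" using w(3) by auto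
  have w2: "punit (w\<^sup>2)" using w by auto
  have w0c2: "w0\<^sup>2 * c2 = 3 * v0 * c" using punit_nz[OF w(3)] by (simp add: c2)
  have c2i: "pint c2" unfolding c2 using v(2) c w(3) by (intro pint_divide pint_mult) auto
  have "pcong 1 (w\<^sup>2 * c2) (w0\<^sup>2 * c2)" using w(2) w0i c2i by (intro pcong_mult_right pcong_power)
  also have "w0\<^sup>2 * c2 = 3 * v0 * c" by (fact w0c2)
  also have "pcong 1 \<dots> (3 * v * c)"
    using c by (intro pcong_mult_right pcong_mult_left pcong_sym[OF v(1)]) auto
  finally have key: "pcong 1 (w\<^sup>2 * c2) (3 * v * c)" .
  note z = pcong_p_half_0
  have A0: "pcong 1 A 0" using pcong_trans[OF pcong_le[OF A] z[OF c]] by simp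
  have E1: "w\<^sup>2 * A2 = (w\<^sup>2 * A2 + 3 * u * v * A) - of_nat p / 2 * (3 * v * A)" by (simp add: u)
  have "pcong 2 (w\<^sup>2 * A2) (0 - of_nat p / 2 * (3 * v * 0))"
    using vi by (subst E1, intro pcong_diff pcong_le[OF E(1)] pcong_p_half_mult pcong_mult_left A0) auto
  then have "pcong 2 (w\<^sup>2 * A2) (w\<^sup>2 * 0)" by simp
  then have A2: "pcong 2 A2 0" by (rule pcong_unit_cancel[OF w2])
  have E2: "w\<^sup>2 * B2 = (2 * w * A2 + w\<^sup>2 * B2 + 54 * (x - 1) * A + 3 * u * v * B) - 2 * w * A2
      - 9 * (u + v) * A - of_nat p / 2 * (3 * v * B)"
    unfolding x by (simp add: u)
  have "pint (9 * (u + v))" unfolding u using vi pint_half_p by (intro pint_mult pint_add) auto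
  then have "pcong 2 (w\<^sup>2 * B2) (0 - 2 * w * 0 - 9 * (u + v) * (of_nat p / 2 * c) - of_nat p / 2 * (3 * v * c))"
    using w vi by (subst E2, intro pcong_diff E(2) pcong_p_half_mult pcong_mult_left A A2 B) auto
  \<comment> \<open>The term 9 v A contributes three times as much as 3 u v B, namely 9 and 3 times
    p v c / 2. Together they give -4 times p/2, the origin of -2 p; the contribution of 9 u A is
    divisible by p^2.\<close>
  also have "0 - 2 * w * 0 - 9 * (u + v) * (of_nat p / 2 * c) - of_nat p / 2 * (3 * v * c)
    = of_nat p / 2 * (- (4 * (3 * v * c) + of_nat p / 2 * (9 * c)))"
    by (simp add: u algebra_simps)
  also have "pcong 2 \<dots> (of_nat p / 2 * (- (4 * (w\<^sup>2 * c2) + 0)))"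
    using c by (intro pcong_p_half_mult pcong_minus pcong_add pcong_mult_left pcong_sym[OF key] z) auto
  also have "\<dots> = w\<^sup>2 * (- 2 * of_nat p * c2)" by simp
  finally have "pcong 2 B2 (- 2 * of_nat p * c2)" by (rule pcong_unit_cancel[OF w2])
  with A2 show ?thesis by blast
qed

text \<open>Only the number p itself is replaced by 1. In the applications with j up to m the
  arguments stay below 2p, so this strips every factor p from the products.\<close>

definition remove_p :: "nat \<Rightarrow> rat" where
  "remove_p k = (if k = p then 1 else of_nat k)"

text \<open>The product of the residues -3 u0 v0 / w0^2 of the first j multipliers, with the factor
  p removed.\<close>

definition dixon_prod :: "nat \<Rightarrow> rat" where
  "dixon_prod j = (\<Prod>i=1..j. - 3 * remove_p (6 * i - 1) * remove_p (6 * i + 1) / (2 * of_nat i + 1)\<^sup>2)"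

text \<open>The case distinction records whether the critical step, at which 3x - 2 or 3x - 4 equals
  p/2, has already been passed.\<close>

lemma dixon_der_3_mod_4:
  assumes m: "p = 4 * m + 3" and j: "j \<le> m"
  defines "y \<equiv> of_nat p / 2 - 1 - 2 * of_nat j"
  shows "pint (dixon_prod j) \<and>
    (if \<exists>i\<in>{1..j}. p = 6 * i - 1 \<or> p = 6 * i + 1
     then pcong 2 (dixon_val y) 0 \<and> pcong 2 (dixon_der y) (- 2 * of_nat p * (3 * dixon_prod j))
     else pcong 2 (dixon_val y) (of_nat p / 2 * (3 * dixon_prod j)) \<and> pcong 1 (dixon_der y) (3 * dixon_prod j))"
  using j unfolding y_def
proof (induction j)
  case 0
  let ?y = "of_nat p / 2 - 1 :: rat"
  have y: "pint ?y" using pint_half_p by blast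
  have h: "pint (1 / 2)" by (auto intro!: pint_divide)
  have "pcong 1 (?y + of_nat 1) 0" using pcong_p_0[OF h] by simp
  moreover have "1 < p" using p_gt_3 by simp
  ultimately have s: "pcong 3 (dixon_val ?y) (poly (dixon_poly (Suc 1)) ?y)"
    "pcong 2 (dixon_der ?y) (poly (pderiv (dixon_poly (Suc 1))) ?y)"
    using dixon_start[of 1 ?y] y by blast+
  \<comment> \<open>Near -1 the sum reduces to 1 + x^3, with value 3p/2 modulo p^2 and derivative 3
    modulo p; this accounts for the factor 3 in front of \<open>dixon_prod\<close>.\<close>
  have d: "dixon_poly (Suc 1) = 1 + [:0, 1:] ^ 3" by (simp add: dixon_poly_def pCons_one)
  have v: "poly (dixon_poly (Suc 1)) ?y = of_nat p / 2 * 3 + of_nat p ^ 2 * (of_nat p / 8 - 3 / 4)"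
    unfolding d by (simp add: power3_eq_cube power2_eq_square field_simps)
  have "pint (of_nat p / 8 - 3 / 4)" by (intro pint_diff pint_divide) auto
  then have "pcong 2 (of_nat p ^ 2 * (of_nat p / 8 - 3 / 4)) 0" unfolding pcong_0_iff by blast
  then have "pcong 2 (poly (dixon_poly (Suc 1)) ?y) (of_nat p / 2 * 3 + 0)"
    unfolding v by (intro pcong_add) auto
  then have 1: "pcong 2 (dixon_val ?y) (of_nat p / 2 * 3)"
    using pcong_trans[OF pcong_le[OF s(1), of 2]] by simp
  have "poly (pderiv (dixon_poly (Suc 1))) ?y = 3 + of_nat p * (3 * of_nat p / 4 - 3)"
    unfolding d by (simp only: pderiv_add poly_add poly_pderiv_cube)
      (simp add: pderiv_pCons power2_eq_square field_simps)
  also have "pcong 1 \<dots> 3" by (intro pcong_add_p pint_diff pint_divide) auto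
  finally have 2: "pcong 1 (dixon_der ?y) 3"
    using pcong_trans[OF pcong_le[OF s(2), of 1]] by simp
  show ?case using 1 2 by (simp add: dixon_prod_def)
next
  case (Suc j)
  define x where "x = of_nat p / 2 - 1 - 2 * (of_nat j :: rat)"
  define A A2 B B2 where "A = dixon_val x" and "A2 = dixon_val (x - 2)" and "B = dixon_der x" and "B2 = dixon_der (x - 2)"
  define u v w where "u = 3 * x - 2" and "v = 3 * x - 4" and "w = x - 2"
  have y2: "of_nat p / 2 - 1 - 2 * of_nat (Suc j) = x - 2" by (simp add: x_def)
  have x: "pint x" unfolding x_def using pint_half_p by (intro pint_diff pint_mult) auto
  have h: "pint (3 / 2)" "pint (1 / 2)" by (auto intro!: pint_divide)
  \<comment> \<open>Hence u = p/2 exactly when p = 6j + 5, and by the next line v = p/2 exactly when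
    p = 6j + 7.\<close>
  have ue: "u = of_nat p * (3 / 2) - of_nat (6 * j + 5)" by (simp add: u_def x_def algebra_simps)
  have ve: "v = of_nat p * (3 / 2) - of_nat (6 * j + 7)" by (simp add: v_def x_def algebra_simps)
  have we: "w = of_nat p * (1 / 2) - of_nat (2 * j + 3)" by (simp add: w_def x_def algebra_simps)
  define u0 v0 w0 where "u0 = - (of_nat (6 * j + 5) :: rat)" and "v0 = - (of_nat (6 * j + 7) :: rat)"
    and "w0 = - (of_nat (2 * j + 3) :: rat)"
  have uc: "pcong 1 u u0" "pint u0" and vc: "pcong 1 v v0" "pint v0"
    unfolding ue ve u0_def v0_def pint_minus_iff
    by (rule pcong_neg_shift[OF h(1)] pint_of_nat)+
  have w0: "punit w0" unfolding w0_def punit_minus_iff using Suc.prems m by (intro punit_of_nat_less) auto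
  have wc: "pcong 1 w w0" unfolding we w0_def by (rule pcong_neg_shift[OF h(2)])
  have w: "punit w" using punit_pcong[OF w0 pcong_sym[OF wc]] by simp
  have "pcong 1 (x + of_nat (2 * j + 1)) 0" using pcong_p_0[OF h(2)] by (simp add: x_def)
  moreover have "2 * j + 1 < p - 2" using Suc.prems m by simp
  ultimately have E: "pcong 3 (w\<^sup>2 * A2 + 3 * u * v * A) 0"
    "pcong 2 (2 * w * A2 + w\<^sup>2 * B2 + 54 * (x - 1) * A + 3 * u * v * B) 0"
    using dixon_step[of "2 * j + 1" x] x unfolding A_def A2_def B_def B2_def u_def v_def w_def by blast+
  define c c2 where "c = 3 * dixon_prod j" and "c2 = 3 * dixon_prod (Suc j)"
  have ps: "dixon_prod (Suc j) = dixon_prod j * (- 3 * remove_p (6 * j + 5) * remove_p (6 * j + 7) / w0\<^sup>2)"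
  proof -
    have "6 * Suc j - 1 = 6 * j + 5" "6 * Suc j + 1 = 6 * j + 7" by auto
    moreover have "(2 * of_nat (Suc j) + 1)\<^sup>2 = w0\<^sup>2" by (simp add: w0_def power2_eq_square algebra_simps)
    moreover have "(\<Prod>i=1..Suc j. f i) = (\<Prod>i=1..j. f i) * f (Suc j)" for f :: "nat \<Rightarrow> rat" by simp
    ultimately show ?thesis unfolding dixon_prod_def by (simp only:)
  qed
  note hyp = Suc.IH[OF Suc_leD[OF Suc.prems]]
  have "pint (remove_p k)" for k by (simp add: remove_p_def)
  then have ip: "pint (dixon_prod (Suc j))"
    unfolding ps by (intro pint_mult pint_divide conjunct1[OF hyp] punit_power w0) simp_all
  have c: "pint c" unfolding c_def by (intro pint_mult conjunct1[OF hyp]) simp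
  have c2: "c2 = - 3 * remove_p (6 * j + 5) * remove_p (6 * j + 7) * c / w0\<^sup>2"
    unfolding c_def c2_def ps by simp
  have IH: "if \<exists>i\<in>{1..j}. p = 6 * i - 1 \<or> p = 6 * i + 1
     then pcong 2 A 0 \<and> pcong 2 B (- 2 * of_nat p * c)
     else pcong 2 A (of_nat p / 2 * c) \<and> pcong 1 B c"
    using conjunct2[OF hyp] unfolding A_def B_def c_def x_def .
  have ex: "(\<exists>i\<in>{1..Suc j}. p = 6 * i - 1 \<or> p = 6 * i + 1) \<longleftrightarrow>
    (\<exists>i\<in>{1..j}. p = 6 * i - 1 \<or> p = 6 * i + 1) \<or> p = 6 * j + 5 \<or> p = 6 * j + 7"
    by (auto simp: atLeastAtMostSuc_conv)
  consider (crit) "p = 6 * j + 5 \<or> p = 6 * j + 7" | (reg) "p \<noteq> 6 * j + 5" "p \<noteq> 6 * j + 7" by blast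
  then have "if \<exists>i\<in>{1..Suc j}. p = 6 * i - 1 \<or> p = 6 * i + 1
     then pcong 2 A2 0 \<and> pcong 2 B2 (- 2 * of_nat p * c2)
     else pcong 2 A2 (of_nat p / 2 * c2) \<and> pcong 1 B2 c2"
  proof cases
    case reg
    then have "remove_p (6 * j + 5) = - u0" "remove_p (6 * j + 7) = - v0"
      unfolding remove_p_def u0_def v0_def by simp_all
    then have "c2 = - 3 * u0 * v0 * c / w0\<^sup>2" by (simp add: c2)
    note st = dixon_step_regular[OF w wc w0 uc vc x c E this]
    have ex': "(\<exists>i\<in>{1..Suc j}. p = 6 * i - 1 \<or> p = 6 * i + 1) \<longleftrightarrow> (\<exists>i\<in>{1..j}. p = 6 * i - 1 \<or> p = 6 * i + 1)"
      using ex reg by blast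
    show ?thesis
      unfolding ex' using st IH by presburger
  next
    case crit
    \<comment> \<open>The critical step occurs only once: for i up to j, the numbers 6i - 1 and 6i +
      1 are below 6j + 5.\<close>
    have no: "\<not> (\<exists>i\<in>{1..j}. p = 6 * i - 1 \<or> p = 6 * i + 1)"
    proof
      assume "\<exists>i\<in>{1..j}. p = 6 * i - 1 \<or> p = 6 * i + 1"
      then obtain i where "1 \<le> i" "i \<le> j" "p = 6 * i - 1 \<or> p = 6 * i + 1" by auto
      then show False using crit by presburger
    qed
    then have AB: "pcong 2 A (of_nat p / 2 * c)" "pcong 1 B c" using IH by simp_all
    have "pcong 2 A2 0 \<and> pcong 2 B2 (- 2 * of_nat p * c2)"
    proof (cases "p = 6 * j + 5")
      case True
      have "u = of_nat p / 2" unfolding ue True[symmetric] by simp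
      moreover have "c2 = 3 * v0 * c / w0\<^sup>2"
      proof -
        have "6 * j + 7 \<noteq> p" "6 * j + 5 = p" using True by simp_all
        then have "remove_p (6 * j + 5) = 1" "remove_p (6 * j + 7) = - v0"
          unfolding remove_p_def v0_def by (simp_all only: if_True if_False minus_minus refl)
        then show ?thesis by (simp add: c2)
      qed
      moreover have "54 * (x - 1) = 9 * (u + v)" by (simp add: u_def v_def)
      ultimately show ?thesis using dixon_step_critical[OF w wc w0 _ vc _ c E _ AB] by blast
    next
      case False
      then have p: "p = 6 * j + 7" using crit by simp
      have "v = of_nat p / 2" unfolding ve p[symmetric] by simp
      moreover have "c2 = 3 * u0 * c / w0\<^sup>2"
      proof -
        have "6 * j + 5 \<noteq> p" "6 * j + 7 = p" using p by simp_all
        then have "remove_p (6 * j + 7) = 1" "remove_p (6 * j + 5) = - u0"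
          unfolding remove_p_def u0_def by (simp_all only: if_True if_False minus_minus refl)
        then show ?thesis by (simp add: c2)
      qed
      \<comment> \<open>The recurrences are symmetric in u and v, so the critical lemma applies with
        the two exchanged.\<close>
      moreover have "54 * (x - 1) = 9 * (v + u)" by (simp add: u_def v_def)
      moreover have E': "pcong 3 (w\<^sup>2 * A2 + 3 * v * u * A) 0"
        "pcong 2 (2 * w * A2 + w\<^sup>2 * B2 + 54 * (x - 1) * A + 3 * v * u * B) 0"
        using E by (simp_all add: mult_ac)
      ultimately show ?thesis using dixon_step_critical[OF w wc w0 _ uc _ c _ _ _ AB] by blast
    qed
    moreover have "\<exists>i\<in>{1..Suc j}. p = 6 * i - 1 \<or> p = 6 * i + 1" using ex crit by blast
    ultimately show ?thesis by (simp only: if_True)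
  qed
  then show ?case unfolding y2 A2_def B2_def c2_def using ip by blast
qed

lemma S_sum_3_mod_4:
  assumes m: "p = 4 * m + 3" shows "pcong 2 S_sum (- of_nat p * dixon_prod m)" "pint (dixon_prod m)"
proof -
  have y: "of_nat p / 2 - 1 - 2 * of_nat m = (1 / 2 :: rat)" by (subst m) (simp add: add_divide_distrib)
  \<comment> \<open>As p is prime to 6, the critical step is passed before x = 1/2 is
    reached.\<close>
  have "\<exists>i\<in>{1..m}. p = 6 * i - 1 \<or> p = 6 * i + 1"
  proof -
    have "prime (3 :: nat)" by simp
    then have "\<not> 3 dvd p" using prime_p p_gt_3 by (metis nat_neq_iff primes_dvd_imp_eq)
    then have "p mod 6 = 1 \<or> p mod 6 = 5" using m by presburger
    moreover define q where "q = p div 6"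
    then have q: "p = 6 * q + p mod 6" by simp
    ultimately consider "p mod 6 = 1" | "p mod 6 = 5" by blast
    then show ?thesis
    proof cases
      case 1
      then have "p = 6 * q + 1" "1 \<le> q" "q \<le> m" using q m p_gt_3 by linarith+
      then show ?thesis by (intro bexI[of _ q] disjI2) simp_all
    next
      case 2
      then have "p = 6 * q + 5" "q + 1 \<le> m" using q m by linarith+
      then show ?thesis by (intro bexI[of _ "q + 1"] disjI1) simp_all
    qed
  qed
  then have d: "pint (dixon_prod m)" "pcong 2 (dixon_der (1 / 2)) (- 2 * of_nat p * (3 * dixon_prod m))"
    using dixon_der_3_mod_4[OF m, of m] unfolding y by auto
  show "pint (dixon_prod m)" by (fact d)
  have "pcong 2 (6 * S_sum) (6 * (- of_nat p * dixon_prod m))"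
    using d(2) unfolding dixon_der_half by (simp add: algebra_simps)
  then show "pcong 2 S_sum (- of_nat p * dixon_prod m)" by (rule pcong_unit_cancel[rotated]) simp
qed

end

section \<open>The sum with odd harmonic numbers of order two\<close>

text \<open>The telescoping step of \<open>whipple_telescope\<close> after its common factor has
  been divided out.\<close>

lemma whipple_cert:
  fixes a c k :: "'a :: field_char_0"
  shows "(6 - 4 * a) * (k * k) * (2 * c + k - 1) + (2 - a) * (a - 1 - 2 * c) * (k + 1 - a) * (k + 2 - a)
    + (1 - a) * (2 - a - 2 * c) * (a + k - 2) * (a + k - 1) = (6 - 4 * a) * (a + k - 2) * (k + 1 - a) * (c + k)" (is "?l = ?r")
proof -
  have "?l - ?r = 0" by (simp add: algebra_simps)
  then show ?thesis by simp
qed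

text \<open>The summand of 3F2(a, 1 - a, c; 1, 2c; 1), a special case of the series in Whipple's
  theorem.\<close>

definition whipple_term :: "'a \<Rightarrow> 'a \<Rightarrow> nat \<Rightarrow> 'a :: field_char_0" where
  "whipple_term c a k = pochhammer a k * pochhammer (1 - a) k * pochhammer c k / ((fact k)\<^sup>2 * pochhammer (2 * c) k)"

text \<open>A contiguity relation between a - 2 and a, obtained by creative telescoping. The
  nonvanishing hypothesis keeps all denominators of the partial sums away from 0.\<close>

lemma whipple_telescope:
  fixes a c :: "'a :: field_char_0"
  assumes "pochhammer (2 * c) (K + 1) \<noteq> 0"
  shows "(2 - a) * (a - 1 - 2 * c) * (\<Sum>k<K+2. whipple_term c (a - 2) k)
    + (1 - a) * (2 - a - 2 * c) * (\<Sum>k<K+2. whipple_term c a k) =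
    (1 - a) * (2 - a) * (6 - 4 * a) * (pochhammer a K * pochhammer (3 - a) K * pochhammer c (K + 2)
      / ((fact (K + 1))\<^sup>2 * pochhammer (2 * c) (K + 1)))"
  using assms
proof (induction K)
  case 0
  then have "c \<noteq> 0" by simp
  have s: "(\<Sum>k<0+2. f k) = f 0 + f 1" for f :: "nat \<Rightarrow> 'a" by (simp add: numeral_2_eq_2)
  have t: "whipple_term c b 0 = 1" "whipple_term c b 1 = b * (1 - b) / 2" for b
    using \<open>c \<noteq> 0\<close> by (simp_all add: whipple_term_def)
  have r: "pochhammer c (0 + 2) / ((fact (0 + 1))\<^sup>2 * pochhammer (2 * c) (0 + 1)) = (c + 1) / 2"
    using \<open>c \<noteq> 0\<close> by (simp add: numeral_2_eq_2 pochhammer_Suc)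
  have "(2 - a) * (a - 1 - 2 * c) * (2 + (a - 2) * (1 - (a - 2))) + (1 - a) * (2 - a - 2 * c) * (2 + a * (1 - a))
    = (1 - a) * (2 - a) * (6 - 4 * a) * (c + 1)" by (simp add: algebra_simps)
  then have "(2 - a) * (a - 1 - 2 * c) * (1 + (a - 2) * (1 - (a - 2)) / 2) + (1 - a) * (2 - a - 2 * c) * (1 + a * (1 - a) / 2)
    = (1 - a) * (2 - a) * (6 - 4 * a) * ((c + 1) / 2)" by (simp add: field_simps)
  then show ?case unfolding s t by (simp only: r[symmetric]) simp
next
  case (Suc K)
  define k where "k = (of_nat (K + 2) :: 'a)"
  have k: "k \<noteq> 0" unfolding k_def of_nat_eq_0_iff by simp
  have q: "pochhammer (2 * c) (K + 2) = pochhammer (2 * c) (K + 1) * (2 * c + k - 1)"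
    by (simp add: pochhammer_Suc k_def)
  then have nz: "pochhammer (2 * c) (K + 1) \<noteq> 0" "2 * c + k - 1 \<noteq> 0"
    using Suc.prems by auto
  have f: "fact (K + 2) = k * fact (K + 1)" by (simp add: k_def)
  \<comment> \<open>Up to explicit linear factors, Z is common to both entering summands and to the
    old and new boundary terms.\<close>
  define Z where "Z = pochhammer a K * pochhammer (3 - a) K * pochhammer c (K + 2) / ((fact (K + 2))\<^sup>2 * pochhammer (2 * c) (K + 2))"
  have old: "pochhammer a K * pochhammer (3 - a) K * pochhammer c (K + 2)
      / ((fact (K + 1))\<^sup>2 * pochhammer (2 * c) (K + 1)) = Z * (k * k) * (2 * c + k - 1)"
    unfolding Z_def q f using nz k by (simp add: power2_eq_square mult_ac)
  have p1: "pochhammer (a - 2) (K + 2) = (1 - a) * (2 - a) * pochhammer a K"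
    by (simp add: pochhammer_rec algebra_simps)
  have p2: "pochhammer (1 - (a - 2)) (K + 2) = pochhammer (3 - a) K * ((k + 1 - a) * (k + 2 - a))"
    by (simp add: pochhammer_Suc k_def algebra_simps)
  have p3: "pochhammer a (K + 2) = pochhammer a K * ((a + k - 2) * (a + k - 1))"
    by (simp add: pochhammer_Suc k_def)
  have "2 - a + 1 = 3 - a" "1 - a + 1 = 2 - a" by simp_all
  then have p4: "pochhammer (1 - a) (K + 2) = (1 - a) * (2 - a) * pochhammer (3 - a) K"
    by (simp add: pochhammer_rec)
  have t1: "whipple_term c (a - 2) (K + 2) = (1 - a) * (2 - a) * Z * ((k + 1 - a) * (k + 2 - a))"
    unfolding whipple_term_def p1 p2 Z_def by simp
  have t2: "whipple_term c a (K + 2) = (1 - a) * (2 - a) * Z * ((a + k - 2) * (a + k - 1))"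
    unfolding whipple_term_def p3 p4 Z_def by simp
  have new: "pochhammer a (Suc K) * pochhammer (3 - a) (Suc K) * pochhammer c (Suc K + 2)
      / ((fact (Suc K + 1))\<^sup>2 * pochhammer (2 * c) (Suc K + 1)) = Z * ((a + k - 2) * (k + 1 - a) * (c + k))"
  proof -
    have "pochhammer a (Suc K) = pochhammer a K * (a + k - 2)" by (simp add: pochhammer_Suc k_def)
    moreover have "pochhammer (3 - a) (Suc K) = pochhammer (3 - a) K * (k + 1 - a)"
      by (simp add: pochhammer_Suc k_def algebra_simps)
    moreover have "pochhammer c (Suc K + 2) = pochhammer c (K + 2) * (c + k)"
      unfolding add_Suc pochhammer_Suc by (simp add: k_def)
    moreover have "Suc K + 1 = K + 2" by simp
    ultimately show ?thesis
      unfolding Z_def by (simp only: times_divide_eq_left times_divide_eq_right mult_ac)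
  qed
  have s: "(\<Sum>k<Suc K + 2. f k) = (\<Sum>k<K + 2. f k) + f (K + 2)" for f :: "nat \<Rightarrow> 'a" by simp
  have d: "x * (S + T) + y * (S' + T') = (x * S + y * S') + (x * T + y * T')" for x y S S' T T' :: 'a
    by (simp add: algebra_simps)
  have "(2 - a) * (a - 1 - 2 * c) * (\<Sum>k<Suc K+2. whipple_term c (a - 2) k)
    + (1 - a) * (2 - a - 2 * c) * (\<Sum>k<Suc K+2. whipple_term c a k)
    = (1 - a) * (2 - a) * (6 - 4 * a) * (Z * (k * k) * (2 * c + k - 1)) +
     ((2 - a) * (a - 1 - 2 * c) * ((1 - a) * (2 - a) * Z * ((k + 1 - a) * (k + 2 - a))) +
      (1 - a) * (2 - a - 2 * c) * ((1 - a) * (2 - a) * Z * ((a + k - 2) * (a + k - 1))))"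
    unfolding s d Suc.IH[OF nz(1)] old t1 t2 ..
  also have "\<dots> = (1 - a) * (2 - a) * Z * ((6 - 4 * a) * (k * k) * (2 * c + k - 1) + (2 - a) * (a - 1 - 2 * c) * (k + 1 - a) * (k + 2 - a)
    + (1 - a) * (2 - a - 2 * c) * (a + k - 2) * (a + k - 1))"
    by (simp only: distrib_left mult_ac add_ac)
  also have "\<dots> = (1 - a) * (2 - a) * (6 - 4 * a) * (Z * ((a + k - 2) * (k + 1 - a) * (c + k)))"
    unfolding whipple_cert by (simp only: mult_ac)
  finally show ?case unfolding new .
qed

text \<open>For a = -1 the series is 1 - 1. The contiguity relation then carries the zero down
  through the negative odd integers a.\<close>

lemma whipple_zero:
  assumes "i < n"
  shows "(\<Sum>k<n+1. whipple_term (- of_nat n) (- of_nat (2 * i + 1) :: rat) k) = 0"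
  using assms
proof (induction i)
  case 0
  have z: "whipple_term (- of_nat n) (- 1 :: rat) k = 0" if "k \<ge> 2" for k
  proof -
    have "pochhammer (- of_nat 1) k = (0 :: rat)" unfolding pochhammer_of_nat_eq_0_iff using that by simp
    then show ?thesis by (simp add: whipple_term_def)
  qed
  have "(\<Sum>k<n+1. whipple_term (- of_nat n) (- 1 :: rat) k) = (\<Sum>k\<in>{0, 1}. whipple_term (- of_nat n) (- 1) k)"
    using 0 z by (intro sum.mono_neutral_right) auto
  also have "\<dots> = 0" using 0 by (simp add: whipple_term_def)
  finally show ?case by simp
next
  case (Suc i)
  define a where "a = - (of_nat (2 * i + 1) :: rat)"
  have K: "n - 1 + 2 = n + 1" "n - 1 + 1 = n" using Suc.prems by auto
  have c2: "2 * (- of_nat n) = (- of_nat (2 * n) :: rat)" by simp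
  have nz: "pochhammer (2 * (- of_nat n)) n \<noteq> (0 :: rat)"
    unfolding c2 pochhammer_of_nat_eq_0_iff by simp
  \<comment> \<open>The boundary term has this factor in its numerator, while (-2n)_n in its
    denominator is not 0.\<close>
  have z: "pochhammer (- of_nat n) (n + 1) = (0 :: rat)"
    unfolding pochhammer_of_nat_eq_0_iff by simp
  have IH: "(\<Sum>k<n+1. whipple_term (- of_nat n) a k) = 0"
    using Suc unfolding a_def by simp
  have "(2 - a) * (a - 1 - 2 * (- of_nat n)) * (\<Sum>k<n+1. whipple_term (- of_nat n) (a - 2) k) = 0"
    using whipple_telescope[of "- of_nat n" "n - 1" a] nz unfolding K z IH by simp
  moreover have "2 - a = of_nat (2 * i + 3)" by (simp add: a_def)
  \<comment> \<open>The coefficient of the new sum is nonzero because i + 1 < n.\<close>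
  moreover have "a - 1 - 2 * (- of_nat n) = (of_nat (2 * n - 2 * i - 2) :: rat)"
    using Suc.prems by (simp add: a_def of_nat_diff)
  moreover have "2 * n - 2 * i - 2 \<noteq> 0" "2 * i + 3 \<noteq> 0" using Suc.prems by auto
  ultimately have "(\<Sum>k<n+1. whipple_term (- of_nat n) (a - 2) k) = 0"
    by (simp only: of_nat_eq_0_iff mult_eq_0_iff simp_thms)
  moreover have "a - 2 = - of_nat (2 * Suc i + 1)" by (simp add: a_def)
  ultimately show ?case by (simp only:)
qed

text \<open>The product of (j + 1/2)^2 - w over j < k, as a polynomial in w.\<close>

definition legendre_factor :: "nat \<Rightarrow> rat poly" where
  "legendre_factor k = (\<Prod>j<k. [:(of_nat j + 1 / 2)\<^sup>2, - 1:])"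

text \<open>The difference of squares (j + 1/2)^2 - (b + 1/2)^2 factors as (j - b)(j + b +
  1).\<close>

lemma legendre_factor_eval:
  "poly (legendre_factor k) ((b + 1 / 2)\<^sup>2) = pochhammer (- b) k * pochhammer (1 + b) k"
proof -
  have "poly (legendre_factor k) ((b + 1 / 2)\<^sup>2) = (\<Prod>j<k. (- b + of_nat j) * (1 + b + of_nat j))"
    unfolding legendre_factor_def poly_prod by (intro prod.cong) (auto simp: power2_eq_square algebra_simps)
  then show ?thesis by (simp add: pochhammer_prod prod.distrib atLeast0LessThan)
qed

lemma degree_prod_linear_le:
  "finite A \<Longrightarrow> degree (\<Prod>j\<in>A. [:f j, - 1 :: rat:]) \<le> card A"
  using degree_prod_sum_le[of A "\<lambda>j. [:f j, - 1:]"] by simp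

lemma prod_odd_even_fact: "(\<Prod>i=1..n. (2 * of_nat i - 1) * (2 * of_nat i)) = (fact (2 * n) :: rat)"
proof (induction n)
  case (Suc n)
  have "2 * Suc n = Suc (Suc (2 * n))" by simp
  then have "(fact (2 * Suc n) :: rat) = fact (2 * n) * ((2 * of_nat (Suc n) - 1) * (2 * of_nat (Suc n)))"
    by (simp add: algebra_simps)
  then show ?case using Suc by simp
qed simp

text \<open>Both sides have degree \<open>n\<close> and agree at the \<open>n + 1\<close> points \<open>1/4\<close> and \<open>(2i - 1/2)\<^sup>2\<close>.\<close>

lemma whipple_poly:
  "(\<Sum>k<n+1. Polynomial.smult (pochhammer (- of_nat n) k / ((fact k)\<^sup>2 * pochhammer (- of_nat (2 * n)) k)) (legendre_factor k))
   = Polynomial.smult (1 / fact (2 * n)) (\<Prod>i=1..n. [:(2 * of_nat i - 1 / 2)\<^sup>2, - 1:])" (is "?L = ?R")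
proof -
  define w where "w = (\<lambda>i. (2 * of_nat i - 1 / 2 :: rat)\<^sup>2)"
  have inj: "inj_on w {1..n}"
  proof (rule inj_onI)
    fix i j assume "i \<in> {1..n}" "j \<in> {1..n}" "w i = w j"
    moreover from this have "(2 * of_nat i - 1 / 2 :: rat) \<ge> 0" "(2 * of_nat j - 1 / 2 :: rat) \<ge> 0" by auto
    ultimately have "(2 * of_nat i - 1 / 2 :: rat) = 2 * of_nat j - 1 / 2"
      unfolding w_def using power2_eq_iff_nonneg by blast
    then show "i = j" by simp
  qed
  have w0: "1 / 4 \<notin> w ` {1..n}"
  proof
    assume "1 / 4 \<in> w ` {1..n}"
    then obtain i where i: "i \<ge> 1" "(2 * of_nat i - 1 / 2 :: rat)\<^sup>2 = (1 / 2)\<^sup>2" by (auto simp: w_def power2_eq_square)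
    then have "(2 * of_nat i - 1 / 2 :: rat) \<ge> 0" by simp
    then have "(2 * of_nat i - 1 / 2 :: rat) = 1 / 2" using i(2) power2_eq_iff_nonneg[of "2 * of_nat i - 1 / 2 :: rat" "1 / 2"] by simp
    then have "of_nat (2 * i) = (of_nat 1 :: rat)" by simp
    then have "2 * i = 1" by (simp only: of_nat_eq_iff)
    then show False by presburger
  qed
  have card: "card (insert (1 / 4) (w ` {1..n})) = n + 1"
    using w0 card_image[OF inj] by simp
  have dL: "degree ?L \<le> n"
  proof (rule degree_sum_le)
    fix k assume "k \<in> {..<n+1}"
    then show "degree (Polynomial.smult (pochhammer (- of_nat n) k / ((fact k)\<^sup>2 * pochhammer (- of_nat (2 * n)) k)) (legendre_factor k)) \<le> n"
      using degree_prod_linear_le[of "{..<k}" "\<lambda>j. (of_nat j + 1 / 2)\<^sup>2"]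
      by (intro order.trans[OF degree_smult_le]) (simp add: legendre_factor_def)
  qed simp
  have dR: "degree ?R \<le> n"
    using degree_prod_linear_le[of "{1..n}" w]
    by (intro order.trans[OF degree_smult_le]) (simp add: w_def)
  have "poly ?L x = poly ?R x" if "x \<in> insert (1 / 4) (w ` {1..n})" for x
  proof (cases "x = 1 / 4")
    \<comment> \<open>Here b = 0 in \<open>legendre_factor_eval\<close>, so only the summand k = 0
      remains.\<close>
    case True
    have x: "x = (0 + 1 / 2)\<^sup>2" by (simp add: True power2_eq_square)
    have l: "poly (legendre_factor k) x = (if k = 0 then 1 else 0)" for k
      unfolding x legendre_factor_eval by (simp add: pochhammer_0_left)
    have "poly ?L x = (\<Sum>k<n+1. if k = 0 then 1 else 0)"
      unfolding poly_sum poly_smult l by (intro sum.cong refl) simp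
    also have "\<dots> = 1" by (subst sum.delta) auto
    finally have "poly ?L x = 1" .
    moreover have "(2 * of_nat i - 1 / 2 :: rat)\<^sup>2 - 1 / 4 = (2 * of_nat i - 1) * (2 * of_nat i)" for i
      by (simp add: power2_eq_square algebra_simps)
    then have R: "poly (\<Prod>i=1..n. [:(2 * of_nat i - 1 / 2)\<^sup>2, - 1:]) x = (fact (2 * n) :: rat)"
      unfolding prod_odd_even_fact[symmetric] poly_prod True by (intro prod.cong refl) simp
    have "poly ?R x = 1" unfolding poly_smult R by simp
    ultimately show ?thesis by (simp only:)
  next
    case False
    then obtain i where i: "i \<in> {1..n}" "x = w i" using \<open>x \<in> _\<close> by blast
    \<comment> \<open>This is b = 2i - 1 in \<open>legendre_factor_eval\<close>, so the left side
      becomes a sum of Whipple terms with a = -(2i - 1), which vanishes by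
      \<open>whipple_zero\<close>.\<close>
    have x: "x = (of_nat (2 * (i - 1) + 1) + 1 / 2)\<^sup>2" using i by (simp add: w_def of_nat_diff algebra_simps)
    have "poly ?R x = 0" using i by (auto simp: poly_prod w_def)
    moreover have "poly ?L x = (\<Sum>k<n+1. whipple_term (- of_nat n) (- of_nat (2 * (i - 1) + 1)) k)"
      unfolding poly_sum poly_smult x legendre_factor_eval
      by (intro sum.cong refl) (simp add: whipple_term_def)
    moreover have "i - 1 < n" using i by auto
    ultimately show ?thesis using whipple_zero[of "i - 1" n] by simp
  qed
  then show ?thesis using card dL dR by (intro poly_eqI_degree[of "insert (1 / 4) (w ` {1..n})"]) auto
qed

lemma poly_legendre_factor_0: "poly (legendre_factor k) 0 = (pochhammer (1 / 2) k)\<^sup>2"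
  by (simp add: legendre_factor_def poly_prod pochhammer_prod prod_power_distrib atLeast0LessThan add.commute)

text \<open>The logarithmic derivative at w = 0 is minus the sum of 1/(j + 1/2)^2 over j <
  k.\<close>

lemma pderiv_legendre_factor_0:
  "poly (pderiv (legendre_factor k)) 0 = - 4 * (pochhammer (1 / 2) k)\<^sup>2 * odd_harmonic 2 k"
proof (induction k)
  case (Suc k)
  have nz: "(2 * of_nat k + 1 :: rat) \<noteq> 0" by (metis of_nat_Suc of_nat_mult of_nat_numeral of_nat_neq_0 add.commute)
  have "legendre_factor (Suc k) = legendre_factor k * [:(of_nat k + 1 / 2)\<^sup>2, - 1:]"
    by (simp add: legendre_factor_def)
  then have "poly (pderiv (legendre_factor (Suc k))) 0 =
    - (pochhammer (1 / 2) k)\<^sup>2 + (of_nat k + 1 / 2)\<^sup>2 * (- 4 * (pochhammer (1 / 2) k)\<^sup>2 * odd_harmonic 2 k)"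
    by (simp only: pderiv_mult poly_add poly_mult Suc.IH poly_legendre_factor_0)
      (simp add: pderiv_pCons poly_legendre_factor_0)
  also have "\<dots> = - 4 * (pochhammer (1 / 2) (Suc k))\<^sup>2 * (odd_harmonic 2 k + 1 / (2 * of_nat k + 1)\<^sup>2)"
  proof -
    have h: "(1 / 2 + of_nat k :: rat) = (2 * of_nat k + 1) / 2" "(of_nat k + 1 / 2 :: rat) = (2 * of_nat k + 1) / 2"
      by simp_all
    have "- P\<^sup>2 + (d / 2)\<^sup>2 * (- 4 * P\<^sup>2 * x) = - 4 * (P * (d / 2))\<^sup>2 * (x + 1 / d\<^sup>2)" if "d \<noteq> 0" for P d x :: rat
      using that by (simp add: power_mult_distrib power_divide distrib_left)
    from this[OF nz] show ?thesis unfolding pochhammer_Suc h .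
  qed
  also have "odd_harmonic 2 k + 1 / (2 * of_nat k + 1)\<^sup>2 = odd_harmonic 2 (Suc k)"
    by (simp add: odd_harmonic_def)
  finally show ?case .
qed (simp add: legendre_factor_def odd_harmonic_def)

lemma pderiv_prod_linear_0:
  assumes "finite A"
  shows "poly (pderiv (\<Prod>i\<in>A. [:f i, - 1 :: rat:])) 0 = - (\<Sum>i\<in>A. \<Prod>j\<in>A - {i}. f j)"
  unfolding pderiv_prod poly_sum sum_negf[symmetric]
  by (intro sum.cong refl) (simp add: pderiv_pCons poly_prod)

section \<open>Evaluation of the second sum modulo p\<close>

context prime_localization begin

abbreviation T_sum :: rat where
  "T_sum \<equiv> (\<Sum>k=1..p-1. of_nat ((2 * k) choose k) ^ 3 * odd_harmonic 2 k / 64 ^ k)"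

lemma T_sum_legendre:
  "4 * T_sum = - (\<Sum>k<p. pochhammer (1 / 2) k / fact k / (fact k)\<^sup>2 * poly (pderiv (legendre_factor k)) 0)"
proof -
  have "- (\<Sum>k<p. pochhammer (1 / 2) k / fact k / (fact k)\<^sup>2 * poly (pderiv (legendre_factor k)) 0)
    = (\<Sum>k<p. 4 * (of_nat ((2 * k) choose k) ^ 3 * odd_harmonic 2 k / 64 ^ k))"
    unfolding sum_negf[symmetric]
  proof (intro sum.cong refl)
    fix k
    have "(64 :: rat) ^ k = (4 ^ 3) ^ k" by simp
    then have "(64 :: rat) ^ k = (4 ^ k) ^ 3" by (simp only: power_mult[symmetric] mult.commute)
    then have "4 * (of_nat ((2 * k) choose k) ^ 3 * odd_harmonic 2 k / 64 ^ k)
      = 4 * ((pochhammer (1 / 2) k / fact k) ^ 3 * odd_harmonic 2 k)"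
      unfolding pochhammer_half by (simp add: power_divide)
    then show "- (pochhammer (1 / 2) k / fact k / (fact k)\<^sup>2 * poly (pderiv (legendre_factor k)) 0)
      = 4 * (of_nat ((2 * k) choose k) ^ 3 * odd_harmonic 2 k / 64 ^ k)"
      unfolding pderiv_legendre_factor_0 by (simp add: power2_eq_square power3_eq_cube mult_ac)
  qed
  moreover have "{..<p} = insert 0 {1..p-1}" by (auto simp: Suc_le_eq)
  moreover have "odd_harmonic 2 0 = 0" by (simp add: odd_harmonic_def)
  then have "(\<Sum>k\<in>insert 0 {1..p-1}. 4 * (of_nat ((2 * k) choose k) ^ 3 * odd_harmonic 2 k / 64 ^ k)) = 4 * T_sum"
    unfolding sum_distrib_left by simp
  ultimately show ?thesis by (simp only:)
qed

lemma pint_pderiv_legendre: "pint (poly (pderiv (legendre_factor k)) 0)"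
proof -
  have "pint_poly [:(of_nat j + 1 / 2)\<^sup>2, - 1:]" for j
  proof -
    have "pint ((of_nat j + 1 / 2)\<^sup>2)" by (intro pint_power pint_add pint_divide) auto
    then show ?thesis by (auto simp: pint_poly_def coeff_pCons split: nat.splits)
  qed
  then show ?thesis unfolding legendre_factor_def
    by (intro pint_poly_eval pint_poly_pderiv pint_poly_prod) auto
qed

lemma pint_pochhammer_half_quot: "k < p \<Longrightarrow> pint (pochhammer (1 / 2) k / fact k / (fact k)\<^sup>2)"
  by (intro pint_divide pint_pochhammer punit_fact punit_power) auto

lemma pint_T_sum: "pint T_sum"
proof -
  have "pint (4 * T_sum)" unfolding T_sum_legendre pint_minus_iff
    by (intro pint_sum pint_mult pint_pderiv_legendre pint_pochhammer_half_quot) simp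
  then have "pint (4 * T_sum / 4)" by (rule pint_divide) simp
  then show ?thesis by simp
qed

text \<open>Modulo p one has 1/2 = -n and 1 = -2n with n = \<open>half\<close>. Replacing just one
  of the three quotients (1/2)_k / k! accordingly makes the sum an instance of
  \<open>whipple_poly\<close>, which is then differentiated at 0.\<close>

lemma T_sum_pcong:
  "pcong 1 (4 * T_sum) (- (\<Sum>i=1..half. \<Prod>j\<in>{1..half} - {i}. (2 * of_nat j - 1 / 2)\<^sup>2))"
proof -
  let ?c = "\<lambda>k. pochhammer (- of_nat half) k / ((fact k)\<^sup>2 * pochhammer (- of_nat (2 * half)) k) :: rat"
  let ?P = "\<Prod>i=1..half. [:(2 * of_nat i - 1 / 2)\<^sup>2, - 1 :: rat:]"
  let ?R = "- (\<Sum>i=1..half. \<Prod>j\<in>{1..half} - {i}. (2 * of_nat j - 1 / 2)\<^sup>2) :: rat"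
  have h2: "pint (1 / 2)" by (intro pint_divide) auto
  have num: "pcong 1 (pochhammer (1 / 2) k) (pochhammer (- of_nat half) k)" for k
    unfolding pochhammer_prod
  proof (intro pcong_prod)
    fix i
    have "(1 / 2 + of_nat i :: rat) = (- of_nat half + of_nat i) + of_nat p * (1 / 2)"
      unfolding of_nat_p by (simp add: add_divide_distrib)
    then show "pcong 1 (1 / 2 + of_nat i) (- of_nat half + of_nat i)"
      using pcong_add_p[OF h2, of "- of_nat half + of_nat i"] by (simp only:)
    show "pint (- of_nat half + of_nat i)" by (intro pint_add) auto
  qed
  have den: "pcong 1 (fact k) (pochhammer (- of_nat (2 * half)) k)" for k
  proof -
    have "fact k = (\<Prod>i\<in>{0..<k}. of_nat i + 1 :: rat)"
      by (simp add: pochhammer_fact pochhammer_prod add.commute)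
    moreover have "pcong 1 \<dots> (\<Prod>i\<in>{0..<k}. - of_nat (2 * half) + of_nat i)"
    proof (intro pcong_prod)
      fix i
      have "of_nat i + 1 = (- of_nat (2 * half) + of_nat i) + of_nat p * (1 :: rat)"
        unfolding of_nat_p by simp
      then show "pcong 1 (of_nat i + 1) (- of_nat (2 * half) + of_nat i)"
        using pcong_add_p[OF pint_numeral(3), of "- of_nat (2 * half) + of_nat i"] by (simp only:)
      show "pint (- of_nat (2 * half) + of_nat i)" by (intro pint_add) auto
    qed
    ultimately show ?thesis unfolding pochhammer_prod by (simp only:)
  qed
  have "pcong 1 (\<Sum>k<p. pochhammer (1 / 2) k / fact k / (fact k)\<^sup>2 * poly (pderiv (legendre_factor k)) 0)
    (\<Sum>k<p. ?c k * poly (pderiv (legendre_factor k)) 0)"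
  proof (intro pcong_sum pcong_mult_right pint_pderiv_legendre)
    fix k assume "k \<in> {..<p}"
    then have u: "punit (fact k)" by (intro punit_fact) simp
    have u2: "punit (pochhammer (- of_nat (2 * half)) k)" using punit_pcong[OF u den] by simp
    have "pcong 1 (pochhammer (1 / 2) k / fact k) (pochhammer (- of_nat half) k / pochhammer (- of_nat (2 * half)) k)"
      by (intro pcong_divide num den u u2 pint_pochhammer) simp
    from pcong_divide_unit[OF punit_power[OF u, of 2] this]
    show "pcong 1 (pochhammer (1 / 2) k / fact k / (fact k)\<^sup>2) (?c k)" by (simp add: mult.commute)
  qed
  \<comment> \<open>The factor (-n)_k vanishes for k > n.\<close>
  also have "(\<Sum>k<p. ?c k * poly (pderiv (legendre_factor k)) 0) = (\<Sum>k<half+1. ?c k * poly (pderiv (legendre_factor k)) 0)"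
  proof (intro sum.mono_neutral_right)
    show "{..<half + 1} \<subseteq> {..<p}" using p_eq(1) by auto
    show "\<forall>k\<in>{..<p} - {..<half + 1}. ?c k * poly (pderiv (legendre_factor k)) 0 = 0"
    proof
      fix k assume "k \<in> {..<p} - {..<half + 1}"
      then have "pochhammer (- of_nat half) k = (0 :: rat)" unfolding pochhammer_of_nat_eq_0_iff by simp
      then show "?c k * poly (pderiv (legendre_factor k)) 0 = 0" by simp
    qed
  qed simp
  also have "\<dots> = poly (pderiv (\<Sum>k<half+1. Polynomial.smult (?c k) (legendre_factor k))) 0"
    by (simp only: higher_pderiv_sum[of 1, simplified] poly_sum pderiv_smult poly_smult)
  also have "\<dots> = 1 / fact (p - 1) * ?R"
    unfolding whipple_poly pderiv_smult poly_smult
    by (simp only: pderiv_prod_linear_0[OF finite_atLeastAtMost] p_eq(2))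
  \<comment> \<open>Wilson's theorem, since 2 \<open>half\<close> = p - 1.\<close>
  also have "pcong 1 \<dots> (1 / (- 1) * ?R)"
  proof (intro pcong_mult_right pcong_divide)
    show "pcong 1 (fact (p - 1)) (- 1)" using wilson_pcong[of 0] by simp
    show "punit (fact (p - 1))" by (intro punit_fact) simp
    show "pint ?R" unfolding pint_minus_iff
      by (intro pint_sum pint_prod pint_power pint_diff pint_mult pint_divide) auto
  qed auto
  finally have "pcong 1 (- (\<Sum>k<p. pochhammer (1 / 2) k / fact k / (fact k)\<^sup>2 * poly (pderiv (legendre_factor k)) 0)) (- (1 / (- 1) * ?R))"
    by (rule pcong_minus)
  then show ?thesis unfolding T_sum_legendre by simp
qed

lemma prod_falling: "k \<le> n \<Longrightarrow> (\<Prod>i<k. of_nat (n - i)) * fact (n - k) = (fact n :: rat)"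
proof (induction k)
  case (Suc k)
  have "n - k = Suc (n - Suc k)" using Suc.prems by simp
  then have "(fact (n - k) :: rat) = of_nat (n - k) * fact (n - Suc k)" by (metis fact_Suc)
  then show ?case using Suc by (simp add: mult_ac)
qed simp

lemma pint_fact [simp]: "pint (fact k)"
  using pint_of_nat[of "fact k"] by simp

lemma four_power: "pcong 1 (4 ^ half) 1"
proof -
  have "\<not> p dvd 2" using p_gt_3 by (auto dest: dvd_imp_le)
  moreover have "(4 :: rat) ^ half = of_nat 2 ^ (p - 1)" unfolding p_eq(2) by (simp add: power_mult)
  ultimately show ?thesis using fermat_pcong[of 2] by metis
qed

text \<open>All factors are units, so the sum of products with one factor omitted is the full
  product D times a sum of inverse squares, which gives the Euler number. D itself is a quotient of
  factorials modulo p.\<close>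

lemma T_sum_1_mod_4:
  assumes m: "p = 4 * m + 1"
  shows "pcong 1 T_sum (1 / 2 * euler_number (p - 3) * fact (3 * m) ^ 4)"
proof -
  have half: "half = 2 * m" using m p_eq(1) by linarith
  define f where "f = (\<lambda>j. 2 * of_nat j - 1 / 2 :: rat)"
  define D where "D = (\<Prod>j=1..2*m. (f j)\<^sup>2)"
  have h: "pint (3 / 2)" by (intro pint_divide) auto
  \<comment> \<open>Makes D congruent to 4^(2m) ((3m)! / m!)^2, where the power of 4 is 1 by
    Fermat.\<close>
  have fc: "pcong 1 (f j) (- 2 * of_nat (3 * m + 1 - j))" if "j \<in> {1..2*m}" for j
  proof -
    have "f j = - 2 * of_nat (3 * m + 1 - j) + of_nat p * (3 / 2)"
      using that by (subst m) (simp add: f_def of_nat_diff add_divide_distrib)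
    then show ?thesis using pcong_add_p[OF h] by (simp only:)
  qed
  have fu: "punit (f j)" if "j \<in> {1..2*m}" for j
  proof -
    have "0 < 3 * m + 1 - j" "3 * m + 1 - j < p" using that m by auto
    then have "punit (of_nat (3 * m + 1 - j))" by (rule punit_of_nat_less)
    then have "punit (- 2 * of_nat (3 * m + 1 - j))" by (rule punit_mult[rotated]) simp
    then show ?thesis using punit_pcong[OF _ pcong_sym[OF fc[OF that]]] by simp
  qed
  have "(\<Sum>i=1..2*m. \<Prod>j\<in>{1..2*m} - {i}. (f j)\<^sup>2) = (\<Sum>i=1..2*m. 4 * D * (1 / (4 * of_nat i - 1)\<^sup>2))"
  proof (intro sum.cong refl)
    fix i assume i: "i \<in> {1..2*m}"
    have D: "D = (f i)\<^sup>2 * (\<Prod>j\<in>{1..2*m} - {i}. (f j)\<^sup>2)"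
      unfolding D_def using i by (intro prod.remove) auto
    have e: "(4 * of_nat i - 1)\<^sup>2 = 4 * (f i)\<^sup>2" by (simp add: f_def power2_eq_square algebra_simps)
    have "f i \<noteq> 0" using punit_nz[OF fu[OF i]] .
    then show "(\<Prod>j\<in>{1..2*m} - {i}. (f j)\<^sup>2) = 4 * D * (1 / (4 * of_nat i - 1)\<^sup>2)"
      unfolding D e by simp
  qed
  also have "\<dots> = 4 * D * (\<Sum>i=1..2*m. 1 / (4 * of_nat i - 1)\<^sup>2)" by (simp only: sum_distrib_left)
  finally have S: "(\<Sum>i=1..2*m. \<Prod>j\<in>{1..2*m} - {i}. (f j)\<^sup>2) = 4 * D * (\<Sum>i=1..2*m. 1 / (4 * of_nat i - 1)\<^sup>2)" .
  have Di: "pint D" unfolding D_def using fu by (intro pint_prod pint_power punit_pint)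
  have "pcong 1 (4 * T_sum) (- (\<Sum>i=1..2*m. \<Prod>j\<in>{1..2*m} - {i}. (f j)\<^sup>2))"
    using T_sum_pcong unfolding half f_def .
  also have "\<dots> = - (4 * D * (\<Sum>i=1..2*m. 1 / (4 * of_nat i - 1)\<^sup>2))" unfolding S ..
  also have "pcong 1 \<dots> (- (4 * D * (- euler_number (p - 3) / 2)))"
    using Di by (intro pcong_minus pcong_mult_left sum_inverse_squares_four_i_minus_1[OF m] pint_mult) auto
  also have "\<dots> = 4 * (1 / 2 * euler_number (p - 3) * D)" by simp
  finally have T: "pcong 1 T_sum (1 / 2 * euler_number (p - 3) * D)" by (rule pcong_unit_cancel[rotated]) simp
  define Q where "Q = (\<Prod>j=1..2*m. of_nat (3 * m + 1 - j) :: rat)"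
  have "Q = (\<Prod>i<2*m. of_nat (3 * m - i))"
    unfolding Q_def by (rule prod.reindex_bij_witness[of _ Suc "\<lambda>j. j - 1"]) auto
  moreover have Qi: "pint Q" unfolding Q_def by (intro pint_prod pint_of_nat)
  ultimately have Q: "Q * fact m = fact (3 * m)" using prod_falling[of "2 * m" "3 * m"] by simp
  have D0: "pcong 1 D (\<Prod>j=1..2*m. (- 2 * of_nat (3 * m + 1 - j))\<^sup>2)"
    unfolding D_def using fc by (intro pcong_prod pcong_power pint_power pint_mult) auto
  have "(\<Prod>j=1..2*m. (- 2 * g j)\<^sup>2) = 4 ^ (2 * m) * (\<Prod>j=1..2*m. g j)\<^sup>2" for g :: "nat \<Rightarrow> rat"
    by (simp add: power_mult_distrib prod.distrib prod_power_distrib)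
  then have "(\<Prod>j=1..2*m. (- 2 * of_nat (3 * m + 1 - j))\<^sup>2) = 4 ^ half * Q\<^sup>2" unfolding Q_def half .
  with D0 have "pcong 1 D (4 ^ half * Q\<^sup>2)" by (simp only:)
  also have "pcong 1 \<dots> (1 * Q\<^sup>2)"
    by (intro pcong_mult_right four_power pint_power Qi)
  finally have "pcong 1 (D * (fact m)\<^sup>2) (1 * Q\<^sup>2 * (fact m)\<^sup>2)" by (intro pcong_mult_right) auto
  then have D1: "pcong 1 (D * (fact m)\<^sup>2) ((fact (3 * m))\<^sup>2)" by (simp add: Q[symmetric] power_mult_distrib)
  have "p - 1 - m = 3 * m" using m by simp
  then have "pcong 1 (fact (3 * m) * fact m * (- 1) ^ m) (- 1)" using wilson_pcong[of m] m by simp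
  moreover have "((- 1) ^ m)\<^sup>2 = (1 :: rat)" by (cases "even m") auto
  \<comment> \<open>By Wilson, m! is the inverse of (3m)! up to sign, so the squared quotient
    becomes the fourth power of (3m)!.\<close>
  ultimately have W: "pcong 1 ((fact (3 * m) * fact m)\<^sup>2) 1"
    using pcong_power[of 1 "fact (3 * m) * fact m * (- 1) ^ m" "- 1" 2] by (simp add: power_mult_distrib)
  have "pcong 1 (D * 1) (D * (fact (3 * m) * fact m)\<^sup>2)"
    by (intro pcong_mult_left Di pcong_sym[OF W])
  also have "\<dots> = D * (fact m)\<^sup>2 * (fact (3 * m))\<^sup>2" by (simp add: power_mult_distrib)
  also have "pcong 1 \<dots> ((fact (3 * m))\<^sup>2 * (fact (3 * m))\<^sup>2)"
    by (intro pcong_mult_right D1) auto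
  also have "\<dots> = fact (3 * m) ^ 4" by (simp add: power_add[symmetric])
  finally have "pcong 1 D (fact (3 * m) ^ 4)" by simp
  then have "pcong 1 (1 / 2 * euler_number (p - 3) * D) (1 / 2 * euler_number (p - 3) * fact (3 * m) ^ 4)"
    by (intro pcong_mult_left pint_mult euler_number_pint pint_divide) auto
  then show ?thesis by (rule pcong_trans[OF T])
qed

text \<open>The factor with index m + 1 is the square of p/2. Modulo p, only the product omitting it
  survives, and its other factors are symmetric about that index.\<close>

lemma T_sum_3_mod_4:
  assumes m: "p = 4 * m + 3"
  shows "pcong 1 T_sum (- 1 / 16 * fact m ^ 4)"
proof -
  have half: "half = 2 * m + 1" using m p_eq(1) by linarith
  define f where "f = (\<lambda>j. 2 * of_nat j - 1 / 2 :: rat)"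
  have h: "pint (1 / 2)" by (intro pint_divide) auto
  have fi: "pint (f j)" for j unfolding f_def by (intro pint_diff pint_mult h) auto
  have f0: "f (m + 1) = of_nat p * (1 / 2)" by (subst m) (simp add: f_def add_divide_distrib)
  have f02: "(f (m + 1))\<^sup>2 = of_nat p * (1 / 2 * f (m + 1))"
    unfolding power2_eq_square by (subst f0) simp
  define D where "D = (\<Prod>j\<in>{1..2*m+1} - {m+1}. (f j)\<^sup>2)"
  have "pcong 1 (\<Sum>i=1..2*m+1. \<Prod>j\<in>{1..2*m+1} - {i}. (f j)\<^sup>2) (\<Sum>i=1..2*m+1. if i = m + 1 then D else 0)"
  proof (intro pcong_sum)
    fix i assume "i \<in> {1..2*m+1}"
    show "pcong 1 (\<Prod>j\<in>{1..2*m+1} - {i}. (f j)\<^sup>2) (if i = m + 1 then D else 0)"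
    proof (cases "i = m + 1")
      case False
      then have "(\<Prod>j\<in>{1..2*m+1} - {i}. (f j)\<^sup>2) = (f (m + 1))\<^sup>2 * (\<Prod>j\<in>{1..2*m+1} - {i} - {m + 1}. (f j)\<^sup>2)"
        by (intro prod.remove) auto
      also have "\<dots> = of_nat p * (1 / 2 * f (m + 1) * (\<Prod>j\<in>{1..2*m+1} - {i} - {m + 1}. (f j)\<^sup>2))"
        by (simp only: f02 mult.assoc)
      also have "pcong 1 \<dots> 0"
        using fi h by (intro pcong_p_0 pint_mult pint_prod pint_power)
      finally show ?thesis using False by simp
    qed (simp add: D_def)
  qed
  also have "(\<Sum>i=1..2*m+1. if i = m + 1 then D else 0) = D" by simp
  finally have S: "pcong 1 (\<Sum>i=1..2*m+1. \<Prod>j\<in>{1..2*m+1} - {i}. (f j)\<^sup>2) D" .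
  have "pcong 1 (4 * T_sum) (- (\<Sum>i=1..2*m+1. \<Prod>j\<in>{1..2*m+1} - {i}. (f j)\<^sup>2))"
    using T_sum_pcong unfolding half f_def .
  also have "pcong 1 \<dots> (- D)" by (intro pcong_minus S)
  \<comment> \<open>The extra factor 4 raises the power 4^(2m) inside D to 4^(2m + 1) =
    4^\<open>half\<close>, which is 1 modulo p.\<close>
  finally have T: "pcong 1 (4 * (4 * T_sum)) (4 * (- D))" by (intro pcong_mult_left) auto
  have "pcong 1 D (\<Prod>j\<in>{1..2*m+1} - {m+1}. 4 * (of_nat j - of_nat (m + 1))\<^sup>2)"
    unfolding D_def
  proof (intro pcong_prod)
    fix j
    have "f j = 2 * (of_nat j - of_nat (m + 1)) + of_nat p * (1 / 2)"
      by (subst m) (simp add: f_def add_divide_distrib)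
    then have "pcong 1 (f j) (2 * (of_nat j - of_nat (m + 1)))" using pcong_add_p[OF h] by (simp only:)
    then have "pcong 1 ((f j)\<^sup>2) ((2 * (of_nat j - of_nat (m + 1)))\<^sup>2)"
      by (rule pcong_power) (intro pint_mult pint_diff pint_of_nat, simp)
    also have "(2 * (of_nat j - of_nat (m + 1)))\<^sup>2 = (4 * (of_nat j - of_nat (m + 1))\<^sup>2 :: rat)"
      by (simp only: power_mult_distrib) simp
    finally show "pcong 1 ((f j)\<^sup>2) (4 * (of_nat j - of_nat (m + 1))\<^sup>2)" .
    show "pint (4 * (of_nat j - of_nat (m + 1))\<^sup>2)" by (intro pint_mult pint_power pint_diff pint_of_nat) simp
  qed
  also have "{1..2*m+1} - {m+1} = {1..m} \<union> {m+2..2*m+1}" by auto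
  also have "(\<Prod>j\<in>{1..m} \<union> {m+2..2*m+1}. 4 * (of_nat j - of_nat (m + 1))\<^sup>2) =
    (\<Prod>j\<in>{1..m}. 4 * (of_nat j - of_nat (m + 1))\<^sup>2) * (\<Prod>j\<in>{m+2..2*m+1}. 4 * (of_nat j - of_nat (m + 1))\<^sup>2 :: rat)"
    by (rule prod.union_disjoint) auto
  also have "(\<Prod>j\<in>{1..m}. 4 * (of_nat j - of_nat (m + 1))\<^sup>2) = (\<Prod>i\<in>{1..m}. 4 * (of_nat i)\<^sup>2 :: rat)"
    by (rule prod.reindex_bij_witness[of _ "\<lambda>i. m + 1 - i" "\<lambda>i. m + 1 - i"])
      (auto simp: of_nat_diff power2_eq_square algebra_simps)
  also have "(\<Prod>j\<in>{m+2..2*m+1}. 4 * (of_nat j - of_nat (m + 1))\<^sup>2) = (\<Prod>i\<in>{1..m}. 4 * (of_nat i)\<^sup>2 :: rat)"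
    by (rule prod.reindex_bij_witness[of _ "\<lambda>i. i + (m + 1)" "\<lambda>i. i - (m + 1)"]) (auto simp: of_nat_diff)
  also have "(\<Prod>i\<in>{1..m}. 4 * (of_nat i)\<^sup>2 :: rat) = 4 ^ m * (fact m)\<^sup>2"
    by (simp add: prod.distrib fact_prod prod_power_distrib)
  finally have "pcong 1 D (4 ^ m * (fact m)\<^sup>2 * (4 ^ m * (fact m)\<^sup>2))" .
  then have "pcong 1 (4 * (- D)) (4 * (- (4 ^ m * (fact m)\<^sup>2 * (4 ^ m * (fact m)\<^sup>2))))"
    by (intro pcong_mult_left pcong_minus) auto
  also have "4 * (- (4 ^ m * (fact m)\<^sup>2 * (4 ^ m * (fact m)\<^sup>2))) = - (4 ^ half * fact m ^ 4 :: rat)"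
    by (simp add: half power_add mult_2 power2_eq_square power4_eq_xxxx)
  also have "pcong 1 \<dots> (- (1 * fact m ^ 4))"
    by (intro pcong_minus pcong_mult_right four_power) auto
  finally have "pcong 1 (4 * (4 * T_sum)) (- (1 * fact m ^ 4))" by (rule pcong_trans[OF T])
  then have "pcong 1 (16 * T_sum) (16 * (- 1 / 16 * fact m ^ 4))" by simp
  then show ?thesis by (rule pcong_unit_cancel[rotated]) simp
qed

end

section \<open>The Dixon product for p congruent to 3 modulo 4\<close>

context prime_localization begin

text \<open>Supplying the factors 6i + 3 = 3(2i + 1) between 6i + 1 and 6i + 5 completes the
  numerator to a product R of consecutive odd numbers. The cost is one more power of the odd product
  Q, and both Q and R reduce to factorials modulo p.\<close>

lemma dixon_prod_pcong:
  assumes m: "p = 4 * m + 3"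
  shows "pcong 1 (12 * dixon_prod m) (fact m ^ 4)"
proof -
  define n where "n = 2 * m + 1"
  define Q where "Q = (\<Prod>i<m+1. 2 * of_nat i + 1 :: rat)"
  define R where "R = (\<Prod>i<3*m+2. remove_p (2 * i + 1))"
  have h3: "remove_p (6 * i + 3) = 3 * (2 * of_nat i + 1)" for i
  proof -
    have "\<not> 3 dvd p" using prime_p p_gt_3 primes_dvd_imp_eq[of 3 p] by auto
    then have "6 * i + 3 \<noteq> p" by presburger
    then show ?thesis by (simp add: remove_p_def)
  qed
  \<comment> \<open>The denominators account for Q^2 and the supplied factors for the third
    Q.\<close>
  have "3 * 3 ^ k * (\<Prod>i<k+1. 2 * of_nat i + 1) ^ 3 * dixon_prod k = (- 3) ^ k * (\<Prod>i<3*k+2. remove_p (2 * i + 1))" for k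
  proof (induction k)
    case 0
    have "remove_p 1 = 1" "remove_p 3 = 3" using p_gt_3 by (simp_all add: remove_p_def)
    then show ?case by (simp add: dixon_prod_def numeral_2_eq_2 numeral_3_eq_3)
  next
    case (Suc k)
    define d where "d = (2 * of_nat (Suc k) + 1 :: rat)"
    define u v where "u = remove_p (6 * k + 5)" and "v = remove_p (6 * k + 7)"
    have d: "d \<noteq> 0" unfolding d_def by (metis of_nat_Suc of_nat_mult of_nat_numeral of_nat_neq_0 add.commute)
    have w: "remove_p (6 * k + 9) = 3 * d" using h3[of "Suc k"] by (simp add: d_def add.commute)
    have i: "6 * Suc k - 1 = 6 * k + 5" "6 * Suc k + 1 = 6 * k + 7" by auto
    have 1: "dixon_prod (Suc k) = dixon_prod k * (- 3 * u * v / d\<^sup>2)"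
    proof -
      have "(\<Prod>i=1..Suc k. f i) = (\<Prod>i=1..k. f i) * f (Suc k)" for f :: "nat \<Rightarrow> rat" by simp
      then show ?thesis unfolding dixon_prod_def u_def v_def d_def i[symmetric] .
    qed
    have 2: "(\<Prod>i<Suc k+1. 2 * of_nat i + 1 :: rat) = (\<Prod>i<k+1. 2 * of_nat i + 1) * d"
      by (simp add: d_def)
    have 3: "(\<Prod>i<3*Suc k+2. remove_p (2 * i + 1)) = (\<Prod>i<3*k+2. remove_p (2 * i + 1)) * (u * v * (3 * d))"
    proof -
      have "3 * Suc k + 2 = Suc (Suc (Suc (3 * k + 2)))" by simp
      moreover have "2 * (3 * k + 2) + 1 = 6 * k + 5" "2 * Suc (3 * k + 2) + 1 = 6 * k + 7"
        "2 * Suc (Suc (3 * k + 2)) + 1 = 6 * k + 9" by auto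
      ultimately show ?thesis unfolding w[symmetric] u_def v_def by (simp only: prod.lessThan_Suc mult.assoc)
    qed
    have e: "3 * 3 ^ Suc k * (P * d) ^ 3 * (D * (- 3 * u * v / d\<^sup>2)) = (- 3 * (u * v * (3 * d))) * (3 * 3 ^ k * P ^ 3 * D)" for P D :: rat
      using d by (simp add: power_mult_distrib power2_eq_square power3_eq_cube)
    show ?case unfolding 1 2 3 e Suc.IH by simp
  qed
  from this[of m] have "3 ^ m * (3 * Q ^ 3 * dixon_prod m) = 3 ^ m * ((- 1) ^ m * R)"
    unfolding Q_def[symmetric] R_def[symmetric] by (simp add: power_minus[of 3] mult_ac)
  then have QR: "3 * Q ^ 3 * dixon_prod m = (- 1) ^ m * R" by simp
  \<comment> \<open>Here 2n + 1 = p, so odd numbers below p are reflected to even ones.\<close>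
  have neg: "pcong 1 (2 * of_nat i + 1) (- 2 * of_nat (n - i))" if "i \<le> n" for i
  proof -
    have "2 * of_nat i + 1 = - 2 * of_nat (n - i) + of_nat p * (1 :: rat)"
      using that by (subst m) (simp add: n_def of_nat_diff)
    then show ?thesis using pcong_add_p[OF pint_numeral(3)] by (simp only:)
  qed
  have "pcong 1 Q (\<Prod>i<m+1. - 2 * of_nat (n - i))"
    unfolding Q_def using neg by (intro pcong_prod pint_mult) (auto simp: n_def)
  also have "(\<Prod>i<m+1. - 2 * of_nat (n - i)) = (- 2) ^ (m + 1) * (\<Prod>i<m+1. of_nat (n - i) :: rat)"
    by (simp only: prod.distrib prod_constant card_lessThan)
  finally have "pcong 1 (Q * fact m) ((- 2) ^ (m + 1) * (\<Prod>i<m+1. of_nat (n - i)) * fact m)"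
    by (rule pcong_mult_right) simp
  also have "\<dots> = (- 2) ^ (m + 1) * fact n"
    using prod_falling[of "m + 1" n] by (simp only: mult.assoc) (simp add: n_def)
  finally have Q: "pcong 1 (Q * fact m) ((- 2) ^ (m + 1) * fact n)" .
  have R: "pcong 1 R ((- 2) ^ n * fact n * (2 ^ m * fact m))"
  proof -
    \<comment> \<open>The odd numbers below p, then p itself, which \<open>remove_p\<close> turns
      into 1, then p + 2i for i from 1 to m.\<close>
    have "{..<3*m+2} = ({..<n} \<union> {n}) \<union> {n+1..n+m}" by (auto simp: n_def)
    then have "R = (\<Prod>i\<in>({..<n} \<union> {n}) \<union> {n+1..n+m}. remove_p (2 * i + 1))" unfolding R_def by (simp only:)
    also have "\<dots> = (\<Prod>i\<in>{..<n} \<union> {n}. remove_p (2 * i + 1)) * (\<Prod>i=n+1..n+m. remove_p (2 * i + 1))"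
      by (rule prod.union_disjoint) auto
    also have "(\<Prod>i\<in>{..<n} \<union> {n}. remove_p (2 * i + 1)) = (\<Prod>i<n. remove_p (2 * i + 1)) * (\<Prod>i\<in>{n}. remove_p (2 * i + 1))"
      by (rule prod.union_disjoint) auto
    also have "(\<Prod>i\<in>{n}. remove_p (2 * i + 1)) = 1"
    proof -
      have "2 * n + 1 = p" using m by (simp add: n_def)
      then show ?thesis by (simp add: remove_p_def)
    qed
    also have "(\<Prod>i<n. remove_p (2 * i + 1)) = (\<Prod>i<n. 2 * of_nat i + 1)"
    proof (intro prod.cong refl)
      fix i assume "i \<in> {..<n}"
      then have "2 * i + 1 \<noteq> p" using m by (auto simp: n_def)
      then show "remove_p (2 * i + 1) = 2 * of_nat i + 1" by (simp add: remove_p_def)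
    qed
    also have "(\<Prod>i=n+1..n+m. remove_p (2 * i + 1)) = (\<Prod>i=1..m. of_nat p + 2 * of_nat i)"
    proof (rule prod.reindex_bij_witness[of _ "\<lambda>i. i + n" "\<lambda>i. i - n"])
      fix i assume i: "i \<in> {n+1..n+m}"
      then have "n < i" by simp
      then have "2 * i + 1 = p + 2 * (i - n)" using m unfolding n_def by linarith
      moreover have "p + 2 * (i - n) \<noteq> p" using i by auto
      ultimately show "of_nat p + 2 * of_nat (i - n) = remove_p (2 * i + 1)"
        unfolding remove_p_def by (simp only: if_False of_nat_add of_nat_mult of_nat_numeral)
    qed auto
    finally have R: "R = (\<Prod>i<n. 2 * of_nat i + 1) * 1 * (\<Prod>i=1..m. of_nat p + 2 * of_nat i)" .
    have "pcong 1 R ((\<Prod>i<n. - 2 * of_nat (n - i)) * 1 * (\<Prod>i=1..m. 2 * of_nat i))"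
      unfolding R
    proof (intro pcong_mult pcong_prod pcong_refl pint_mult pint_prod)
      fix i assume "i \<in> {..<n}"
      then show "pcong 1 (2 * of_nat i + 1) (- 2 * of_nat (n - i))" by (intro neg) simp
    next
      fix i
      show "pcong 1 (of_nat p + 2 * of_nat i) (2 * of_nat i)"
        using pcong_add_p[of 1 "2 * of_nat i"] by (simp add: add.commute)
    qed auto
    also have "(\<Prod>i<n. - 2 * of_nat (n - i)) = (- 2) ^ n * (\<Prod>i<n. of_nat (n - i) :: rat)"
      by (simp only: prod.distrib prod_constant card_lessThan)
    also have "(\<Prod>i<n. of_nat (n - i)) = (fact n :: rat)" using prod_falling[of n n] by simp
    also have "(\<Prod>i=1..m. 2 * of_nat i) = (2 ^ m * fact m :: rat)"
      by (simp add: prod.distrib fact_prod)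
    finally show ?thesis by simp
  qed
  have lt: "m < p" "n < p" using m by (auto simp: n_def)
  define s where "s = (- 2 :: rat) ^ (m + 1)"
  have s: "punit s" unfolding s_def by (intro punit_power) simp
  have nf: "punit (fact n)" using lt by (intro punit_fact)
  \<comment> \<open>All powers of 2 and signs on the R side, together with the factor 4 from 12 = 4
    * 3, match the cube arising from Q^3.\<close>
  have s3: "4 * ((- 1) ^ m * ((- 2) ^ n * 2 ^ m)) = s ^ 3"
  proof -
    have "(- 2 :: rat) ^ n = - (2 ^ n)" by (simp add: n_def)
    moreover have "n = m + m + 1" by (simp add: n_def)
    then have "(2 :: rat) ^ n = 2 * (2 ^ m * 2 ^ m)" by (simp only: power_add power_one_right mult_ac)
    moreover have "s = - 2 * ((- 1) ^ m * 2 ^ m)"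
      unfolding s_def using power_mult_distrib[of "- 1 :: rat" 2 m] by simp
    moreover have "(- 1 :: rat) ^ m * (- 1) ^ m = 1" by (cases "even m") auto
    then have "4 * (e * (- (2 * (t * t)) * t)) = (- 2 * (e * t)) ^ 3" if "e = (- 1) ^ m" for e t :: rat
      unfolding that power3_eq_cube by (simp add: mult_ac)
    ultimately show ?thesis by (simp only:)
  qed
  have ip: "pint (dixon_prod m)" using S_sum_3_mod_4(2)[OF m] .
  have Qf: "pcong 1 ((Q * fact m) ^ 3) ((s * fact n) ^ 3)"
    using Q s by (intro pcong_power) (auto simp: s_def)
  have "pcong 1 ((s * fact n) ^ 3 * (12 * dixon_prod m)) ((Q * fact m) ^ 3 * (12 * dixon_prod m))"
    using ip by (intro pcong_mult_right pcong_sym[OF Qf] pint_mult) auto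
  also have "\<dots> = 4 * fact m ^ 3 * (3 * Q ^ 3 * dixon_prod m)"
    by (simp add: power_mult_distrib)
  also have "\<dots> = 4 * fact m ^ 3 * (- 1) ^ m * R" unfolding QR by simp
  also have "pcong 1 \<dots> (4 * fact m ^ 3 * (- 1) ^ m * ((- 2) ^ n * fact n * (2 ^ m * fact m)))"
    by (intro pcong_mult_left R pint_mult pint_power) auto
  also have "\<dots> = 4 * ((- 1) ^ m * ((- 2) ^ n * 2 ^ m)) * fact n * fact m ^ 4"
    by (simp add: power4_eq_xxxx power3_eq_cube)
  also have "\<dots> = s ^ 3 * fact n * fact m ^ 4" unfolding s3 ..
  finally have "pcong 1 (s ^ 3 * fact n * (fact n * fact n * (12 * dixon_prod m))) (s ^ 3 * fact n * fact m ^ 4)"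
    by (simp add: power_mult_distrib power3_eq_cube mult_ac)
  then have 1: "pcong 1 (fact n * fact n * (12 * dixon_prod m)) (fact m ^ 4)"
    by (rule pcong_unit_cancel[rotated]) (intro punit_mult punit_power s nf)
  \<comment> \<open>Since n is odd, Wilson's theorem gives (n!)^2 = 1 modulo p.\<close>
  have "p - 1 - n = n" using m by (simp add: n_def)
  then have "pcong 1 (fact n * fact n * (- 1) ^ n) (- 1)" using wilson_pcong[OF lt(2)] by simp
  then have "pcong 1 (- (fact n * fact n * (- 1) ^ n)) (- (- 1))" by (rule pcong_minus)
  then have "pcong 1 (fact n * fact n) 1" by (simp add: n_def)
  then have "pcong 1 (fact n * fact n * (12 * dixon_prod m)) (1 * (12 * dixon_prod m))"
    using ip by (intro pcong_mult_right pint_mult) auto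
  then show ?thesis using pcong_trans[OF pcong_sym 1] by simp
qed

section \<open>The fourth power of the Gamma value and the final assembly\<close>

lemma padic_Gamma_quarter_carrier: "padic_Gamma p (Zp_of_rat p (1 / 4)) \<in> carrier (Zp p)"
proof -
  have "pint (1 / 4)" by (intro pint_divide) auto
  from p_integral_Zp_carrier[OF this] padic_Gamma_extension[OF prime_p odd_p]
  show ?thesis by (auto simp: is_Gamma_extension_def)
qed

text \<open>The fourth power removes the sign of \<open>padic_Gamma_quarter\<close>.\<close>

lemma padic_Gamma_quarter_power:
  assumes "[4 * a = 1] (mod p)" "0 < a" "a < p"
  shows "pcong 1 (of_int (padic_Gamma p (Zp_of_rat p (1 / 4)) 1) ^ 4) (fact (a - 1) ^ 4)"
proof -
  have "((- 1) ^ a * fact (a - 1)) ^ 4 = (fact (a - 1) ^ 4 :: rat)"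
    by (cases "even a") (simp_all add: power_mult_distrib)
  moreover have "pcong 1 (of_int (padic_Gamma p (Zp_of_rat p (1 / 4)) 1) ^ 4) (((- 1) ^ a * fact (a - 1)) ^ 4)"
    by (intro pcong_power padic_Gamma_quarter assms pint_mult pint_power) auto
  ultimately show ?thesis by (simp only:)
qed

end

theorem theorem3:
  fixes p :: nat
  assumes "prime p" and "p > 3"
  shows
    "let S = (\<Sum>k=1..p-1. of_nat ((2 * k) choose k) ^ 3 * odd_harmonic 1 k / 64 ^ k);
         T = (\<Sum>k=1..p-1. of_nat ((2 * k) choose k) ^ 3 * odd_harmonic 2 k / 64 ^ k);
         G4 = padic_Gamma p (Zp_of_rat p (1 / 4)) [^]\<^bsub>Zp p\<^esub> (4 :: nat)
     in p_integral p S \<and> p_integral p T \<and>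
        ([p = 1] (mod 4) \<longrightarrow>
           Zp_cong p 2 (Zp_of_rat p S) \<zero>\<^bsub>Zp p\<^esub> \<and>
           Zp_cong p 1 (Zp_of_rat p T) (Zp_of_rat p (1 / 2 * euler_number (p - 3)) \<otimes>\<^bsub>Zp p\<^esub> G4)) \<and>
        ([p = 3] (mod 4) \<longrightarrow>
           Zp_cong p 2 (Zp_of_rat p S) (Zp_of_rat p (- of_nat p / 12) \<otimes>\<^bsub>Zp p\<^esub> G4) \<and>
           Zp_cong p 1 (Zp_of_rat p T) (Zp_of_rat p (- 1 / 16) \<otimes>\<^bsub>Zp p\<^esub> G4))"
proof -
  interpret prime_localization p using assms by unfold_locales
  let ?g = "padic_Gamma p (Zp_of_rat p (1 / 4))"
  let ?G4 = "?g [^]\<^bsub>Zp p\<^esub> (4 :: nat)"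
  note gc = padic_Gamma_quarter_carrier
  have one: "Zp_cong p 2 (Zp_of_rat p S_sum) \<zero>\<^bsub>Zp p\<^esub> \<and>
    Zp_cong p 1 (Zp_of_rat p T_sum) (Zp_of_rat p (1 / 2 * euler_number (p - 3)) \<otimes>\<^bsub>Zp p\<^esub> ?G4)"
    if "[p = 1] (mod 4)"
  proof -
    define m where "m = p div 4"
    have m: "p = 4 * m + 1" using that mult_div_mod_eq[of 4 p] by (simp add: cong_def m_def)
    let ?d = "1 / 2 * euler_number (p - 3)"
    have d: "pint ?d" by (intro pint_mult euler_number_pint pint_divide) auto
    \<comment> \<open>The residue of 1/4 modulo p is 3m + 1, so the Gamma value is (3m)! up to
      sign.\<close>
    have "4 * (3 * m + 1) = 1 + 3 * p" using m by simp
    moreover have "[1 + 3 * p = 1] (mod p)" unfolding cong_def by (rule mod_mult_self1)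
    ultimately have "[4 * (3 * m + 1) = 1] (mod p)" by (simp only:)
    moreover have "3 * m + 1 < p" using m p_gt_3 by simp
    ultimately have g: "pcong 1 (of_int (?g 1) ^ 4) (fact (3 * m) ^ 4)"
      using padic_Gamma_quarter_power[of "3 * m + 1"] by simp
    have "pcong 1 T_sum (?d * of_int (?g 1) ^ 4)"
      by (rule pcong_trans[OF T_sum_1_mod_4[OF m] pcong_mult_left[OF pcong_sym[OF g] d]])
    then have "Zp_cong p 1 (Zp_of_rat p T_sum) (Zp_of_rat p ?d \<otimes>\<^bsub>Zp p\<^esub> ?G4)"
      using Zp_of_rat_cong_mult_power[OF pint_T_sum d gc, of 0 4] by simp
    then show ?thesis using Zp_of_rat_cong_0[OF pint_S_sum S_sum_1_mod_4[OF m]] by blast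
  qed
  have three: "Zp_cong p 2 (Zp_of_rat p S_sum) (Zp_of_rat p (- of_nat p / 12) \<otimes>\<^bsub>Zp p\<^esub> ?G4) \<and>
    Zp_cong p 1 (Zp_of_rat p T_sum) (Zp_of_rat p (- 1 / 16) \<otimes>\<^bsub>Zp p\<^esub> ?G4)"
    if "[p = 3] (mod 4)"
  proof -
    define m where "m = p div 4"
    have m: "p = 4 * m + 3" using that mult_div_mod_eq[of 4 p] by (simp add: cong_def m_def)
    have d: "pint (- 1 / 12)" "pint (- 1 / 16)"
      unfolding minus_divide_left[symmetric] pint_minus_iff by (intro pint_divide; simp)+
    \<comment> \<open>The residue of 1/4 modulo p is m + 1, so the Gamma value is m! up to
      sign.\<close>
    have "4 * (m + 1) = 1 + 1 * p" using m by simp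
    moreover have "[1 + 1 * p = 1] (mod p)" unfolding cong_def by (rule mod_mult_self1)
    ultimately have "[4 * (m + 1) = 1] (mod p)" by (simp only:)
    moreover have "m + 1 < p" using m p_gt_3 by simp
    ultimately have g: "pcong 1 (fact m ^ 4) (of_int (?g 1) ^ 4)"
      using pcong_sym[OF padic_Gamma_quarter_power[of "m + 1"]] by simp
    have "pcong 1 T_sum (- 1 / 16 * of_int (?g 1) ^ 4)"
      by (rule pcong_trans[OF T_sum_3_mod_4[OF m] pcong_mult_left[OF g d(2)]])
    then have T: "Zp_cong p 1 (Zp_of_rat p T_sum) (Zp_of_rat p (- 1 / 16) \<otimes>\<^bsub>Zp p\<^esub> ?G4)"
      using Zp_of_rat_cong_mult_power[OF pint_T_sum d(2) gc, of 0 4] by simp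
    have "pcong 1 (- 1 / 12 * (12 * dixon_prod m)) (- 1 / 12 * of_int (?g 1) ^ 4)"
      by (rule pcong_mult_left[OF pcong_trans[OF dixon_prod_pcong[OF m] g] d(1)])
    \<comment> \<open>The explicit factor p lifts the evaluation of \<open>dixon_prod\<close> modulo
      p to the required modulus p^2.\<close>
    from pcong_p_mult[OF this]
    have "pcong 2 (- of_nat p * dixon_prod m) (of_nat p ^ 1 * (- 1 / 12) * of_int (?g 1) ^ 4)"
      by (simp add: numeral_2_eq_2)
    from pcong_trans[OF S_sum_3_mod_4(1)[OF m] this]
    have "pcong (Suc 1) S_sum (of_nat p ^ 1 * (- 1 / 12) * of_int (?g 1) ^ 4)"
      by (simp only: Suc_1)
    from Zp_of_rat_cong_mult_power[OF pint_S_sum d(1) gc this]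
    have "Zp_cong p 2 (Zp_of_rat p S_sum) (Zp_of_rat p (of_nat p ^ 1 * (- 1 / 12)) \<otimes>\<^bsub>Zp p\<^esub> ?G4)"
      by (simp only: Suc_1)
    moreover have "of_nat p ^ 1 * (- 1 / 12) = (- of_nat p / 12 :: rat)" by simp
    ultimately show ?thesis using T by (simp only:)
  qed
  show ?thesis unfolding Let_def using pint_S_sum pint_T_sum one three by blast
qed

end
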